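(* Let $a\ge b>0$, $r>0$, $s,t>0$, $0<\sigma\le\pi/2$, $\varepsilon=\sqrt{a^2-b^2}/a$. Consider the unbounded lattice of circles $C_0$ of radius $r$ whose centers are the points $i\,(s,0)+j\,(t\cos\sigma,t\sin\sigma)$, $i,j\in\mathbb{Z}$; each circle $C_0$ bounds a closed disk $K_0$. An oriented ellipse $C_1$ with semi-major axis $a$ and semi-minor axis $b$, bounding the closed region $K_1$, is thrown at random onto this lattice. Assume $2(a+r)\le\min(s,t)$, and that the ellipse can hit at most one circle of the lattice at the same time (i.e., up to a set of positions of measure zero, $K_1$ meets at most one of the disks $K_0$). Let $p_{n}$, $n\in\{0,2,4\}$, be the probability that the number of intersection points of $C_1$ with the circles of the lattice equals $n$; let $p_{\mathrm i}$ be the probability that, for some circle $C_0$ of the lattice, $C_1\subset K_0$ or $C_0\subset K_1$; and let $p_{\mathrm e}$ be the probability that $K_0\cap K_1=\emptyset$ for all disks $K_0$ of the lattice. Then $$p_0=1-\frac{2\pi^2r^2+2\pi^2ab+8\pi ra\,E(\varepsilon)-m_{\mathrm i}}{2\pi st\sin\sigma},\qquad p_2=\frac{2\pi^2r^2+2\pi^2ab-m_{\mathrm i}}{\pi st\sin\sigma},$$ $$p_4=\frac{8\pi ra\,E(\varepsilon)-2\pi^2r^2-2\pi^2ab+m_{\mathrm i}}{2\pi st\sin\sigma},\qquad p_{\mathrm i}=\frac{m_{\mathrm i}}{2\pi st\sin\sigma},$$ $$p_{\mathrm e}=1-\frac{2\pi^2r^2+2\pi^2ab+8\pi ra\,E(\varepsilon)}{2\pi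 st\sin\sigma},$$ where $$m_{\mathrm i}=\begin{cases}2\pi\big(\pi r^2+\pi ab-4ra\,E(\varepsilon)\big) & \text{if } a<r \text{ and } a^2/b\le r,\\ 2\pi F(\beta) & \text{if } a<r<a^2/b,\\ 0 & \text{if } b\le r\le a,\\ 2\pi\widetilde F(\alpha) & \text{if } b^2/a<r<b,\\ 2\pi\big(\pi r^2+\pi ab-4ra\,E(\varepsilon)\big) & \text{if } r<b \text{ and } r\le b^2/a,\end{cases}$$ with $$F(\phi)=2r^2\phi+2ab\arctan\Big(\frac ba\tan\phi\Big)-4ra\,E(\phi,\varepsilon)+\frac{ra\,\varepsilon^2\sin 2\phi}{\sqrt{1-\varepsilon^2\sin^2\phi}},$$ $$\widetilde F(\phi)=\pi r^2+\pi ab-4ra\,E(\varepsilon)-F(\phi),$$ $$\alpha=\arctan\frac{\sqrt{r^2a^2-b^4}}{b\sqrt{b^2-r^2}},\qquad \beta=\arctan\frac{a\sqrt{r^2-a^2}}{\sqrt{a^4-r^2b^2}}.$$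
   Context: Random throw: the center $M_1=(x_1,y_1)$ of $C_1$ is uniformly distributed in the parallelogram $\mathcal P=\{(x,y)\in\mathbb{R}^2: 0\le y\le t\sin\sigma,\ y\cot\sigma\le x\le s+y\cot\sigma\}$, and the angle $\psi$ between the $x$-axis of the fixed frame and the $\xi$-axis of the frame attached to $C_1$ (with origin $M_1$) is uniformly distributed in $[0,2\pi]$ and independent of $M_1$. Intersection points are real intersection points, counted with intersection multiplicity. $E(\phi,\varepsilon)=\int_0^{\phi}\sqrt{1-\varepsilon^2\sin^2\theta}\,\mathrm d\theta$ is the incomplete elliptic integral of the second kind, and $E(\varepsilon)=E(\pi/2,\varepsilon)$ the complete one. *)

theory Defs
  imports "HOL-Probability.Probability"
begin

section \<open>The lattice of circles and the thrown ellipse\<close>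

definition lattice_points :: "real \<Rightarrow> real \<Rightarrow> real \<Rightarrow> (real \<times> real) set" where
  "lattice_points s t \<sigma> =
    {of_int i *\<^sub>R (s, 0) + of_int j *\<^sub>R (t * cos \<sigma>, t * sin \<sigma>) | i j :: int. True}"

definition parallelogram :: "real \<Rightarrow> real \<Rightarrow> real \<Rightarrow> (real \<times> real) set" where
  "parallelogram s t \<sigma> =
    {(x, y). 0 \<le> y \<and> y \<le> t * sin \<sigma> \<and> y * cot \<sigma> \<le> x \<and> x \<le> s + y * cot \<sigma>}"

text \<open>Position of a point given by its coordinates in the moving frame, where \<open>M\<close> is the origin
  of that frame and \<open>\<psi>\<close> the angle from the \<open>x\<close>-axis to the \<open>\<xi>\<close>-axis.\<close>

definition place :: "real \<times> real \<Rightarrow> real \<Rightarrow> real \<times> real \<Rightarrow> real \<times> real" where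
  "place M \<psi> = (\<lambda>(\<xi>, \<eta>). M + (\<xi> * cos \<psi> - \<eta> * sin \<psi>, \<xi> * sin \<psi> + \<eta> * cos \<psi>))"

definition ellipse :: "real \<Rightarrow> real \<Rightarrow> real \<times> real \<Rightarrow> real \<Rightarrow> (real \<times> real) set" where
  "ellipse a b M \<psi> = place M \<psi> ` {(\<xi>, \<eta>). (\<xi> / a)\<^sup>2 + (\<eta> / b)\<^sup>2 = 1}"

definition ellipse_region :: "real \<Rightarrow> real \<Rightarrow> real \<times> real \<Rightarrow> real \<Rightarrow> (real \<times> real) set" where
  "ellipse_region a b M \<psi> = place M \<psi> ` {(\<xi>, \<eta>). (\<xi> / a)\<^sup>2 + (\<eta> / b)\<^sup>2 \<le> 1}"

section \<open>Intersection points counted with multiplicity\<close>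

text \<open>The order is \<open>\<infinity>\<close> if all derivatives vanish at the point.\<close>

definition vanishing_order :: "(real \<Rightarrow> real) \<Rightarrow> real \<Rightarrow> enat" where
  "vanishing_order f x = (INF k\<in>{k. (deriv ^^ k) f x \<noteq> 0}. enat k)"

definition ellipse_param :: "real \<Rightarrow> real \<Rightarrow> real \<times> real \<Rightarrow> real \<Rightarrow> real \<Rightarrow> real \<times> real" where
  "ellipse_param a b M \<psi> \<theta> = place M \<psi> (a * cos \<theta>, b * sin \<theta>)"

text \<open>Both curves are smooth, so their intersection multiplicity at a common point \<open>p\<close> is the order
  of vanishing at \<open>p\<close> of the equation of the circle (centre \<open>c\<close>, radius \<open>r\<close>) along a regular
  parametrization of the ellipse.\<close>

definition intersection_multiplicity ::
    "real \<Rightarrow> real \<Rightarrow> real \<Rightarrow> real \<times> real \<Rightarrow> real \<Rightarrow> real \<times> real \<Rightarrow> real \<times> real \<Rightarrow> enat" where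
  "intersection_multiplicity a b r M \<psi> c p =
    vanishing_order (\<lambda>\<theta>. (dist (ellipse_param a b M \<psi> \<theta>) c)\<^sup>2 - r\<^sup>2)
      (THE \<theta>. 0 \<le> \<theta> \<and> \<theta> < 2 * pi \<and> ellipse_param a b M \<psi> \<theta> = p)"

text \<open>The explicit value \<open>\<infinity>\<close> is needed because a sum over an infinite set is \<open>0\<close> by convention; it
  occurs exactly when the ellipse coincides with a circle of the lattice.\<close>

definition num_intersections ::
    "real \<Rightarrow> real \<Rightarrow> real \<Rightarrow> real \<Rightarrow> real \<Rightarrow> real \<Rightarrow> real \<times> real \<Rightarrow> real \<Rightarrow> enat" where
  "num_intersections a b r s t \<sigma> M \<psi> =
    (let I = (SIGMA c:lattice_points s t \<sigma>. ellipse a b M \<psi> \<inter> sphere c r)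
     in if finite I then \<Sum>(c, p)\<in>I. intersection_multiplicity a b r M \<psi> c p else \<infinity>)"

section \<open>The random throw\<close>

text \<open>The product measure expresses the independence of the centre and the angle. It is completed
  so that subsets of null sets are measurable; the probabilities of Borel events do not change.\<close>

definition throw :: "real \<Rightarrow> real \<Rightarrow> real \<Rightarrow> ((real \<times> real) \<times> real) measure" where
  "throw s t \<sigma> =
    completion (uniform_measure lborel (parallelogram s t \<sigma>) \<Otimes>\<^sub>M uniform_measure lborel {0..2 * pi})"

definition meets_at_most_one ::
    "real \<Rightarrow> real \<Rightarrow> real \<Rightarrow> real \<Rightarrow> real \<Rightarrow> real \<Rightarrow> real \<times> real \<Rightarrow> real \<Rightarrow> bool" where
  "meets_at_most_one a b r s t \<sigma> M \<psi> \<longleftrightarrow>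
    (\<forall>c\<in>lattice_points s t \<sigma>. \<forall>c'\<in>lattice_points s t \<sigma>.
      ellipse_region a b M \<psi> \<inter> cball c r \<noteq> {} \<longrightarrow> ellipse_region a b M \<psi> \<inter> cball c' r \<noteq> {} \<longrightarrow> c = c')"

definition p_num :: "real \<Rightarrow> real \<Rightarrow> real \<Rightarrow> real \<Rightarrow> real \<Rightarrow> real \<Rightarrow> enat \<Rightarrow> real" where
  "p_num a b r s t \<sigma> n = \<P>((M, \<psi>) in throw s t \<sigma>. num_intersections a b r s t \<sigma> M \<psi> = n)"

definition p_incl :: "real \<Rightarrow> real \<Rightarrow> real \<Rightarrow> real \<Rightarrow> real \<Rightarrow> real \<Rightarrow> real" where
  "p_incl a b r s t \<sigma> = \<P>((M, \<psi>) in throw s t \<sigma>.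
    \<exists>c\<in>lattice_points s t \<sigma>. ellipse a b M \<psi> \<subseteq> cball c r \<or> sphere c r \<subseteq> ellipse_region a b M \<psi>)"

definition p_ext :: "real \<Rightarrow> real \<Rightarrow> real \<Rightarrow> real \<Rightarrow> real \<Rightarrow> real \<Rightarrow> real" where
  "p_ext a b r s t \<sigma> = \<P>((M, \<psi>) in throw s t \<sigma>.
    \<forall>c\<in>lattice_points s t \<sigma>. cball c r \<inter> ellipse_region a b M \<psi> = {})"

section \<open>Elliptic integrals and the measure of the inclusions\<close>

definition ellE :: "real \<Rightarrow> real \<Rightarrow> real" where
  "ellE \<phi> \<epsilon> = integral {0..\<phi>} (\<lambda>\<theta>. sqrt (1 - \<epsilon>\<^sup>2 * (sin \<theta>)\<^sup>2))"

abbreviation complete_ellE :: "real \<Rightarrow> real" where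
  "complete_ellE \<epsilon> \<equiv> ellE (pi / 2) \<epsilon>"

definition ecc :: "real \<Rightarrow> real \<Rightarrow> real" where
  "ecc a b = sqrt (a\<^sup>2 - b\<^sup>2) / a"

definition incl_F :: "real \<Rightarrow> real \<Rightarrow> real \<Rightarrow> real \<Rightarrow> real" where
  "incl_F a b r \<phi> = 2 * r\<^sup>2 * \<phi> + 2 * a * b * arctan (b / a * tan \<phi>) - 4 * r * a * ellE \<phi> (ecc a b)
    + r * a * (ecc a b)\<^sup>2 * sin (2 * \<phi>) / sqrt (1 - (ecc a b)\<^sup>2 * (sin \<phi>)\<^sup>2)"

definition incl_F_tilde :: "real \<Rightarrow> real \<Rightarrow> real \<Rightarrow> real \<Rightarrow> real" where
  "incl_F_tilde a b r \<phi> =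
    pi * r\<^sup>2 + pi * a * b - 4 * r * a * complete_ellE (ecc a b) - incl_F a b r \<phi>"

definition angle_alpha :: "real \<Rightarrow> real \<Rightarrow> real \<Rightarrow> real" where
  "angle_alpha a b r = arctan (sqrt (r\<^sup>2 * a\<^sup>2 - b ^ 4) / (b * sqrt (b\<^sup>2 - r\<^sup>2)))"

definition angle_beta :: "real \<Rightarrow> real \<Rightarrow> real \<Rightarrow> real" where
  "angle_beta a b r = arctan (a * sqrt (r\<^sup>2 - a\<^sup>2) / sqrt (a ^ 4 - r\<^sup>2 * b\<^sup>2))"

text \<open>For \<open>0 < b \<le> a\<close>, the last branch is the case \<open>r < b \<and> r \<le> b\<^sup>2 / a\<close>.\<close>

definition m_incl :: "real \<Rightarrow> real \<Rightarrow> real \<Rightarrow> real" where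
  "m_incl a b r =
    (if a < r \<and> a\<^sup>2 / b \<le> r then
       2 * pi * (pi * r\<^sup>2 + pi * a * b - 4 * r * a * complete_ellE (ecc a b))
     else if a < r \<and> r < a\<^sup>2 / b then 2 * pi * incl_F a b r (angle_beta a b r)
     else if b \<le> r \<and> r \<le> a then 0
     else if b\<^sup>2 / a < r \<and> r < b then 2 * pi * incl_F_tilde a b r (angle_alpha a b r)
     else 2 * pi * (pi * r\<^sup>2 + pi * a * b - 4 * r * a * complete_ellE (ecc a b)))"

end

theory Submission
  imports Defs
begin

text \<open>
  In the moving frame the thrown ellipse stands still and the circles move; the circle around the
  lattice point \<open>c\<close> then has its centre at \<open>unplace M \<psi> c\<close>. Since the translates of the parallelogram by the
  lattice tile the plane and rotations preserve area, the expected number of lattice points whose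
  moved position lies in a planar set \<open>B\<close> is the area of \<open>B\<close> divided by \<open>s t sin \<sigma>\<close>. As at most one
  circle is hit at a time, this number is almost surely \<open>0\<close> or \<open>1\<close> as long as \<open>B\<close> only contains
  positions that hit the ellipse. Its expectation is then the probability that some lattice point
  falls into \<open>B\<close> (\<open>prob_throw\<close>). What remains is to compute areas of sets of positions of the centre
  of a single circle of radius \<open>r\<close> relative to a fixed ellipse with perimeter \<open>L = 4 a E(\<epsilon>)\<close>.

  The positions where disc and elliptical region meet form the outer parallel body of the ellipse, of area
  \<open>H = \<pi> a b + \<pi> r\<^sup>2 + r L\<close> (\<open>area_hits\<close>). The nested positions form an inner parallel body, or the
  body cut out by all discs of radius \<open>r\<close> around points of the ellipse; their area is
  \<open>I = m\<^sub>i / (2 \<pi>)\<close> (\<open>area_inclusion\<close>). All these convex bodies have the two axes as symmetry axes. With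
  the direction \<open>\<phi>\<close> of the outward normal as parameter and
  \<open>h(\<phi>) = sqrt (a\<^sup>2 cos\<^sup>2 \<phi> + b\<^sup>2 sin\<^sup>2 \<phi>)\<close> as support function of the ellipse, their boundaries are pieces
  of the parallel curves \<open>((a\<^sup>2/h + \<rho>) cos \<phi>, (b\<^sup>2/h + \<rho>) sin \<phi>)\<close> with \<open>\<rho> = r\<close> or \<open>\<rho> = - r\<close>, up to a
  reflection in the origin. For intermediate \<open>r\<close> the parallel curve has cusps, and only its part from one
  axis to the first point on the other axis bounds the body; the normal there has the direction
  \<open>\<alpha>\<close> or \<open>\<beta>\<close>. That these points do belong to the bodies is read off from an identity for their
  distance to the points of the ellipse (\<open>distance_to_curve\<close>).

  The number \<open>N\<close> of intersection points satisfies the formula of Poincare for one fixed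
  orientation: the integral of \<open>N\<close> over all positions is \<open>4 r L\<close> (\<open>integral_num_crossings\<close>). To see this,
  \<open>N\<close> is approximated by the number of edges of an inscribed polygon whose endpoints are separated by
  the circle. An edge of length \<open>d\<close> is separated by the circles whose centres lie in the symmetric
  difference of two discs at distance \<open>d\<close>, a set of area \<open>4 r d\<close> up to lower order terms.

  Almost every circle crosses the ellipse transversally. Then every multiplicity is \<open>1\<close>, \<open>N\<close> is even
  because it is a number of sign changes around a closed curve, \<open>N\<close> is at most \<open>4\<close> because the
  intersections are roots of a quartic, and among the hitting positions \<open>N = 0\<close> means nested
  (\<open>inclusion_iff_no_crossings\<close>). If \<open>A\<^sub>2\<close> and \<open>A\<^sub>4\<close> are the areas of the positions with two and four
  intersections, then \<open>A\<^sub>2 + A\<^sub>4 = H - I\<close> and \<open>2 A\<^sub>2 + 4 A\<^sub>4 = 4 r L\<close>, which determines both.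
\<close>

section \<open>Rotations and shears preserve area\<close>

definition rot :: "real \<Rightarrow> real \<times> real \<Rightarrow> real \<times> real" where
  "rot \<psi> v = (fst v * cos \<psi> - snd v * sin \<psi>, fst v * sin \<psi> + snd v * cos \<psi>)"

lemma rot_measurable [measurable]: "rot \<psi> \<in> borel_measurable borel"
  unfolding rot_def borel_prod[symmetric] by measurable

lemma rot_rot: "rot \<phi> (rot \<psi> v) = rot (\<phi> + \<psi>) v"
  by (simp add: rot_def cos_add sin_add algebra_simps)

lemma rot_0 [simp]: "rot 0 v = v"
  by (simp add: rot_def)

lemma emeasure_lborel_shift:
  fixes S :: "'a::euclidean_space set"
  assumes "S \<in> sets borel"
  shows "emeasure lborel {x. k + x \<in> S} = emeasure lborel S"
proof -
  have "emeasure lborel S = emeasure (distr lborel borel ((+) k)) S"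
    by (simp add: lborel_distr_plus)
  also have "\<dots> = emeasure lborel {x. k + x \<in> S}"
    using assms by (subst emeasure_distr) (auto simp: vimage_def)
  finally show ?thesis by simp
qed

lemma lborel_shear1: "distr lborel borel (\<lambda>v. (k * snd v + fst v, snd v)) = (lborel :: (real \<times> real) measure)"
proof (rule measure_eqI)
  fix A :: "(real \<times> real) set"
  assume "A \<in> sets (distr lborel borel (\<lambda>v. (k * snd v + fst v, snd v)))"
  then have A[measurable]: "A \<in> sets borel" by simp
  have m[measurable]: "(\<lambda>v::real\<times>real. (k * snd v + fst v, snd v)) \<in> borel_measurable borel"
    unfolding borel_prod[symmetric] by measurable
  have A': "A \<in> sets (lborel \<Otimes>\<^sub>M lborel)" unfolding lborel_prod using A by simp
  have B': "{v. (k * snd v + fst v, snd v) \<in> A} \<in> sets (lborel \<Otimes>\<^sub>M lborel)"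
    unfolding lborel_prod using measurable_sets[OF m A] by (simp add: vimage_def)
  have "emeasure (distr lborel borel (\<lambda>v. (k * snd v + fst v, snd v))) A
      = emeasure (lborel \<Otimes>\<^sub>M lborel) {v. (k * snd v + fst v, snd v) \<in> A}"
    by (subst emeasure_distr) (auto simp: vimage_def lborel_prod)
  also have "\<dots> = (\<integral>\<^sup>+ y. emeasure lborel {x. k * y + x \<in> (\<lambda>x. (x, y)) -` A} \<partial>lborel)"
    by (subst lborel_pair.emeasure_pair_measure_alt2[OF B']) (simp add: vimage_def)
  also have "\<dots> = (\<integral>\<^sup>+ y. emeasure lborel ((\<lambda>x. (x, y)) -` A) \<partial>lborel)"
    using sets_Pair2[OF A'] by (intro nn_integral_cong emeasure_lborel_shift) auto
  also have "\<dots> = emeasure lborel A"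
    by (subst lborel_pair.emeasure_pair_measure_alt2[OF A', symmetric]) (simp add: lborel_prod)
  finally show "emeasure (distr lborel borel (\<lambda>v. (k * snd v + fst v, snd v))) A = emeasure lborel A" .
qed simp

lemma distr_lborel_comp:
  fixes f g :: "real \<times> real \<Rightarrow> real \<times> real"
  assumes "distr lborel borel f = lborel" "distr lborel borel g = lborel"
    and [measurable]: "f \<in> borel_measurable borel" "g \<in> borel_measurable borel"
  shows "distr lborel borel (\<lambda>v. f (g v)) = lborel"
proof -
  have "distr lborel borel (\<lambda>v. f (g v)) = distr (distr lborel borel g) borel f"
    by (subst distr_distr) (auto simp: comp_def)
  then show ?thesis using assms by simp
qed

lemma lborel_shear2: "distr lborel borel (\<lambda>v. (fst v, k * fst v + snd v)) = (lborel :: (real \<times> real) measure)"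
proof -
  let ?swap = "\<lambda>v :: real \<times> real. (snd v, fst v)"
  let ?shear = "\<lambda>v :: real \<times> real. (k * snd v + fst v, snd v)"
  have m [measurable]: "?swap \<in> borel_measurable borel" "?shear \<in> borel_measurable borel"
    unfolding borel_prod[symmetric] by measurable
  have "distr (lborel \<Otimes>\<^sub>M lborel) (lborel \<Otimes>\<^sub>M lborel) ?swap = (lborel \<Otimes>\<^sub>M lborel :: (real \<times> real) measure)"
    using lborel_pair.distr_pair_swap[where 'a = real and 'b = real] by (simp add: case_prod_beta')
  then have swap: "distr lborel borel ?swap = lborel"
    unfolding lborel_prod by (metis distr_cong sets_lborel)
  have "distr lborel borel (\<lambda>v. ?shear (?swap v)) = lborel"
    by (rule distr_lborel_comp[OF lborel_shear1 swap m(2,1)])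
  then have "distr lborel borel (\<lambda>v. ?swap (?shear (?swap v))) = lborel"
    by (rule distr_lborel_comp[OF swap]) measurable
  then show ?thesis by simp
qed

text \<open>
  A rotation is a product of three shears, in the directions of the \<open>x\<close>-axis, the \<open>y\<close>-axis and again
  the \<open>x\<close>-axis. The outer two have slope \<open>- tan (\<psi> / 2)\<close>, which needs \<open>\<psi>\<close> to be no odd multiple
  of \<open>\<pi>\<close>.
\<close>

lemma lborel_rot_by_shears:
  assumes "cos (\<psi> / 2) \<noteq> 0"
  shows "distr lborel borel (rot \<psi>) = lborel"
proof -
  let ?k = "- tan (\<psi> / 2)"
  let ?f = "\<lambda>v::real\<times>real. (?k * snd v + fst v, snd v)"
  let ?g = "\<lambda>v::real\<times>real. (fst v, sin \<psi> * fst v + snd v)"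
  have [measurable]: "?f \<in> borel_measurable borel" "?g \<in> borel_measurable borel"
    unfolding borel_prod[symmetric] by measurable
  have s: "sin \<psi> = 2 * sin (\<psi>/2) * cos (\<psi>/2)" and c: "cos \<psi> = 1 - 2 * (sin (\<psi>/2))\<^sup>2"
    using sin_double[of "\<psi>/2"] cos_double_sin[of "\<psi>/2"] by auto
  have c': "(cos (\<psi>/2))\<^sup>2 = 1 - (sin (\<psi>/2))\<^sup>2" using sin_cos_squared_add[of "\<psi>/2"] by linarith
  have kc: "1 + ?k * sin \<psi> = cos \<psi>"
    using assms unfolding tan_def s c by (simp add: power2_eq_square)
  have kk: "?k * (sin \<psi> * ?k + 1) + ?k = - sin \<psi>"
  proof -
    have "?k * (sin \<psi> * ?k + 1) + ?k = ?k * (1 + (1 + ?k * sin \<psi>))" by (simp add: algebra_simps)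
    also have "\<dots> = ?k * (2 * (cos (\<psi>/2))\<^sup>2)" unfolding kc c c' by simp
    also have "\<dots> = - sin \<psi>" using assms unfolding tan_def s by (simp add: power2_eq_square)
    finally show ?thesis .
  qed
  have "rot \<psi> v = ?f (?g (?f v))" for v
  proof -
    have "?k * (sin \<psi> * (?k * snd v + fst v) + snd v) + (?k * snd v + fst v)
        = fst v * (1 + ?k * sin \<psi>) + snd v * (?k * (sin \<psi> * ?k + 1) + ?k)" by algebra
    moreover have "sin \<psi> * (?k * snd v + fst v) + snd v = fst v * sin \<psi> + snd v * (1 + ?k * sin \<psi>)" by algebra
    ultimately show ?thesis unfolding rot_def using kc kk by simp
  qed
  then have e: "rot \<psi> = (\<lambda>v. ?f (?g (?f v)))" by auto
  have gf: "distr lborel borel (\<lambda>v. ?g (?f v)) = lborel"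
    using distr_lborel_comp[OF lborel_shear2[of "sin \<psi>"] lborel_shear1[of ?k]] by measurable
  show ?thesis unfolding e
    by (rule distr_lborel_comp[OF lborel_shear1[of ?k] gf]) measurable
qed

text \<open>An excluded angle is halved: both halves are covered by the product of shears.\<close>

lemma lborel_rot: "distr lborel borel (rot \<psi>) = lborel"
proof (cases "cos (\<psi> / 2) = 0")
  case True
  then have "cos ((\<psi>/2) / 2) \<noteq> 0"
    using cos_double_cos[of "\<psi>/2/2"] by auto
  then have "distr lborel borel (\<lambda>v. rot (\<psi>/2) (rot (\<psi>/2) v)) = lborel"
    using distr_lborel_comp[OF lborel_rot_by_shears lborel_rot_by_shears rot_measurable rot_measurable] by blast
  then show ?thesis by (simp add: rot_rot)
qed (rule lborel_rot_by_shears)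

lemma emeasure_rot_vimage:
  assumes "B \<in> sets borel"
  shows "emeasure lborel (rot \<psi> -` B) = emeasure lborel B"
proof -
  have "emeasure lborel B = emeasure (distr lborel borel (rot \<psi>)) B" by (simp add: lborel_rot)
  also have "\<dots> = emeasure lborel (rot \<psi> -` B)" using assms by (subst emeasure_distr) auto
  finally show ?thesis by simp
qed

lemma nn_integral_lborel_reflect:
  fixes f :: "'a::euclidean_space \<Rightarrow> ennreal"
  assumes [measurable]: "f \<in> borel_measurable borel"
  shows "(\<integral>\<^sup>+ x. f (c - x) \<partial>lborel) = (\<integral>\<^sup>+ x. f x \<partial>lborel)"
proof -
  have "(\<integral>\<^sup>+ x. f x \<partial>lborel) = (\<integral>\<^sup>+ x. f x \<partial>density (distr lborel borel (\<lambda>x. c + (-1) *\<^sub>R x)) (\<lambda>_. \<bar>-1::real\<bar> ^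
      DIM('a)))"
    by (subst lborel_affine[of "-1" c]) auto
  also have "\<dots> = (\<integral>\<^sup>+ x. f (c - x) \<partial>lborel)"
    by (subst nn_integral_density) (auto simp: nn_integral_distr)
  finally show ?thesis by simp
qed

section \<open>Averaging over the lattice\<close>

lemma countable_lattice_points: "countable (lattice_points s t \<sigma>)"
proof -
  have "lattice_points s t \<sigma> = range (\<lambda>(i::int, j::int). of_int i *\<^sub>R (s, 0) + of_int j *\<^sub>R (t * cos \<sigma>, t * sin \<sigma>))"
    unfolding lattice_points_def by auto
  then show ?thesis by (auto intro: countable_image)
qed

text \<open>This is the inverse of \<open>place M \<psi>\<close>.\<close>

definition unplace :: "real \<times> real \<Rightarrow> real \<Rightarrow> real \<times> real \<Rightarrow> real \<times> real" where
  "unplace M \<psi> c = rot (- \<psi>) (c - M)"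

locale lattice =
  fixes s t \<sigma> :: real
  assumes s_pos: "0 < s" and t_pos: "0 < t" and sigma_pos: "0 < \<sigma>" and sigma_le: "\<sigma> \<le> pi / 2"
begin

abbreviation "\<Lambda> \<equiv> lattice_points s t \<sigma>"
abbreviation "cell \<equiv> parallelogram s t \<sigma>"

lemma sin_pos: "0 < sin \<sigma>"
  using sigma_pos sigma_le by (intro sin_gt_zero) (auto intro: order_le_less_trans)

lemma height_pos: "0 < t * sin \<sigma>"
  using sin_pos t_pos by simp

definition half_open_cell :: "(real \<times> real) set" where
  "half_open_cell = (\<lambda>v. (- cot \<sigma> * snd v + fst v, snd v)) -` ({0..<s} \<times> {0..<t * sin \<sigma>})"

lemma shear_measurable:
  fixes k :: real
  shows "(\<lambda>v. (k * snd v + fst v, snd v)) \<in> borel_measurable borel"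
  unfolding borel_prod[symmetric] by measurable

lemma cell_eq: "cell = (\<lambda>v. (- cot \<sigma> * snd v + fst v, snd v)) -` ({0..s} \<times> {0..t * sin \<sigma>})"
  by (auto simp: parallelogram_def algebra_simps)

lemma emeasure_shear1:
  fixes k :: real
  assumes "B \<in> sets borel"
  shows "emeasure lborel ((\<lambda>v. (k * snd v + fst v, snd v)) -` B) = emeasure lborel B"
proof -
  have "emeasure lborel B = emeasure (distr lborel borel (\<lambda>v. (k * snd v + fst v, snd v))) B"
    by (simp add: lborel_shear1)
  also have "\<dots> = emeasure lborel ((\<lambda>v. (k * snd v + fst v, snd v)) -` B)"
    using assms shear_measurable by (subst emeasure_distr) auto
  finally show ?thesis by simp
qed

lemma emeasure_rect:
  assumes "A \<in> sets borel" "B \<in> sets borel"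
  shows "emeasure lborel (A \<times> B :: (real \<times> real) set) = emeasure lborel A * emeasure lborel B"
  using assms by (subst lborel_prod[symmetric], subst lborel.emeasure_pair_measure_Times) auto

lemma rect_sets: "A \<in> sets borel \<Longrightarrow> B \<in> sets borel \<Longrightarrow> (A \<times> B :: (real \<times> real) set) \<in> sets borel"
  unfolding borel_prod[symmetric] by auto

lemma emeasure_cell: "emeasure lborel cell = ennreal (s * t * sin \<sigma>)"
  and emeasure_half_open_cell: "emeasure lborel half_open_cell = ennreal (s * t * sin \<sigma>)"
  and cell_sets [measurable]: "cell \<in> sets borel"
  and half_open_cell_sets [measurable]: "half_open_cell \<in> sets borel"
proof -
  have A: "{0..s} \<times> {0..t * sin \<sigma>} \<in> sets borel" and B: "{0..<s} \<times> {0..<t * sin \<sigma>} \<in> sets borel"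
    by (intro rect_sets; simp)+
  show "cell \<in> sets borel" "half_open_cell \<in> sets borel"
    unfolding cell_eq half_open_cell_def by (rule measurable_sets_borel[OF shear_measurable A], rule
        measurable_sets_borel[OF shear_measurable B])
  show "emeasure lborel cell = ennreal (s * t * sin \<sigma>)" "emeasure lborel half_open_cell = ennreal (s * t * sin \<sigma>)"
    unfolding cell_eq half_open_cell_def emeasure_shear1[OF A] emeasure_shear1[OF B]
    using s_pos height_pos by (simp_all add: emeasure_rect ennreal_mult'[symmetric] mult.assoc)
qed

lemma AE_half_open_cell: "AE x in lborel. x \<in> cell \<longleftrightarrow> x \<in> half_open_cell"
proof -
  have sub: "half_open_cell \<subseteq> cell" by (auto simp: half_open_cell_def cell_eq)
  have "emeasure lborel (cell - half_open_cell) = 0"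
    using sub by (subst emeasure_Diff) (auto simp: emeasure_cell emeasure_half_open_cell)
  then have "AE x in lborel. x \<notin> cell - half_open_cell"
    by (intro AE_not_in) (auto intro!: null_setsI)
  then show ?thesis by eventually_elim (use sub in auto)
qed

text \<open>
  The shear \<open>(x, y) \<mapsto> (x - y cot \<sigma>, y)\<close> turns the lattice into the rectangular one with sides \<open>s\<close> and
  \<open>t sin \<sigma>\<close>, where the translate is found by rounding up each coordinate separately.
\<close>

lemma unique_lattice_translate: "\<exists>!c. c \<in> \<Lambda> \<and> c - z \<in> half_open_cell"
proof -
  let ?h = "t * sin \<sigma>"
  let ?L = "\<lambda>(i::int) (j::int). of_int i *\<^sub>R (s, 0) + of_int j *\<^sub>R (t * cos \<sigma>, t * sin \<sigma>)"
  have sn: "sin \<sigma> \<noteq> 0" using sin_pos by simp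
  have cs: "cot \<sigma> * sin \<sigma> = cos \<sigma>"
    using sn by (simp add: cot_def)
  have mem: "?L i j - z \<in> half_open_cell \<longleftrightarrow>
      i = \<lceil>(fst z - cot \<sigma> * snd z) / s\<rceil> \<and> j = \<lceil>snd z / ?h\<rceil>" for i j
  proof -
    have "?L i j - z \<in> half_open_cell \<longleftrightarrow>
       (0 \<le> of_int i * s - (fst z - cot \<sigma> * snd z) \<and> of_int i * s - (fst z - cot \<sigma> * snd z) < s)
       \<and> (0 \<le> of_int j * ?h - snd z \<and> of_int j * ?h - snd z < ?h)"
      unfolding half_open_cell_def using cs by (simp add: algebra_simps)
    also have "(0 \<le> of_int i * s - (fst z - cot \<sigma> * snd z) \<and> of_int i * s - (fst z - cot \<sigma> * snd z) < s)
       \<longleftrightarrow> i = \<lceil>(fst z - cot \<sigma> * snd z) / s\<rceil>"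
    proof -
      have "i = \<lceil>(fst z - cot \<sigma> * snd z) / s\<rceil>
          \<longleftrightarrow> of_int i - 1 < (fst z - cot \<sigma> * snd z) / s \<and> (fst z - cot \<sigma> * snd z) / s \<le> of_int i"
        using ceiling_eq_iff[of "(fst z - cot \<sigma> * snd z) / s" i] by metis
      then show ?thesis using s_pos by (auto simp: field_simps)
    qed
    also have "(0 \<le> of_int j * ?h - snd z \<and> of_int j * ?h - snd z < ?h) \<longleftrightarrow> j = \<lceil>snd z / ?h\<rceil>"
    proof -
      have "j = \<lceil>snd z / ?h\<rceil> \<longleftrightarrow> of_int j - 1 < snd z / ?h \<and> snd z / ?h \<le> of_int j"
        using ceiling_eq_iff[of "snd z / ?h" j] by metis
      also have "\<dots> \<longleftrightarrow> (of_int j - 1) * ?h < snd z \<and> snd z \<le> of_int j * ?h"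
        using height_pos by (simp add: pos_less_divide_eq pos_divide_le_eq)
      finally show ?thesis by (auto simp: algebra_simps)
    qed
    finally show ?thesis .
  qed
  show ?thesis
  proof (rule ex1I)
    show "?L \<lceil>(fst z - cot \<sigma> * snd z) / s\<rceil> \<lceil>snd z / ?h\<rceil> \<in> \<Lambda> \<and>
       ?L \<lceil>(fst z - cot \<sigma> * snd z) / s\<rceil> \<lceil>snd z / ?h\<rceil> - z \<in> half_open_cell"
      using mem unfolding lattice_points_def by blast
    show "c = ?L \<lceil>(fst z - cot \<sigma> * snd z) / s\<rceil> \<lceil>snd z / ?h\<rceil>" if c: "c \<in> \<Lambda> \<and> c - z \<in> half_open_cell" for c
    proof -
      obtain i j where "c = ?L i j" using c unfolding lattice_points_def by blast
      then show ?thesis using mem[of i j] c by simp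
    qed
  qed
qed

text \<open>
  Unfolding: the translates \<open>c - cell\<close> of the reflected cell cover the plane without overlap, so that
  summing over the lattice and integrating over one cell amounts to integrating over the plane.
\<close>

lemma nn_integral_tiling:
  assumes [measurable]: "f \<in> borel_measurable borel"
  shows "(\<integral>\<^sup>+ M. (\<integral>\<^sup>+ c. f (c - M) \<partial>count_space \<Lambda>) * indicator cell M \<partial>lborel) = (\<integral>\<^sup>+ z. f z \<partial>lborel)"
proof -
  have "(\<integral>\<^sup>+ M. (\<integral>\<^sup>+ c. f (c - M) \<partial>count_space \<Lambda>) * indicator cell M \<partial>lborel)
      = (\<integral>\<^sup>+ M. (\<integral>\<^sup>+ c. f (c - M) \<partial>count_space \<Lambda>) * indicator half_open_cell M \<partial>lborel)"
    using AE_half_open_cell by (intro nn_integral_cong_AE) (auto elim!: eventually_mono split: split_indicator)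
  also have "\<dots> = (\<integral>\<^sup>+ M. (\<integral>\<^sup>+ c. f (c - M) * indicator half_open_cell M \<partial>count_space \<Lambda>) \<partial>lborel)"
    by (simp add: nn_integral_multc)
  also have "\<dots> = (\<integral>\<^sup>+ c. (\<integral>\<^sup>+ M. f (c - M) * indicator half_open_cell M \<partial>lborel) \<partial>count_space \<Lambda>)"
    by (subst nn_integral_count_space_nn_integral) (auto simp: countable_lattice_points)
  also have "\<dots> = (\<integral>\<^sup>+ c. (\<integral>\<^sup>+ z. f z * indicator half_open_cell (c - z) \<partial>lborel) \<partial>count_space \<Lambda>)"
  proof (rule nn_integral_cong)
    fix c :: "real \<times> real"
    show "(\<integral>\<^sup>+ M. f (c - M) * indicator half_open_cell M \<partial>lborel)
        = (\<integral>\<^sup>+ z. f z * indicator half_open_cell (c - z) \<partial>lborel)"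
      using nn_integral_lborel_reflect[of "\<lambda>z. f z * indicator half_open_cell (c - z)" c] by simp
  qed
  also have "\<dots> = (\<integral>\<^sup>+ z. (\<integral>\<^sup>+ c. f z * indicator half_open_cell (c - z) \<partial>count_space \<Lambda>) \<partial>lborel)"
    by (subst nn_integral_count_space_nn_integral) (auto simp: countable_lattice_points)
  also have "\<dots> = (\<integral>\<^sup>+ z. f z \<partial>lborel)"
  proof (rule nn_integral_cong)
    fix z :: "real \<times> real"
    obtain c where c: "c \<in> \<Lambda>" "c - z \<in> half_open_cell" "\<And>c'. c' \<in> \<Lambda> \<Longrightarrow> c' - z \<in> half_open_cell \<Longrightarrow> c' = c"
      using unique_lattice_translate[of z] by blast
    have iff: "c' - z \<in> half_open_cell \<longleftrightarrow> c' = c" if "c' \<in> \<Lambda>" for c'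
      using c that by blast
    have "(\<integral>\<^sup>+ c'. indicator half_open_cell (c' - z) \<partial>count_space \<Lambda>) = (\<integral>\<^sup>+ c'. indicator {c} c' \<partial>count_space \<Lambda>)"
      by (intro nn_integral_cong) (simp add: indicator_def iff)
    also have "\<dots> = 1" using c(1) by (subst nn_integral_indicator) auto
    finally show "(\<integral>\<^sup>+ c. f z * indicator half_open_cell (c - z) \<partial>count_space \<Lambda>) = f z"
      by (simp add: nn_integral_cmult)
  qed
  finally show ?thesis .
qed

abbreviation "centres \<equiv> uniform_measure lborel cell"
abbreviation "angles \<equiv> uniform_measure lborel {0..2 * pi :: real}"
abbreviation "position \<omega> \<equiv> unplace (fst \<omega>) (snd \<omega>)"
abbreviation "throw_space \<equiv> centres \<Otimes>\<^sub>M angles"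

lemma prob_space_cell: "prob_space centres"
  using s_pos height_pos by (intro prob_space_uniform_measure) (auto simp: emeasure_cell mult.assoc)

lemma prob_space_angle: "prob_space angles"
  by (intro prob_space_uniform_measure) auto

lemma sets_throw_space: "sets throw_space = sets borel"
proof -
  have "sets throw_space = sets ((borel :: (real \<times> real) measure) \<Otimes>\<^sub>M (borel :: real measure))"
    by (intro sets_pair_measure_cong) auto
  then show ?thesis unfolding borel_prod .
qed

lemma unplace_measurable [measurable]: "(\<lambda>\<omega>. position \<omega> c) \<in> throw_space \<rightarrow>\<^sub>M borel"
proof -
  have "(\<lambda>\<omega>. position \<omega> c) \<in> borel_measurable borel"
    unfolding unplace_def rot_def fst_diff snd_diff
    by (intro borel_measurable_continuous_onI continuous_intros)
  then show ?thesis by (subst measurable_cong_sets[OF sets_throw_space refl])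
qed

text \<open>
  The expected number of lattice points that the throw moves into \<open>B\<close>. For every fixed angle it is
  found by unfolding, and the rotation of \<open>B\<close> by this angle does not change the area.
\<close>

lemma nn_integral_count_unplace:
  assumes B [measurable]: "B \<in> sets borel"
  shows "(\<integral>\<^sup>+ \<omega>. (\<integral>\<^sup>+ c. indicator B (position \<omega> c) \<partial>count_space \<Lambda>) \<partial>throw_space)
      = emeasure lborel B / ennreal (s * t * sin \<sigma>)"
proof -
  interpret A: prob_space centres by (rule prob_space_cell)
  interpret A2: prob_space angles by (rule prob_space_angle)
  interpret P: pair_prob_space centres angles ..
  have m: "(\<lambda>\<omega>. indicator B (position \<omega> c)) \<in> borel_measurable throw_space" for c
    by measurable
  have "(\<integral>\<^sup>+ \<omega>. (\<integral>\<^sup>+ c. indicator B (position \<omega> c) \<partial>count_space \<Lambda>) \<partial>throw_space)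
     = (\<integral>\<^sup>+ c. (\<integral>\<^sup>+ \<omega>. indicator B (position \<omega> c) \<partial>throw_space) \<partial>count_space \<Lambda>)"
    using m by (subst nn_integral_count_space_nn_integral) (auto simp: countable_lattice_points)
  also have "\<dots> = (\<integral>\<^sup>+ c. (\<integral>\<^sup>+ \<psi>. (\<integral>\<^sup>+ M. indicator B (unplace M \<psi> c) \<partial>centres) \<partial>angles) \<partial>count_space \<Lambda>)"
    by (simp add: P.nn_integral_snd[OF m, symmetric])
  also have "\<dots> = (\<integral>\<^sup>+ \<psi>. (\<integral>\<^sup>+ c. (\<integral>\<^sup>+ M. indicator B (unplace M \<psi> c) \<partial>centres) \<partial>count_space \<Lambda>) \<partial>angles)"
  proof (subst nn_integral_count_space_nn_integral)
    show "(\<lambda>\<psi>. (\<integral>\<^sup>+ M. indicator B (unplace M \<psi> c) \<partial>centres)) \<in> borel_measurable (angles)" for c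
      using measurable_pair_swap[OF m[of c]] by (intro A.borel_measurable_nn_integral) (simp add: case_prod_beta')
  qed (auto simp: countable_lattice_points)
  also have "\<dots> = (\<integral>\<^sup>+ \<psi>. emeasure lborel B / ennreal (s * t * sin \<sigma>) \<partial>angles)"
  proof (rule nn_integral_cong)
    fix \<psi> :: real
    let ?f = "\<lambda>z. indicator B (rot (- \<psi>) z) :: ennreal"
    have mr: "(\<lambda>M. unplace M \<psi> c) \<in> borel_measurable borel" for c
      unfolding unplace_def by measurable
    have "(\<integral>\<^sup>+ c. (\<integral>\<^sup>+ M. indicator B (unplace M \<psi> c) \<partial>centres) \<partial>count_space \<Lambda>)
       = (\<integral>\<^sup>+ c. (\<integral>\<^sup>+ M. indicator B (unplace M \<psi> c) * indicator cell M \<partial>lborel) / emeasure lborel cell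
           \<partial>count_space \<Lambda>)"
      using mr by (intro nn_integral_cong nn_integral_uniform_measure) auto
    also have "\<dots> = (\<integral>\<^sup>+ c. (\<integral>\<^sup>+ M. indicator B (unplace M \<psi> c) * indicator cell M \<partial>lborel) \<partial>count_space \<Lambda>) /
        emeasure lborel cell"
      by (intro nn_integral_divide) auto
    also have "(\<integral>\<^sup>+ c. (\<integral>\<^sup>+ M. indicator B (unplace M \<psi> c) * indicator cell M \<partial>lborel) \<partial>count_space \<Lambda>)
       = (\<integral>\<^sup>+ M. (\<integral>\<^sup>+ c. indicator B (unplace M \<psi> c) * indicator cell M \<partial>count_space \<Lambda>) \<partial>lborel)"
      using mr by (subst nn_integral_count_space_nn_integral) (auto simp: countable_lattice_points)
    also have "\<dots> = (\<integral>\<^sup>+ M. (\<integral>\<^sup>+ c. indicator B (unplace M \<psi> c) \<partial>count_space \<Lambda>) * indicator cell M \<partial>lborel)"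
      by (simp add: nn_integral_multc)
    also have "\<dots> = (\<integral>\<^sup>+ z. ?f z \<partial>lborel)"
      using nn_integral_tiling[of ?f] unfolding unplace_def by simp
    also have "(\<integral>\<^sup>+ z. ?f z \<partial>lborel) = emeasure lborel (rot (- \<psi>) -` B)"
    proof -
      have "rot (- \<psi>) -` B \<in> sets borel" using measurable_sets_borel[OF rot_measurable B] .
      then have "emeasure lborel (rot (- \<psi>) -` B) = (\<integral>\<^sup>+ z. indicator (rot (- \<psi>) -` B) z \<partial>lborel)" by simp
      then show ?thesis by (simp add: indicator_def)
    qed
    finally show "(\<integral>\<^sup>+ c. (\<integral>\<^sup>+ M. indicator B (unplace M \<psi> c) \<partial>centres) \<partial>count_space \<Lambda>)
        = emeasure lborel B / ennreal (s * t * sin \<sigma>)"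
      by (simp add: emeasure_rot_vimage emeasure_cell)
  qed
  also have "\<dots> = emeasure lborel B / ennreal (s * t * sin \<sigma>)"
    using A2.emeasure_space_1 by simp
  finally show ?thesis .
qed

text \<open>
  For a null set \<open>B\<close> the expected number vanishes, so what holds for almost every position holds
  almost surely for all lattice points at once.
\<close>

lemma AE_unplace:
  assumes "AE v in lborel. R v"
  shows "AE \<omega> in throw_space. \<forall>c\<in>\<Lambda>. R (position \<omega> c)"
proof -
  obtain N where N: "{v \<in> space lborel. \<not> R v} \<subseteq> N" "emeasure lborel N = 0" "N \<in> sets lborel"
    using AE_E[OF assms] by blast
  have Nb [measurable]: "N \<in> sets borel" using N by simp
  have z: "(\<integral>\<^sup>+ \<omega>. (\<integral>\<^sup>+ c. indicator N (position \<omega> c) \<partial>count_space \<Lambda>) \<partial>throw_space) = 0"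
    using nn_integral_count_unplace[OF Nb] N by simp
  have "AE \<omega> in throw_space. position \<omega> c \<notin> N" if c: "c \<in> \<Lambda>" for c
  proof -
    have "(\<integral>\<^sup>+ \<omega>. indicator N (position \<omega> c) \<partial>throw_space) \<le>
      (\<integral>\<^sup>+ \<omega>. (\<integral>\<^sup>+ c. indicator N (position \<omega> c) \<partial>count_space \<Lambda>) \<partial>throw_space)"
      using c by (intro nn_integral_mono nn_integral_ge_point)
    then have "(\<integral>\<^sup>+ \<omega>. indicator N (position \<omega> c) \<partial>throw_space) = 0" using z by simp
    then have "AE \<omega> in throw_space. indicator N (position \<omega> c) = (0::ennreal)"
      by (subst (asm) nn_integral_0_iff_AE) auto
    then show ?thesis by eventually_elim (auto simp: indicator_def split: if_splits)
  qed
  then have "AE \<omega> in throw_space. \<forall>c\<in>\<Lambda>. position \<omega> c \<notin> N"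
    by (subst AE_ball_countable[OF countable_lattice_points]) auto
  then show ?thesis by eventually_elim (use N(1) in auto)
qed

text \<open>
  Almost surely at most one lattice point falls into \<open>B\<close>, so the number of those that do is the indicator
  of the event.
\<close>

lemma emeasure_exists_unplace:
  assumes B [measurable]: "B \<in> sets borel"
    and u: "AE \<omega> in throw_space. \<forall>c\<in>\<Lambda>. \<forall>c'\<in>\<Lambda>. position \<omega> c \<in> B \<longrightarrow> position \<omega> c' \<in> B \<longrightarrow> c = c'"
  shows "emeasure throw_space {\<omega>\<in>space throw_space. \<exists>c\<in>\<Lambda>. position \<omega> c \<in> B}
      = emeasure lborel B / ennreal (s * t * sin \<sigma>)"
    and "{\<omega>\<in>space throw_space. \<exists>c\<in>\<Lambda>. position \<omega> c \<in> B} \<in> sets throw_space"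
proof -
  let ?E = "{\<omega>\<in>space throw_space. \<exists>c\<in>\<Lambda>. position \<omega> c \<in> B}"
  show E: "?E \<in> sets throw_space"
      proof -
    have "?E = (\<Union>c\<in>\<Lambda>. {\<omega>\<in>space throw_space. position \<omega> c \<in> B})" by blast
    also have "\<dots> \<in> sets throw_space"
      by (intro sets.countable_UN'' countable_lattice_points) measurable
    finally show ?thesis .
  qed
  have "emeasure throw_space ?E = (\<integral>\<^sup>+ \<omega>. indicator ?E \<omega> \<partial>throw_space)" using E by simp
  also have "\<dots> = (\<integral>\<^sup>+ \<omega>. (\<integral>\<^sup>+ c. indicator B (position \<omega> c) \<partial>count_space \<Lambda>) \<partial>throw_space)"
  proof (rule nn_integral_cong_AE)
    show "AE \<omega> in throw_space. indicator ?E \<omega> = (\<integral>\<^sup>+ c. indicator B (position \<omega> c) \<partial>count_space \<Lambda>)"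
      using u AE_space
    proof eventually_elim
      case (elim \<omega>)
      show ?case
      proof (cases "\<omega> \<in> ?E")
        case True
        then obtain c where c: "c \<in> \<Lambda>" "position \<omega> c \<in> B" by auto
        have iff: "position \<omega> c' \<in> B \<longleftrightarrow> c' = c" if "c' \<in> \<Lambda>" for c'
          using c elim(1) that by blast
        have "(\<integral>\<^sup>+ c'. indicator B (position \<omega> c') \<partial>count_space \<Lambda>) = (\<integral>\<^sup>+ c'. indicator {c} c' \<partial>count_space \<Lambda>)"
          by (intro nn_integral_cong) (simp add: indicator_def iff)
        also have "\<dots> = 1" using c(1) by (subst nn_integral_indicator) auto
        finally show ?thesis using True by simp
      next
        case False
        then have "(\<integral>\<^sup>+ c'. indicator B (position \<omega> c') \<partial>count_space \<Lambda>) = (\<integral>\<^sup>+ c'. 0 \<partial>count_space \<Lambda>)"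
          using elim(2) by (intro nn_integral_cong) (auto split: split_indicator)
        then show ?thesis using False by simp
      qed
    qed
  qed
  finally show "emeasure throw_space ?E = emeasure lborel B / ennreal (s * t * sin \<sigma>)"
    using nn_integral_count_unplace[OF B] by simp
qed

text \<open>
  The event \<open>Q\<close> need only agree almost surely with a Borel event; its measurability then comes from the
  completeness of the measure of the throw.
\<close>

lemma prob_throw:
  assumes B: "B \<in> sets borel" "emeasure lborel B = ennreal m" "0 \<le> m"
    and u: "AE \<omega> in throw_space. \<forall>c\<in>\<Lambda>. \<forall>c'\<in>\<Lambda>. position \<omega> c \<in> B \<longrightarrow> position \<omega> c' \<in> B \<longrightarrow> c = c'"
    and Q: "AE \<omega> in throw_space. Q \<omega> \<longleftrightarrow> (\<exists>c\<in>\<Lambda>. position \<omega> c \<in> B)"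
  shows "{\<omega> \<in> space (throw s t \<sigma>). Q \<omega>} \<in> sets (throw s t \<sigma>)"
    and "measure (throw s t \<sigma>) {\<omega> \<in> space (throw s t \<sigma>). Q \<omega>} = m / (s * t * sin \<sigma>)"
proof -
  let ?E = "{\<omega>\<in>space throw_space. \<exists>c\<in>\<Lambda>. position \<omega> c \<in> B}"
  let ?Q = "{\<omega> \<in> space (throw s t \<sigma>). Q \<omega>}"
  note E = emeasure_exists_unplace[OF B(1) u]
  have E': "?E \<in> sets (throw s t \<sigma>)" using E(2) by (simp add: throw_def)
  have ae: "AE \<omega> in throw s t \<sigma>. \<omega> \<in> ?E \<longleftrightarrow> \<omega> \<in> ?Q"
    unfolding throw_def using AE_completion[OF Q] AE_space by eventually_elim (auto simp: throw_def)
  show Qs: "?Q \<in> sets (throw s t \<sigma>)"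
    unfolding throw_def by (rule completion.in_sets_AE[OF ae[unfolded throw_def] E'[unfolded throw_def]]) auto
  have "measure (throw s t \<sigma>) ?Q = measure (throw s t \<sigma>) ?E"
    using ae Qs E' by (intro measure_eq_AE) auto
  also have "\<dots> = measure throw_space ?E" unfolding throw_def using E(2) by simp
  also have "\<dots> = m / (s * t * sin \<sigma>)"
    unfolding measure_def E(1) B(2) using s_pos height_pos B(3)
    by (subst divide_ennreal) (auto simp: mult.assoc)
  finally show "measure (throw s t \<sigma>) ?Q = m / (s * t * sin \<sigma>)" .
qed

end

section \<open>The area of a symmetric convex set from its boundary\<close>

text \<open>The sign condition matters because \<open>ennreal\<close> sends negative numbers to \<open>0\<close>.\<close>

definition has_area :: "(real \<times> real) set \<Rightarrow> real \<Rightarrow> bool" where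
  "has_area T m \<longleftrightarrow> emeasure lborel T = ennreal m \<and> 0 \<le> m"

text \<open>
  The area is four times that of the part in the first quadrant, which is the region below the curve
  \<open>u \<mapsto> (X u, Y u)\<close>, traced from right to left as \<open>X\<close> decreases to \<open>0\<close>. Substituting \<open>x = X u\<close> gives the
  integral of \<open>- Y X'\<close>, with antiderivative \<open>G\<close>.
\<close>

lemma area_quadrant_symmetric:
  fixes T :: "(real \<times> real) set"
  assumes T: "T \<in> sets borel"
    and sym1: "\<And>x y. (x, y) \<in> T \<Longrightarrow> (- x, y) \<in> T"
    and sym2: "\<And>x y. (x, y) \<in> T \<Longrightarrow> (x, - y) \<in> T"
    and le: "p \<le> q"
    and X: "\<And>u. u \<in> {p..q} \<Longrightarrow> (X has_real_derivative X' u) (at u)"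
    and X': "continuous_on {p..q} X'" "\<And>u. u \<in> {p..q} \<Longrightarrow> X' u \<le> 0"
    and Y: "\<And>u. u \<in> {p..q} \<Longrightarrow> 0 \<le> Y u"
    and Xq: "X q = 0"
    and slice: "\<And>u y. u \<in> {p<..<q} \<Longrightarrow> 0 \<le> y \<Longrightarrow> (X u, y) \<in> T \<longleftrightarrow> y \<le> Y u"
    and out: "\<And>x y. X p < x \<Longrightarrow> (x, y) \<notin> T"
    and Ym: "continuous_on {p..q} Y"
    and G: "\<And>u. u \<in> {p..q} \<Longrightarrow> (G has_real_derivative - Y u * X' u) (at u)"
  shows "has_area T (4 * (G q - G p))"
proof -
  define L where "L x = emeasure lborel (Pair x -` T)" for x
  have T': "T \<in> sets (lborel \<Otimes>\<^sub>M lborel)" unfolding lborel_prod using T by simp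
  have L [measurable]: "L \<in> borel_measurable borel"
    using lborel.measurable_emeasure_Pair[OF T'] unfolding L_def by simp
  have L_minus: "L (- x) = L x" for x
  proof -
    have "Pair (- x) -` T = Pair x -` T" using sym1 by (auto dest: sym1)
    then show ?thesis by (simp add: L_def)
  qed
  have L_out: "L x = 0" if "x < - X p" for x
  proof -
    have "Pair (- x) -` T = {}" using out that by auto
    then have "L (- x) = 0" by (simp add: L_def)
    then show ?thesis by (simp add: L_minus)
  qed
  have L_in: "L (X u) = ennreal (2 * Y u)" if u: "u \<in> {p<..<q}" for u
  proof -
    have "(X u, y) \<in> T \<longleftrightarrow> \<bar>y\<bar> \<le> Y u" for y
    proof -
      have "(X u, y) \<in> T \<longleftrightarrow> (X u, - y) \<in> T" using sym2 minus_minus by metis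
      moreover have "\<bar>y\<bar> = y \<or> \<bar>y\<bar> = - y" by linarith
      ultimately have "(X u, y) \<in> T \<longleftrightarrow> (X u, \<bar>y\<bar>) \<in> T" by metis
      then show ?thesis using slice[OF u abs_ge_zero] by simp
    qed
    then have "Pair (X u) -` T = {- Y u .. Y u}" by auto
    then show ?thesis using Y[of u] u by (simp add: L_def)
  qed
  have Xc: "continuous_on {p..q} X"
    using X by (meson DERIV_isCont continuous_at_imp_continuous_on)
  have surj: "\<exists>u\<in>{p<..<q}. X u = x" if "0 < x" "x < X p" for x
  proof -
    have "\<exists>u\<ge>p. u \<le> q \<and> X u = x"
      using that Xq le Xc by (intro IVT2') auto
    then obtain u where "u \<ge> p" "u \<le> q" "X u = x" by blast
    then show ?thesis using that Xq by (intro bexI[of _ u]) (auto simp: less_le)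
  qed
  \<comment> \<open>The substitution rule is about real functions.\<close>
  define f where "f x = enn2real (L x)" for x
  have f [measurable]: "f \<in> borel_measurable borel" unfolding f_def by measurable
  \<comment> \<open>The left half is used because \<open>- X\<close> is increasing, as the substitution rule requires.\<close>
  have neg: "(\<integral>\<^sup>+ x. L x * indicator {..0} x \<partial>lborel) = ennreal (2 * (G q - G p))"
  proof -
    have "(\<integral>\<^sup>+ x. L x * indicator {..0} x \<partial>lborel) = (\<integral>\<^sup>+ x. f x * indicator {- X p..- X q} x \<partial>lborel)"
    proof (rule nn_integral_cong_AE)
      show "AE x in lborel. L x * indicator {..0} x = ennreal (f x * indicator {- X p..- X q} x)"
        using AE_lborel_singleton[of "- X p"] AE_lborel_singleton[of 0]
      proof eventually_elim
        case (elim x)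
        consider "x < - X p" | "x > 0" | "- X p < x" "x < 0" using elim by linarith
        then show ?case
        proof cases
          case 1
          then show ?thesis using L_out[of x] by (simp add: indicator_def)
        next
          case 2
          then show ?thesis using Xq by (simp add: indicator_def)
        next
          case 3
          then obtain u where u: "u \<in> {p<..<q}" "X u = - x" using surj[of "- x"] by auto
          then have "L x = ennreal (2 * Y u)" using L_in[of u] L_minus[of x] by simp
          then show ?thesis using Y[of u] u 3 Xq by (simp add: f_def indicator_def)
        qed
      qed
    qed
    also have "\<dots> = (\<integral>\<^sup>+ u. f (- X u) * (- X' u) * indicator {p..q} u \<partial>lborel)"
    proof (rule nn_integral_substitution)
      show "set_borel_measurable borel {- X p..- X q} f"
        unfolding set_borel_measurable_def by measurable
      show "((\<lambda>u. - X u) has_real_derivative - X' u) (at u)" if "u \<in> {p..q}" for u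
        using X[OF that] by (rule DERIV_minus)
    qed (use X' le in \<open>auto intro: continuous_intros\<close>)
    also have "\<dots> = (\<integral>\<^sup>+ u. ennreal (2 * (- Y u * X' u)) * indicator {p..q} u \<partial>lborel)"
    proof (rule nn_integral_cong_AE)
      show "AE u in lborel. ennreal (f (- X u) * (- X' u) * indicator {p..q} u)
          = ennreal (2 * (- Y u * X' u)) * indicator {p..q} u"
        using AE_lborel_singleton[of p] AE_lborel_singleton[of q]
      proof eventually_elim
        case (elim u)
        show ?case
        proof (cases "u \<in> {p<..<q}")
          case True
          then have "f (- X u) = 2 * Y u" using L_in[OF True] L_minus[of "X u"] Y[of u] by (simp add: f_def)
          then show ?thesis using True by (simp add: indicator_def mult.assoc)
        next
          case False
          then show ?thesis using elim by (auto simp: indicator_def)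
        qed
      qed
    qed
    also have "\<dots> = ennreal (2 * G q - 2 * G p)"
    proof -
      let ?g = "\<lambda>u. 2 * (- Y u * X' u)"
      have gc: "continuous_on {p..q} ?g" using Ym X'(1) by (intro continuous_intros)
      have "(\<integral>\<^sup>+ u. ennreal (?g u) * indicator {p..q} u \<partial>lborel)
          = (\<integral>\<^sup>+ u. ennreal (?g u * indicator {p..q} u) * indicator {p..q} u \<partial>lborel)"
        by (intro nn_integral_cong) (auto split: split_indicator)
      also have "\<dots> = ennreal (2 * G q - 2 * G p)"
      proof (rule nn_integral_FTC_Icc)
        have "(\<lambda>u. indicator {p..q} u *\<^sub>R ?g u) \<in> borel_measurable borel"
          using gc by (intro borel_measurable_continuous_on_indicator) auto
        then show "(\<lambda>u. ?g u * indicator {p..q} u) \<in> borel_measurable borel"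
          by (simp add: mult.commute)
        show "((\<lambda>u. 2 * G u) has_real_derivative ?g u * indicator {p..q} u) (at u)" if "u \<in> {p..q}" for u
          using DERIV_cmult[OF G, of u 2] that by simp
        show "0 \<le> ?g u * indicator {p..q} u" if "u \<in> {p..q}" for u
          using mult_nonneg_nonpos[OF Y X'(2), of u u] that by (simp add: mult.commute)
      qed (use le in auto)
      finally show ?thesis .
    qed
    finally show ?thesis by (simp add: algebra_simps)
  qed
  have "(\<integral>\<^sup>+ x. L x * indicator {0<..} x \<partial>lborel) = (\<integral>\<^sup>+ x. L (0 - x) * indicator {0<..} (0 - x) \<partial>lborel)"
    using nn_integral_lborel_reflect[of "\<lambda>x. L x * indicator {0<..} x" 0] by simp
  also have "\<dots> = (\<integral>\<^sup>+ x. L x * indicator {..0} x \<partial>lborel)"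
    using AE_lborel_singleton[of 0] by (intro nn_integral_cong_AE) (auto simp: L_minus indicator_def elim!:
        eventually_mono)
  finally have pos: "(\<integral>\<^sup>+ x. L x * indicator {0<..} x \<partial>lborel) = ennreal (2 * (G q - G p))" using neg by simp
  have GG: "G p \<le> G q"
    using DERIV_nonneg_imp_nondecreasing[OF le, of G] G Y X'(2)
    by (metis atLeastAtMost_iff mult_minus_left mult_nonneg_nonpos neg_0_le_iff_le)
  have "emeasure lborel T = (\<integral>\<^sup>+ x. L x \<partial>lborel)"
    unfolding L_def by (subst lborel.emeasure_pair_measure_alt[OF T', symmetric]) (simp add: lborel_prod)
  also have "\<dots> = (\<integral>\<^sup>+ x. L x * indicator {..0} x + L x * indicator {0<..} x \<partial>lborel)"
    by (intro nn_integral_cong) (auto split: split_indicator)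
  also have "\<dots> = (\<integral>\<^sup>+ x. L x * indicator {..0} x \<partial>lborel) + (\<integral>\<^sup>+ x. L x * indicator {0<..} x \<partial>lborel)"
    by (intro nn_integral_add) measurable
  also have "\<dots> = ennreal (4 * (G q - G p))"
    unfolding neg pos using GG by (subst ennreal_plus[symmetric]) auto
  finally show ?thesis using GG by (simp add: has_area_def)
qed

text \<open>
  Suppose that \<open>(X u, Y u)\<close> is a point of \<open>T\<close> that maximises the component in the direction \<open>u\<close>. Then
  the vertical line through it contains no higher point of \<open>T\<close>, while convexity and the
  symmetry about the \<open>x\<close>-axis supply all lower ones. The curve either starts at \<open>p = 0\<close> or at a
  corner of \<open>T\<close> on the \<open>x\<close>-axis.
\<close>

lemma area_by_support_points:
  fixes T :: "(real \<times> real) set"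
  assumes T: "T \<in> sets borel" "convex T"
    and sym1: "\<And>x y. (x, y) \<in> T \<Longrightarrow> (- x, y) \<in> T"
    and sym2: "\<And>x y. (x, y) \<in> T \<Longrightarrow> (x, - y) \<in> T"
    and pq: "0 \<le> p" "p \<le> q" "q \<le> pi / 2" "p < pi / 2"
    and X: "\<And>u. u \<in> {p..q} \<Longrightarrow> (X has_real_derivative X' u) (at u)"
    and X': "continuous_on {p..q} X'" "\<And>u. u \<in> {p..q} \<Longrightarrow> X' u \<le> 0"
    and Y: "\<And>u. u \<in> {p..q} \<Longrightarrow> 0 \<le> Y u" "continuous_on {p..q} Y"
    and ends: "X q = 0" "Y p = 0"
    and mem: "\<And>u. u \<in> {p..q} \<Longrightarrow> (X u, Y u) \<in> T"
    and support: "\<And>u x y. u \<in> {p..q} \<Longrightarrow> (x, y) \<in> T \<Longrightarrow> x * cos u + y * sin u \<le> X u * cos u + Y u * sin u"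
    and G: "\<And>u. u \<in> {p..q} \<Longrightarrow> (G has_real_derivative - Y u * X' u) (at u)"
  shows "has_area T (4 * (G q - G p))"
proof (rule area_quadrant_symmetric[OF T(1) sym1 sym2 pq(2) X X' Y(1) ends(1) _ _ Y(2) G])
  have between: "(x, y') \<in> T" if "(x, y) \<in> T" "\<bar>y'\<bar> \<le> y" for x y y'
  proof (cases "y = 0")
    case False
    then have y: "y > 0" using that by linarith
    let ?l = "(1 + y' / y) / 2"
    have l: "0 \<le> ?l" "?l \<le> 1" using that(2) y by (auto simp: field_simps)
    have "(1 - ?l) *\<^sub>R (x, - y) + ?l *\<^sub>R (x, y) \<in> T"
      using T(2) sym2[OF that(1)] that(1) l by (intro convexD_alt) auto
    moreover have "(1 - ?l) *\<^sub>R (x, - y) + ?l *\<^sub>R (x, y) = (x, y')"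
      using y by (simp add: field_simps)
    ultimately show ?thesis by simp
  qed (use that in auto)
  show "(X u, y) \<in> T \<longleftrightarrow> y \<le> Y u" if u: "u \<in> {p<..<q}" and y: "0 \<le> y" for u y
  proof
    assume "(X u, y) \<in> T"
    then have "y * sin u \<le> Y u * sin u" using support[of u "X u" y] u by auto
    moreover have "0 < sin u" using u pq by (intro sin_gt_zero) auto
    ultimately show "y \<le> Y u" by simp
  next
    assume "y \<le> Y u"
    then show "(X u, y) \<in> T" using between[OF mem[of u]] u y by auto
  qed
  show "(x, y) \<notin> T" if x: "X p < x" for x y
  proof
    assume "(x, y) \<in> T"
    then have "(x, \<bar>y\<bar>) \<in> T" using sym2[of x y] by (auto simp: abs_if)
    then have "(x, 0) \<in> T" by (rule between) simp
    then have "x * cos p \<le> X p * cos p" using support[of p x 0] ends pq by simp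
    moreover have "0 < cos p" using pq by (intro cos_gt_zero_pi) auto
    ultimately show False using x by simp
  qed
qed auto

section \<open>Support function and parallel curves of the ellipse\<close>

locale ellipse_circle =
  fixes a b r :: real
  assumes b_pos: "0 < b" and b_le_a: "b \<le> a" and r_pos: "0 < r"
begin

lemma a_pos: "0 < a" using b_pos b_le_a by simp

text \<open>The support function of the ellipse: the largest component of its points in the direction \<open>\<phi>\<close>.\<close>

definition support :: "real \<Rightarrow> real" where
  "support \<phi> = sqrt (a\<^sup>2 * (cos \<phi>)\<^sup>2 + b\<^sup>2 * (sin \<phi>)\<^sup>2)"

lemma support_arg: "b\<^sup>2 \<le> a\<^sup>2 * (cos \<phi>)\<^sup>2 + b\<^sup>2 * (sin \<phi>)\<^sup>2" "a\<^sup>2 * (cos \<phi>)\<^sup>2 + b\<^sup>2 * (sin \<phi>)\<^sup>2 \<le> a\<^sup>2"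
proof -
  have ab: "b\<^sup>2 \<le> a\<^sup>2" using b_pos b_le_a by (simp add: power_mono)
  have s: "(sin \<phi>)\<^sup>2 = 1 - (cos \<phi>)\<^sup>2" "(cos \<phi>)\<^sup>2 = 1 - (sin \<phi>)\<^sup>2"
    using sin_cos_squared_add[of \<phi>] by linarith+
  have "0 \<le> (a\<^sup>2 - b\<^sup>2) * (cos \<phi>)\<^sup>2" "0 \<le> (a\<^sup>2 - b\<^sup>2) * (sin \<phi>)\<^sup>2" using ab by auto
  then show "b\<^sup>2 \<le> a\<^sup>2 * (cos \<phi>)\<^sup>2 + b\<^sup>2 * (sin \<phi>)\<^sup>2" "a\<^sup>2 * (cos \<phi>)\<^sup>2 + b\<^sup>2 * (sin \<phi>)\<^sup>2 \<le> a\<^sup>2"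
    by (simp_all add: s(1) algebra_simps)
qed

lemma support_sq: "(support \<phi>)\<^sup>2 = a\<^sup>2 * (cos \<phi>)\<^sup>2 + b\<^sup>2 * (sin \<phi>)\<^sup>2"
  unfolding support_def by simp

lemma support_bounds: "b \<le> support \<phi>" "support \<phi> \<le> a" "0 < support \<phi>"
proof -
  show "b \<le> support \<phi>" unfolding support_def using support_arg(1) by (intro real_le_rsqrt)
  then show "0 < support \<phi>" using b_pos by simp
  show "support \<phi> \<le> a" unfolding support_def using support_arg(2) a_pos by (intro real_le_lsqrt) auto
qed

lemma support_0 [simp]: "support 0 = a" and support_pi_half [simp]: "support (pi / 2) = b"
  unfolding support_def using a_pos b_pos by simp_all

lemma ecc_sq: "(ecc a b)\<^sup>2 = 1 - b\<^sup>2 / a\<^sup>2" and ecc_support: "a * sqrt (1 - (ecc a b)\<^sup>2 * (sin \<phi>)\<^sup>2) = support \<phi>"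
proof -
  have ab: "b\<^sup>2 \<le> a\<^sup>2" using b_pos b_le_a by (simp add: power_mono)
  then show e: "(ecc a b)\<^sup>2 = 1 - b\<^sup>2 / a\<^sup>2"
    using a_pos by (simp add: ecc_def power_divide diff_divide_distrib)
  have c: "(cos \<phi>)\<^sup>2 = 1 - (sin \<phi>)\<^sup>2"
    using sin_cos_squared_add[of \<phi>] by linarith
  have "a\<^sup>2 * (cos \<phi>)\<^sup>2 + b\<^sup>2 * (sin \<phi>)\<^sup>2 = a\<^sup>2 * (1 - (ecc a b)\<^sup>2 * (sin \<phi>)\<^sup>2)"
    unfolding e c using a_pos by (simp add: field_simps)
  then show "a * sqrt (1 - (ecc a b)\<^sup>2 * (sin \<phi>)\<^sup>2) = support \<phi>"
    unfolding support_def using a_pos by (simp add: real_sqrt_mult)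
qed

lemma support_deriv: "(support has_real_derivative - (a\<^sup>2 - b\<^sup>2) * sin \<phi> * cos \<phi> / support \<phi>) (at \<phi>)"
proof -
  have p: "0 < a\<^sup>2 * (cos \<phi>)\<^sup>2 + b\<^sup>2 * (sin \<phi>)\<^sup>2"
    using support_arg(1)[of \<phi>] b_pos by (smt (verit) zero_less_power)
  have "((\<lambda>u. sqrt (a\<^sup>2 * (cos u)\<^sup>2 + b\<^sup>2 * (sin u)\<^sup>2)) has_real_derivative
     - (a\<^sup>2 - b\<^sup>2) * sin \<phi> * cos \<phi> / support \<phi>) (at \<phi>)"
    using p by (auto intro!: derivative_eq_intros simp: support_def field_simps)
  then show ?thesis by (simp add: support_def[abs_def])
qed

lemma support_cont: "continuous_on S support"
  using support_deriv by (meson DERIV_isCont continuous_at_imp_continuous_on)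

lemma support_antimono:
  assumes "0 \<le> u" "u \<le> v" "v \<le> pi / 2"
  shows "support v \<le> support u"
proof -
  have ab: "0 \<le> a\<^sup>2 - b\<^sup>2" using b_pos b_le_a by (simp add: power_mono)
  have "sin u \<le> sin v" using assms by (intro sin_monotone_2pi_le) auto
  moreover have "0 \<le> sin u" using assms by (intro sin_ge_zero) auto
  ultimately have s: "(sin u)\<^sup>2 \<le> (sin v)\<^sup>2" by (intro power_mono)
  have c: "(cos x)\<^sup>2 = 1 - (sin x)\<^sup>2" for x :: real
    using sin_cos_squared_add[of x] by linarith
  have "(a\<^sup>2 - b\<^sup>2) * (sin u)\<^sup>2 \<le> (a\<^sup>2 - b\<^sup>2) * (sin v)\<^sup>2" using s ab by (intro mult_left_mono)
  then show ?thesis unfolding support_def c by (intro real_sqrt_le_mono) (simp add: algebra_simps)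
qed

text \<open>The point of the ellipse with outward normal \<open>(cos \<phi>, sin \<phi>)\<close>, moved by \<open>\<rho>\<close> along this normal.\<close>

definition offset_x :: "real \<Rightarrow> real \<Rightarrow> real" where "offset_x \<rho> \<phi> = (a\<^sup>2 / support \<phi> + \<rho>) * cos \<phi>"
definition offset_y :: "real \<Rightarrow> real \<Rightarrow> real" where "offset_y \<rho> \<phi> = (b\<^sup>2 / support \<phi> + \<rho>) * sin \<phi>"
text \<open>
  The first summand is the radius of curvature of the ellipse, which moving along the normal
  increases by \<open>\<rho>\<close>.
\<close>

definition curv_radius :: "real \<Rightarrow> real \<Rightarrow> real" where "curv_radius \<rho> \<phi> = a\<^sup>2 * b\<^sup>2 / support \<phi> ^ 3 + \<rho>"

lemma offset_x_deriv: "(offset_x \<rho> has_real_derivative - curv_radius \<rho> \<phi> * sin \<phi>) (at \<phi>)"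
  and offset_y_deriv: "(offset_y \<rho> has_real_derivative curv_radius \<rho> \<phi> * cos \<phi>) (at \<phi>)"
proof -
  define h where "h = support \<phi>"
  have h: "h > 0" "support \<phi> \<noteq> 0" using support_bounds(3)[of \<phi>] by (auto simp: h_def)
  have h2: "h\<^sup>2 = a\<^sup>2 * (cos \<phi>)\<^sup>2 + b\<^sup>2 * (sin \<phi>)\<^sup>2" using support_sq by (simp add: h_def)
  have sc: "(sin \<phi>)\<^sup>2 + (cos \<phi>)\<^sup>2 = 1" by simp
  have "(offset_x \<rho> has_real_derivative - (a\<^sup>2 / h + \<rho>) * sin \<phi> + a\<^sup>2 * ((a\<^sup>2 - b\<^sup>2) * sin \<phi> * cos \<phi> / h) / h\<^sup>2
      * cos \<phi>) (at \<phi>)"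
    unfolding offset_x_def[abs_def] using h
    by (auto intro!: derivative_eq_intros support_deriv simp: h_def[symmetric]) (simp add: field_simps
        power2_eq_square)
  moreover have "- (a\<^sup>2 / h + \<rho>) * sin \<phi> + a\<^sup>2 * ((a\<^sup>2 - b\<^sup>2) * sin \<phi> * cos \<phi> / h) / h\<^sup>2 * cos \<phi>
      = - (a\<^sup>2 * b\<^sup>2 / h ^ 3 + \<rho>) * sin \<phi>"
  proof -
    have "- (a\<^sup>2 / h + \<rho>) * sin \<phi> + a\<^sup>2 * ((a\<^sup>2 - b\<^sup>2) * sin \<phi> * cos \<phi> / h) / h\<^sup>2 * cos \<phi>
      = - sin \<phi> * (a\<^sup>2 * (h\<^sup>2 - (a\<^sup>2 - b\<^sup>2) * (cos \<phi>)\<^sup>2) / h ^ 3 + \<rho>)"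
      using h(1) by (simp add: field_simps power2_eq_square power3_eq_cube)
    also have "h\<^sup>2 - (a\<^sup>2 - b\<^sup>2) * (cos \<phi>)\<^sup>2 = b\<^sup>2" unfolding h2 using sc by algebra
    also have "- sin \<phi> * (a\<^sup>2 * b\<^sup>2 / h ^ 3 + \<rho>) = - (a\<^sup>2 * b\<^sup>2 / h ^ 3 + \<rho>) * sin \<phi>"
      by (simp add: algebra_simps)
    finally show ?thesis .
  qed
  ultimately show "(offset_x \<rho> has_real_derivative - curv_radius \<rho> \<phi> * sin \<phi>) (at \<phi>)"
    by (simp add: curv_radius_def h_def)
  have "(offset_y \<rho> has_real_derivative (b\<^sup>2 / h + \<rho>) * cos \<phi> + b\<^sup>2 * ((a\<^sup>2 - b\<^sup>2) * sin \<phi> * cos \<phi> / h) / h\<^sup>2 *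
      sin \<phi>) (at \<phi>)"
    unfolding offset_y_def[abs_def] using h
    by (auto intro!: derivative_eq_intros support_deriv simp: h_def[symmetric]) (simp add: field_simps
        power2_eq_square)
  moreover have "(b\<^sup>2 / h + \<rho>) * cos \<phi> + b\<^sup>2 * ((a\<^sup>2 - b\<^sup>2) * sin \<phi> * cos \<phi> / h) / h\<^sup>2 * sin \<phi>
      = (a\<^sup>2 * b\<^sup>2 / h ^ 3 + \<rho>) * cos \<phi>"
  proof -
    have "(b\<^sup>2 / h + \<rho>) * cos \<phi> + b\<^sup>2 * ((a\<^sup>2 - b\<^sup>2) * sin \<phi> * cos \<phi> / h) / h\<^sup>2 * sin \<phi>
      = cos \<phi> * (b\<^sup>2 * (h\<^sup>2 + (a\<^sup>2 - b\<^sup>2) * (sin \<phi>)\<^sup>2) / h ^ 3 + \<rho>)"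
      using h(1) by (simp add: field_simps power2_eq_square power3_eq_cube)
    also have "h\<^sup>2 + (a\<^sup>2 - b\<^sup>2) * (sin \<phi>)\<^sup>2 = a\<^sup>2" unfolding h2 using sc by algebra
    finally show ?thesis by (simp add: mult.commute)
  qed
  ultimately show "(offset_y \<rho> has_real_derivative curv_radius \<rho> \<phi> * cos \<phi>) (at \<phi>)"
    by (simp add: curv_radius_def h_def)
qed

lemma offset_cos_sin: "offset_x \<rho> \<phi> * cos \<phi> + offset_y \<rho> \<phi> * sin \<phi> = support \<phi> + \<rho>"
proof -
  define h where "h = support \<phi>"
  have h: "h > 0" using support_bounds(3)[of \<phi>] by (auto simp: h_def)
  have h2: "h * h = a\<^sup>2 * (cos \<phi>)\<^sup>2 + b\<^sup>2 * (sin \<phi>)\<^sup>2" using support_sq by (simp add: h_def power2_eq_square)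
  have "offset_x \<rho> \<phi> * cos \<phi> + offset_y \<rho> \<phi> * sin \<phi>
      = (a\<^sup>2 * (cos \<phi>)\<^sup>2 + b\<^sup>2 * (sin \<phi>)\<^sup>2) / h + (\<rho> * (sin \<phi>)\<^sup>2 + \<rho> * (cos \<phi>)\<^sup>2)"
    unfolding offset_x_def offset_y_def h_def[symmetric]
        by (simp add: add_divide_distrib algebra_simps power2_eq_square)
  moreover have "\<rho> * (sin \<phi>)\<^sup>2 + \<rho> * (cos \<phi>)\<^sup>2 = \<rho>"
    by (simp add: distrib_left[symmetric])
  ultimately show ?thesis using h unfolding h2[symmetric] by (simp add: h_def)
qed

text \<open>
  For \<open>0 \<le> \<phi> < \<pi>/2\<close> this is \<open>arctan (b / a * tan \<phi>)\<close>, the parameter \<open>\<theta>\<close> at which the ellipse \<open>(a cos \<theta>, b sin \<theta>)\<close> has the normal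
  direction \<open>\<phi>\<close>. Written as the deviation from \<open>\<phi>\<close>, it stays smooth at \<open>\<phi> = \<pi>/2\<close>, where the tangent has a pole.
\<close>

definition ecc_angle :: "real \<Rightarrow> real" where
  "ecc_angle \<phi> = \<phi> - arctan ((a - b) * sin \<phi> * cos \<phi> / (a * (cos \<phi>)\<^sup>2 + b * (sin \<phi>)\<^sup>2))"

lemma ecc_angle_deriv: "(ecc_angle has_real_derivative a * b / (support \<phi>)\<^sup>2) (at \<phi>)"
proof -
  define s c where "s = sin \<phi>" and "c = cos \<phi>"
  have sc: "s\<^sup>2 + c\<^sup>2 = 1" by (simp add: s_def c_def)
  define D where "D = a * c\<^sup>2 + b * s\<^sup>2"
  have D: "D > 0"
  proof -
    have "b * (s\<^sup>2 + c\<^sup>2) \<le> D" unfolding D_def using b_le_a by (simp add: distrib_left mult_right_mono)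
    then show ?thesis using sc b_pos by simp
  qed
  have key: "D\<^sup>2 + ((a - b) * s * c)\<^sup>2 = (a\<^sup>2 * c\<^sup>2 + b\<^sup>2 * s\<^sup>2)"
    unfolding D_def using sc by algebra
  have pos: "a\<^sup>2 * c\<^sup>2 + b\<^sup>2 * s\<^sup>2 > 0" using support_sq[of \<phi>] support_bounds(3)[of \<phi>]
      by (simp add: s_def c_def) (metis zero_less_power)
  have "(ecc_angle has_real_derivative 1 - (((a - b) * (c\<^sup>2 - s\<^sup>2)) * D - ((a - b) * s * c) * (2 * (b - a) * s *
      c)) / D\<^sup>2 / (1 + ((a - b) * s * c / D)\<^sup>2)) (at \<phi>)"
    unfolding ecc_angle_def[abs_def] using D
    by (auto intro!: derivative_eq_intros simp: s_def[symmetric] c_def[symmetric] D_def[symmetric])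
       (simp_all add: divide_simps D_def, algebra?)
  moreover have "1 - (((a - b) * (c\<^sup>2 - s\<^sup>2)) * D - ((a - b) * s * c) * (2 * (b - a) * s * c)) / D\<^sup>2 / (1 + ((a
      - b) * s * c / D)\<^sup>2) = a * b / (support \<phi>)\<^sup>2"
  proof -
    have e: "1 + ((a - b) * s * c / D)\<^sup>2 = (a\<^sup>2 * c\<^sup>2 + b\<^sup>2 * s\<^sup>2) / D\<^sup>2"
      unfolding key[symmetric] using D by (simp add: power_divide add_divide_distrib)
    have quot: "1 - N / D\<^sup>2 / (Q / D\<^sup>2) = (Q - N) / Q" if "Q > 0" for N Q :: real
      using D that by (simp add: field_simps)
    have "1 - (((a - b) * (c\<^sup>2 - s\<^sup>2)) * D - ((a - b) * s * c) * (2 * (b - a) * s * c)) / D\<^sup>2 / (1 + ((a - b) *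
        s * c / D)\<^sup>2)
      = ((a\<^sup>2 * c\<^sup>2 + b\<^sup>2 * s\<^sup>2) - (((a - b) * (c\<^sup>2 - s\<^sup>2)) * D - ((a - b) * s * c) * (2 * (b - a) * s * c))) /
          (a\<^sup>2 * c\<^sup>2 + b\<^sup>2 * s\<^sup>2)"
      unfolding e by (rule quot[OF pos])
    also have "(a\<^sup>2 * c\<^sup>2 + b\<^sup>2 * s\<^sup>2) - (((a - b) * (c\<^sup>2 - s\<^sup>2)) * D - ((a - b) * s * c) * (2 * (b - a) * s *
        c)) = a * b"
      unfolding D_def using sc by algebra
    finally show ?thesis by (simp add: support_sq s_def c_def)
  qed
  ultimately show ?thesis by simp
qed

lemma ecc_angle_0 [simp]: "ecc_angle 0 = 0" and ecc_angle_pi_half [simp]: "ecc_angle (pi / 2) = pi / 2"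
  by (simp_all add: ecc_angle_def)

lemma ecc_angle_eq:
  assumes "0 \<le> \<phi>" "\<phi> < pi / 2"
  shows "ecc_angle \<phi> = arctan (b / a * tan \<phi>)"
proof -
  define x where "x = b / a * tan \<phi>"
  define z where "z = (a - b) * sin \<phi> * cos \<phi> / (a * (cos \<phi>)\<^sup>2 + b * (sin \<phi>)\<^sup>2)"
  have c: "cos \<phi> > 0" using assms by (intro cos_gt_zero_pi) auto
  have s: "sin \<phi> \<ge> 0" using assms by (intro sin_ge_zero) auto
  have z: "z \<ge> 0" unfolding z_def using c s b_le_a b_pos
      by (intro divide_nonneg_nonneg mult_nonneg_nonneg add_nonneg_nonneg) auto
  have t: "tan \<phi> = sin \<phi> / cos \<phi>" by (simp add: tan_def)
  have D: "a * (cos \<phi>)\<^sup>2 + b * (sin \<phi>)\<^sup>2 > 0" using c a_pos b_pos by (intro add_pos_nonneg) auto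
  have x: "x \<ge> 0" unfolding x_def t using c s a_pos b_pos by auto
  have az: "0 \<le> arctan z" "arctan z < pi / 2" using z arctan_ubound by auto
  have ax: "0 \<le> arctan x" "arctan x < pi / 2" using x arctan_ubound by auto
  have "arctan x = \<phi> - arctan z"
  proof (rule arctan_unique)
    show "- (pi / 2) < \<phi> - arctan z" "\<phi> - arctan z < pi / 2" using az assms by linarith+
    then have c': "cos (\<phi> - arctan z) \<noteq> 0" using cos_gt_zero_pi by fastforce
    have "1 + tan \<phi> * z \<noteq> 0" using t c s z by (smt (verit) divide_nonneg_nonneg mult_nonneg_nonneg)
    have "tan (\<phi> - arctan z) = (tan \<phi> - z) / (1 + tan \<phi> * z)"
      using tan_diff[of \<phi> "arctan z"] c c' by (simp add: tan_arctan)
    also have "\<dots> = x"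
    proof -
      have "tan \<phi> - z = (sin \<phi> * (a * (cos \<phi>)\<^sup>2 + b * (sin \<phi>)\<^sup>2) - (a - b) * sin \<phi> * cos \<phi> * cos \<phi>) / (cos \<phi> *
          (a * (cos \<phi>)\<^sup>2 + b * (sin \<phi>)\<^sup>2))"
        unfolding t z_def using D c by (simp add: field_simps)
      also have "sin \<phi> * (a * (cos \<phi>)\<^sup>2 + b * (sin \<phi>)\<^sup>2) - (a - b) * sin \<phi> * cos \<phi> * cos \<phi> = b * sin \<phi>"
        using sin_cos_squared_add[of \<phi>] by algebra
      finally have n: "tan \<phi> - z = b * sin \<phi> / (cos \<phi> * (a * (cos \<phi>)\<^sup>2 + b * (sin \<phi>)\<^sup>2))" .
      have "tan \<phi> * z = (a - b) * (sin \<phi>)\<^sup>2 / (a * (cos \<phi>)\<^sup>2 + b * (sin \<phi>)\<^sup>2)"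
        unfolding t z_def using c by (simp add: power2_eq_square)
      then have "1 + tan \<phi> * z = (a * (cos \<phi>)\<^sup>2 + b * (sin \<phi>)\<^sup>2 + (a - b) * (sin \<phi>)\<^sup>2) / (a * (cos \<phi>)\<^sup>2 + b *
          (sin \<phi>)\<^sup>2)"
        using D by (simp add: add_divide_distrib)
      also have "a * (cos \<phi>)\<^sup>2 + b * (sin \<phi>)\<^sup>2 + (a - b) * (sin \<phi>)\<^sup>2 = a"
        using sin_cos_squared_add[of \<phi>] by algebra
      finally have d: "1 + tan \<phi> * z = a / (a * (cos \<phi>)\<^sup>2 + b * (sin \<phi>)\<^sup>2)" .
      show ?thesis unfolding n d x_def unfolding t using a_pos D c by simp
    qed
    finally show "tan (\<phi> - arctan z) = x" .
  qed
  then show ?thesis by (simp add: ecc_angle_def x_def z_def)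
qed

text \<open>
  The incomplete elliptic integral, integrated from \<open>- 1\<close> so that it has a two-sided derivative
  at \<open>0\<close>.
\<close>

definition elliptic :: "real \<Rightarrow> real" where
  "elliptic \<phi> = integral {- 1..\<phi>} (\<lambda>\<theta>. sqrt (1 - (ecc a b)\<^sup>2 * (sin \<theta>)\<^sup>2)) - integral {- 1..0} (\<lambda>\<theta>. sqrt (1 -
      (ecc a b)\<^sup>2 * (sin \<theta>)\<^sup>2))"

lemma elliptic_eq:
  assumes "0 \<le> \<phi>"
  shows "elliptic \<phi> = ellE \<phi> (ecc a b)"
  unfolding elliptic_def ellE_def
  using Henstock_Kurzweil_Integration.integral_combine[of "-1" 0 \<phi> "\<lambda>\<theta>. sqrt (1 - (ecc a b)\<^sup>2 * (sin \<theta>)\<^sup>2)"] assms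
  by (simp add: integrable_continuous_real continuous_intros)

lemma elliptic_deriv:
  assumes "0 \<le> \<phi>"
  shows "(elliptic has_real_derivative support \<phi> / a) (at \<phi>)"
proof -
  have "((\<lambda>x. integral {- 1..x} (\<lambda>\<theta>. sqrt (1 - (ecc a b)\<^sup>2 * (sin \<theta>)\<^sup>2))) has_real_derivative sqrt (1 - (ecc a
      b)\<^sup>2 * (sin \<phi>)\<^sup>2)) (at \<phi> within {- 1..\<phi> + 1})"
    using assms by (intro integral_has_real_derivative continuous_intros) auto
  moreover have "at \<phi> within {- 1..\<phi> + 1} = at \<phi>"
    using assms by (intro at_within_interior) auto
  ultimately have "(elliptic has_real_derivative sqrt (1 - (ecc a b)\<^sup>2 * (sin \<phi>)\<^sup>2) - 0) (at \<phi>)"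
    unfolding elliptic_def[abs_def] by (intro derivative_intros) simp_all
  moreover have "sqrt (1 - (ecc a b)\<^sup>2 * (sin \<phi>)\<^sup>2) = support \<phi> / a"
    unfolding ecc_support[symmetric] using a_pos by simp
  ultimately show ?thesis by simp
qed

text \<open>
  The signed area under the parallel curve from the direction \<open>0\<close> to \<open>\<phi>\<close>. It arises from
  \<open>- y dx = (x dy - y dx - d(x y)) / 2\<close>, where \<open>x dy - y dx = (h + \<rho>) (h + h'' + \<rho>) d\<phi>\<close> and
  \<open>h (h + h'') = a\<^sup>2 b\<^sup>2 / h\<^sup>2\<close> is \<open>a b\<close> times the derivative of the eccentric angle.
\<close>

definition swept_area :: "real \<Rightarrow> real \<Rightarrow> real" where
  "swept_area \<rho> \<phi> = (a * b * ecc_angle \<phi> + \<rho>\<^sup>2 * \<phi> + \<rho> * (2 * a * elliptic \<phi> - (a\<^sup>2 - b\<^sup>2) * sin \<phi> * cos \<phi> /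
      support \<phi>) - offset_x \<rho> \<phi> * offset_y \<rho> \<phi>) / 2"

lemma swept_area_deriv:
  assumes "0 \<le> \<phi>"
  shows "(swept_area \<rho> has_real_derivative offset_y \<rho> \<phi> * (curv_radius \<rho> \<phi> * sin \<phi>)) (at \<phi>)"
proof -
  define h s c where "h = support \<phi>" and "s = sin \<phi>" and "c = cos \<phi>"
  define R where "R = curv_radius \<rho> \<phi>"
  define X Y where "X = offset_x \<rho> \<phi>" and "Y = offset_y \<rho> \<phi>"
  have h: "h > 0" "support \<phi> \<noteq> 0" using support_bounds(3)[of \<phi>] by (auto simp: h_def)
  have h2: "h\<^sup>2 = a\<^sup>2 * c\<^sup>2 + b\<^sup>2 * s\<^sup>2" using support_sq by (simp add: h_def s_def c_def)
  have sc: "s\<^sup>2 + c\<^sup>2 = 1" by (simp add: s_def c_def)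
  have p: "X * c + Y * s = h + \<rho>" using offset_cos_sin by (simp add: X_def Y_def h_def s_def c_def)
  define q where "q = (\<lambda>u. (a\<^sup>2 - b\<^sup>2) * sin u * cos u / support u)"
  have d1: "(q has_real_derivative h - a\<^sup>2 * b\<^sup>2 / h ^ 3) (at \<phi>)"
  proof -
    have "((\<lambda>u. (a\<^sup>2 - b\<^sup>2) * sin u * cos u / support u) has_real_derivative
       ((a\<^sup>2 - b\<^sup>2) * (c\<^sup>2 - s\<^sup>2) * h - (a\<^sup>2 - b\<^sup>2) * s * c * (- (a\<^sup>2 - b\<^sup>2) * s * c / h)) / h\<^sup>2) (at \<phi>)"
      using h by (auto intro!: derivative_eq_intros support_deriv simp: h_def[symmetric] s_def[symmetric]
          c_def[symmetric] power2_eq_square algebra_simps)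
    moreover have "((a\<^sup>2 - b\<^sup>2) * (c\<^sup>2 - s\<^sup>2) * h - (a\<^sup>2 - b\<^sup>2) * s * c * (- (a\<^sup>2 - b\<^sup>2) * s * c / h)) / h\<^sup>2
       = ((a\<^sup>2 - b\<^sup>2) * (c\<^sup>2 - s\<^sup>2) * h\<^sup>2 + ((a\<^sup>2 - b\<^sup>2) * s * c)\<^sup>2) / h ^ 3"
      using h(1) by (simp add: field_simps power2_eq_square power3_eq_cube)
    moreover have "(a\<^sup>2 - b\<^sup>2) * (c\<^sup>2 - s\<^sup>2) * h\<^sup>2 + ((a\<^sup>2 - b\<^sup>2) * s * c)\<^sup>2 = (h\<^sup>2)\<^sup>2 - a\<^sup>2 * b\<^sup>2"
      unfolding h2 using sc by algebra
    moreover have "((h\<^sup>2)\<^sup>2 - a\<^sup>2 * b\<^sup>2) / h ^ 3 = h - a\<^sup>2 * b\<^sup>2 / h ^ 3"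
      using h(1) by (simp add: field_simps power2_eq_square power3_eq_cube)
    ultimately show ?thesis unfolding q_def by simp
  qed
  have "(swept_area \<rho> has_real_derivative (a * b * (a * b / h\<^sup>2) + \<rho>\<^sup>2 + \<rho> * (2 * h - (h - a\<^sup>2 * b\<^sup>2 / h ^ 3))
      - (- R * s * Y + X * (R * c))) / 2) (at \<phi>)"
    unfolding swept_area_def[abs_def] fun_cong[OF q_def, symmetric] using a_pos
    by (auto intro!: derivative_eq_intros ecc_angle_deriv elliptic_deriv[OF assms] d1 offset_x_deriv offset_y_deriv
        simp: h_def[symmetric] s_def[symmetric] c_def[symmetric] R_def[symmetric] X_def[symmetric] Y_def[symmetric])
  moreover have "(a * b * (a * b / h\<^sup>2) + \<rho>\<^sup>2 + \<rho> * (2 * h - (h - a\<^sup>2 * b\<^sup>2 / h ^ 3)) - (- R * s * Y + X * (R *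
      c))) / 2 = Y * (R * s)"
  proof -
    have "a * b * (a * b / h\<^sup>2) + \<rho>\<^sup>2 + \<rho> * (2 * h - (h - a\<^sup>2 * b\<^sup>2 / h ^ 3)) = (h + \<rho>) * R"
      unfolding R_def curv_radius_def h_def[symmetric] using h(1)
          by (simp add: field_simps power2_eq_square power3_eq_cube)
    then show ?thesis unfolding p[symmetric] by (simp add: algebra_simps)
  qed
  ultimately show ?thesis by (simp only: Y_def R_def s_def)
qed

lemma swept_area_0: "swept_area \<rho> 0 = 0"
  by (simp add: swept_area_def elliptic_eq ellE_def offset_y_def)

lemma swept_area_pi_half: "4 * swept_area \<rho> (pi / 2) = pi * a * b + pi * \<rho>\<^sup>2 + 4 * \<rho> * a * complete_ellE (ecc a b)"
  by (simp add: swept_area_def elliptic_eq offset_x_def algebra_simps)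

text \<open>Hence \<open>incl_F\<close> is four times the area in the quadrant whenever the curve ends on one of the axes.\<close>

lemma incl_F_swept_area:
  assumes "0 \<le> \<phi>" "\<phi> < pi / 2"
  shows "incl_F a b r \<phi> = 4 * swept_area (- r) \<phi> + 2 * offset_x (- r) \<phi> * offset_y (- r) \<phi>"
proof -
  have h: "support \<phi> > 0" by (rule support_bounds)
  have e: "sqrt (1 - (ecc a b)\<^sup>2 * (sin \<phi>)\<^sup>2) = support \<phi> / a" unfolding ecc_support[symmetric] using a_pos by simp
  define q where "q = (a\<^sup>2 - b\<^sup>2) * sin \<phi> * cos \<phi> / support \<phi>"
  have "r * a * (ecc a b)\<^sup>2 * sin (2 * \<phi>) / sqrt (1 - (ecc a b)\<^sup>2 * (sin \<phi>)\<^sup>2) = 2 * r * q"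
    unfolding e unfolding ecc_sq sin_double q_def using h a_pos by (simp add: field_simps power2_eq_square)
  then show ?thesis
    unfolding incl_F_def swept_area_def ecc_angle_eq[OF assms] elliptic_eq[OF assms(1)] q_def[symmetric]
        by (simp add: field_simps)
qed

section \<open>Hitting and nested positions\<close>


definition region :: "(real \<times> real) set" where "region = {(x, y). (x / a)\<^sup>2 + (y / b)\<^sup>2 \<le> 1}"
definition curve :: "(real \<times> real) set" where "curve = {(x, y). (x / a)\<^sup>2 + (y / b)\<^sup>2 = 1}"
definition hits :: "(real \<times> real) set" where "hits = {v. cball v r \<inter> region \<noteq> {}}"
definition curve_in_disc :: "(real \<times> real) set" where "curve_in_disc = {v. curve \<subseteq> cball v r}"
definition circle_in_region :: "(real \<times> real) set" where "circle_in_region = {v. sphere v r \<subseteq> region}"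

lemma mem_cball_iff: "(p, q) \<in> cball (x, y) r \<longleftrightarrow> (x - p)\<^sup>2 + (y - q)\<^sup>2 \<le> r\<^sup>2"
  and mem_sphere_iff: "(p, q) \<in> sphere (x, y) r \<longleftrightarrow> (x - p)\<^sup>2 + (y - q)\<^sup>2 = r\<^sup>2"
proof -
  have "(p, q) \<in> cball (x, y) r \<longleftrightarrow> sqrt ((x - p)\<^sup>2 + (y - q)\<^sup>2) \<le> sqrt (r\<^sup>2)"
   and "(p, q) \<in> sphere (x, y) r \<longleftrightarrow> sqrt ((x - p)\<^sup>2 + (y - q)\<^sup>2) = sqrt (r\<^sup>2)"
    using r_pos by (simp_all add: dist_Pair_Pair dist_real_def)
  then show "(p, q) \<in> cball (x, y) r \<longleftrightarrow> (x - p)\<^sup>2 + (y - q)\<^sup>2 \<le> r\<^sup>2"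
   "(p, q) \<in> sphere (x, y) r \<longleftrightarrow> (x - p)\<^sup>2 + (y - q)\<^sup>2 = r\<^sup>2"
    by (simp_all only: real_sqrt_le_iff real_sqrt_eq_iff)
qed

lemma curve_subset_region: "curve \<subseteq> region"
  by (auto simp: curve_def region_def)

lemma region_image: "region = (\<lambda>v. (a * fst v, b * snd v)) ` cball 0 1"
proof -
  have c: "v \<in> cball 0 1 \<longleftrightarrow> (fst v)\<^sup>2 + (snd v)\<^sup>2 \<le> 1" for v :: "real \<times> real"
    by (simp add: norm_prod_def)
  show ?thesis
  proof (intro equalityI subsetI)
    fix v assume "v \<in> region"
    then have "(fst v / a, snd v / b) \<in> cball 0 1" unfolding c by (auto simp: region_def)
    then have "(a * fst (fst v / a, snd v / b), b * snd (fst v / a, snd v / b)) \<in> (\<lambda>v. (a * fst v, b * snd v)) `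
        cball 0 1"
      by (rule imageI)
    then show "v \<in> (\<lambda>v. (a * fst v, b * snd v)) ` cball 0 1" using a_pos b_pos by simp
  next
    fix v assume "v \<in> (\<lambda>v. (a * fst v, b * snd v)) ` cball 0 1"
    then obtain w where "v = (a * fst w, b * snd w)" "w \<in> cball 0 1" by blast
    then show "v \<in> region" using a_pos b_pos unfolding c by (simp add: region_def)
  qed
qed

lemma region_compact: "compact region" and region_convex: "convex region"
proof -
  have l: "linear (\<lambda>v::real\<times>real. (a * fst v, b * snd v))"
    by (intro linearI) (auto simp: algebra_simps)
  show "compact region"
    unfolding region_image by (intro compact_continuous_image continuous_intros) auto
  show "convex region"
    unfolding region_image by (intro convex_linear_image l) auto
qed

lemma hits_sum: "hits = {p + u | p u. p \<in> region \<and> u \<in> cball 0 r}"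
proof (intro equalityI subsetI)
  fix v assume "v \<in> hits"
  then obtain p where "p \<in> region" "dist v p \<le> r" by (auto simp: hits_def)
  moreover from this have "v - p \<in> cball 0 r" "v = p + (v - p)" by (simp_all add: dist_norm norm_minus_commute)
  ultimately show "v \<in> {p + u | p u. p \<in> region \<and> u \<in> cball 0 r}" by blast
next
  fix v assume "v \<in> {p + u | p u. p \<in> region \<and> u \<in> cball 0 r}"
  then obtain p u where "v = p + u" "p \<in> region" "norm u \<le> r" by auto
  then have "p \<in> cball v r \<inter> region" by (simp add: dist_norm)
  then show "v \<in> hits" by (auto simp: hits_def)
qed

lemma hits_convex: "convex hits" and hits_compact: "compact hits"
proof -
  have "{p + u | p u. p \<in> region \<and> u \<in> cball 0 r} = (\<Union>p\<in>region. \<Union>u\<in>cball 0 r. {p + u})" by blast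
  then show "convex hits"
    unfolding hits_sum using convex_sums[OF region_convex convex_cball[of 0 r]] by simp
  show "compact hits"
    unfolding hits_sum using compact_sums[OF region_compact compact_cball[of 0 r]] by simp
qed

lemma curve_in_disc_eq: "curve_in_disc = (\<Inter>p\<in>curve. cball p r)"
  by (auto simp: curve_in_disc_def dist_commute subset_iff)

lemma curve_in_disc_convex: "convex curve_in_disc" and curve_in_disc_closed: "closed curve_in_disc"
  unfolding curve_in_disc_eq by (auto intro!: convex_INT closed_INT)

lemma circle_in_region_eq: "circle_in_region = (\<Inter>u\<in>sphere 0 r. (+) (- u) ` region)"
proof (intro equalityI subsetI INT_I)
  fix v u :: "real \<times> real" assume "v \<in> circle_in_region" and u: "u \<in> sphere 0 r"
  moreover have "v + u \<in> sphere v r" using u by (simp add: dist_norm)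
  ultimately have "v + u \<in> region" by (auto simp: circle_in_region_def)
  then show "v \<in> (+) (- u) ` region" by (intro image_eqI[of _ _ "v + u"]) auto
next
  fix v assume v: "v \<in> (\<Inter>u\<in>sphere 0 r. (+) (- u) ` region)"
  have "p \<in> region" if "p \<in> sphere v r" for p
  proof -
    have "p - v \<in> sphere 0 r" using that by (simp add: dist_norm norm_minus_commute)
    then have "v \<in> (+) (- (p - v)) ` region" using v by blast
    then show ?thesis by auto
  qed
  then show "v \<in> circle_in_region" by (auto simp: circle_in_region_def)
qed

lemma circle_in_region_convex: "convex circle_in_region" and circle_in_region_closed: "closed circle_in_region"
  unfolding circle_in_region_eq
  by (intro convex_INT convex_translation region_convex,
      intro closed_INT ballI closed_translation compact_imp_closed[OF region_compact])

lemma region_symmetric: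
  "(- x, y) \<in> region \<longleftrightarrow> (x, y) \<in> region" "(x, - y) \<in> region \<longleftrightarrow> (x, y) \<in> region"
  "(- x, y) \<in> curve \<longleftrightarrow> (x, y) \<in> curve" "(x, - y) \<in> curve \<longleftrightarrow> (x, y) \<in> curve"
  by (auto simp: region_def curve_def)

lemma hits_symmetric:
  assumes "(x, y) \<in> hits"
  shows "(- x, y) \<in> hits" "(x, - y) \<in> hits"
proof -
  obtain p q where pq: "(p, q) \<in> region" "(x - p)\<^sup>2 + (y - q)\<^sup>2 \<le> r\<^sup>2"
    using assms unfolding hits_def by (force simp: mem_cball_iff simp del: mem_cball)
  have "(- p, q) \<in> cball (- x, y) r" "(p, - q) \<in> cball (x, - y) r"
    using pq(2) unfolding mem_cball_iff by (simp_all add: power2_eq_square algebra_simps)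
  then show "(- x, y) \<in> hits" "(x, - y) \<in> hits"
    using pq(1) region_symmetric unfolding hits_def by blast+
qed

lemma curve_in_disc_symmetric:
  assumes "(x, y) \<in> curve_in_disc"
  shows "(- x, y) \<in> curve_in_disc" "(x, - y) \<in> curve_in_disc"
proof -
  have *: "(x - p)\<^sup>2 + (y - q)\<^sup>2 \<le> r\<^sup>2" if "(p, q) \<in> curve" for p q
    using assms that unfolding curve_in_disc_def by (auto simp: mem_cball_iff simp del: mem_cball)
  have "(p, q) \<in> cball (- x, y) r" "(p, q) \<in> cball (x, - y) r" if "(p, q) \<in> curve" for p q
    using *[of "- p" q] *[of p "- q"] that unfolding mem_cball_iff region_symmetric
    by (simp_all add: power2_eq_square algebra_simps)
  then show "(- x, y) \<in> curve_in_disc" "(x, - y) \<in> curve_in_disc"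
    unfolding curve_in_disc_def by auto
qed

lemma circle_in_region_symmetric:
  assumes "(x, y) \<in> circle_in_region"
  shows "(- x, y) \<in> circle_in_region" "(x, - y) \<in> circle_in_region"
proof -
  have *: "(p, q) \<in> region" if "(x - p)\<^sup>2 + (y - q)\<^sup>2 = r\<^sup>2" for p q
    using assms that unfolding circle_in_region_def by (auto simp: mem_sphere_iff simp del: mem_sphere)
  have "(p, q) \<in> sphere (- x, y) r \<Longrightarrow> (p, q) \<in> region" "(p, q) \<in> sphere (x, - y) r \<Longrightarrow> (p, q) \<in> region" for p q
    using *[of "- p" q] *[of p "- q"] unfolding mem_sphere_iff region_symmetric
    by (simp_all add: power2_eq_square algebra_simps)
  then show "(- x, y) \<in> circle_in_region" "(x, - y) \<in> circle_in_region"
    unfolding circle_in_region_def by auto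
qed

text \<open>This is the inequality of Cauchy and Schwarz with a unit vector.\<close>

lemma component_le_norm:
  fixes x y d u :: real
  assumes "x\<^sup>2 + y\<^sup>2 \<le> d\<^sup>2" "0 \<le> d"
  shows "x * cos u + y * sin u \<le> d"
proof -
  have "(x * cos u + y * sin u)\<^sup>2 + (x * sin u - y * cos u)\<^sup>2 = x\<^sup>2 + y\<^sup>2"
    using sin_cos_squared_add[of u] by algebra
  then have "(x * cos u + y * sin u)\<^sup>2 \<le> d\<^sup>2"
    using assms(1) zero_le_power2[of "x * sin u - y * cos u"] by linarith
  then show ?thesis using assms(2) by (rule power2_le_imp_le)
qed

text \<open>
  Scaling the axes to \<open>1\<close> turns the region into the unit disc and the direction into
  \<open>(a cos u, b sin u)\<close>, a vector of length \<open>support u\<close>.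
\<close>

lemma region_support:
  assumes "(x, y) \<in> region"
  shows "x * cos u + y * sin u \<le> support u"
proof -
  define p q where "p = x / a" and "q = y / b"
  have xy: "x = p * a" "y = q * b" using a_pos b_pos by (simp_all add: p_def q_def)
  have "p\<^sup>2 + q\<^sup>2 \<le> 1" using assms by (simp add: region_def p_def q_def)
  then have "(p\<^sup>2 + q\<^sup>2) * (support u)\<^sup>2 \<le> 1 * (support u)\<^sup>2" by (intro mult_right_mono) auto
  moreover have "(x * cos u + y * sin u)\<^sup>2 + (p * b * sin u - q * a * cos u)\<^sup>2 = (p\<^sup>2 + q\<^sup>2) * (support u)\<^sup>2"
    unfolding support_sq xy by algebra
  ultimately have "(x * cos u + y * sin u)\<^sup>2 \<le> (support u)\<^sup>2"
    using zero_le_power2[of "p * b * sin u - q * a * cos u"] by linarith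
  then show ?thesis using support_bounds(3)[of u] by (meson less_imp_le power2_le_imp_le)
qed

lemma offset_x_eq: "offset_x \<rho> u = offset_x 0 u * (1 + \<rho> * support u / a\<^sup>2)" and offset_y_eq: "offset_y \<rho> u
    = offset_y 0 u * (1 + \<rho> * support u / b\<^sup>2)"
  and offset_x_add: "offset_x \<rho> u = offset_x 0 u + \<rho> * cos u" and offset_y_add: "offset_y \<rho> u
      = offset_y 0 u + \<rho> * sin u"
  using a_pos b_pos support_bounds(3)[of u] by (simp_all add: offset_x_def offset_y_def field_simps)

lemma foot_in_curve: "(offset_x 0 u, offset_y 0 u) \<in> curve"
proof -
  have h: "support u > 0" by (rule support_bounds)
  have "(offset_x 0 u / a)\<^sup>2 + (offset_y 0 u / b)\<^sup>2 = (a\<^sup>2 * (cos u)\<^sup>2 + b\<^sup>2 * (sin u)\<^sup>2) / (support u)\<^sup>2"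
    using a_pos b_pos h unfolding offset_x_def offset_y_def by (simp add: field_simps power2_eq_square)
  then show ?thesis using h unfolding support_sq[symmetric] curve_def by simp
qed

text \<open>
  Let \<open>g\<close> be the foot point on the ellipse, so that the offset point is \<open>g + \<rho> n\<close> with normal \<open>n\<close>, and
  let \<open>p = (x, y)\<close> run through the ellipse. Since \<open>g\<close> and \<open>p\<close> satisfy the equation of the ellipse, the
  mixed term \<open>(p - g) \<bullet> n\<close> is a combination of \<open>(x - g\<^sub>1)\<^sup>2\<close> and \<open>(y - g\<^sub>2)\<^sup>2\<close>. The signs of the two coefficients
  decide whether \<open>g\<close> is the nearest or the farthest point of the ellipse, and by \<open>offset_x_eq\<close> they
  are also the signs of the coordinates of the offset point relative to those of \<open>g\<close>.
\<close>

lemma distance_to_curve: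
  assumes "(x, y) \<in> curve"
  shows "(x - offset_x \<rho> u)\<^sup>2 + (y - offset_y \<rho> u)\<^sup>2 =
    \<rho>\<^sup>2 + (1 + \<rho> * support u / a\<^sup>2) * (x - offset_x 0 u)\<^sup>2 + (1 + \<rho> * support u / b\<^sup>2) * (y - offset_y 0 u)\<^sup>2"
proof -
  define h g k where "h = support u" and "g = offset_x 0 u" and "k = offset_y 0 u"
  have h: "h > 0" unfolding h_def by (rule support_bounds)
  have c: "cos u = g * h / a\<^sup>2" and s: "sin u = k * h / b\<^sup>2"
    using h a_pos b_pos by (simp_all add: g_def k_def h_def offset_x_def offset_y_def)
  have cs: "(cos u)\<^sup>2 + (sin u)\<^sup>2 = 1" by simp
  have e1: "x\<^sup>2 / a\<^sup>2 + y\<^sup>2 / b\<^sup>2 = 1" using assms by (simp add: curve_def power_divide)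
  have e2: "g\<^sup>2 / a\<^sup>2 + k\<^sup>2 / b\<^sup>2 = 1" using foot_in_curve[of u] by (simp add: curve_def power_divide g_def k_def)
  have "(x - offset_x \<rho> u)\<^sup>2 + (y - offset_y \<rho> u)\<^sup>2
      = (x - g)\<^sup>2 + (y - k)\<^sup>2 - 2 * \<rho> * ((x - g) * cos u + (y - k) * sin u) + \<rho>\<^sup>2 * ((cos u)\<^sup>2 + (sin u)\<^sup>2)"
    unfolding offset_x_add[of \<rho>] offset_y_add[of \<rho>] g_def[symmetric] k_def[symmetric] by algebra
  also have "(x - g) * cos u + (y - k) * sin u = - h / 2 * ((x - g)\<^sup>2 / a\<^sup>2 + (y - k)\<^sup>2 / b\<^sup>2)"
  proof -
    define W where "W = (x - g) * (g / a\<^sup>2) + (y - k) * (k / b\<^sup>2)"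
    have "(x - g)\<^sup>2 / a\<^sup>2 + (y - k)\<^sup>2 / b\<^sup>2 = (x\<^sup>2 / a\<^sup>2 + y\<^sup>2 / b\<^sup>2) - (g\<^sup>2 / a\<^sup>2 + k\<^sup>2 / b\<^sup>2) - 2 * ((x - g) *
        (g / a\<^sup>2) + (y - k) * (k / b\<^sup>2))"
      by (simp add: power2_diff diff_divide_distrib add_divide_distrib algebra_simps) (simp add:
          power2_eq_square mult_ac)
    then have "(x - g)\<^sup>2 / a\<^sup>2 + (y - k)\<^sup>2 / b\<^sup>2 = - 2 * W"
      unfolding e1 e2 W_def[symmetric] by simp
    moreover have "(x - g) * cos u + (y - k) * sin u = h * W"
      unfolding c s W_def by (simp add: algebra_simps)
    ultimately show ?thesis by simp
  qed
  finally show ?thesis unfolding cs g_def[symmetric] k_def[symmetric] h_def[symmetric] by (simp add: algebra_simps)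
qed

lemma curve_minus: "(x, y) \<in> curve \<Longrightarrow> (- x, - y) \<in> curve"
  by (simp add: region_symmetric)

text \<open>The boundary of the outer parallel body is the parallel curve at distance \<open>r\<close>.\<close>

lemma area_hits: "has_area hits (pi * a * b + pi * r\<^sup>2 + 4 * r * a * complete_ellE (ecc a b))"
proof -
  have R: "0 \<le> curv_radius r u" for u
    using r_pos support_bounds(3)[of u] by (simp add: curv_radius_def)
  have "has_area hits (4 * (swept_area r (pi / 2) - swept_area r 0))"
  proof (rule area_by_support_points[where p = 0 and q = "pi / 2" and G = "swept_area r" and X = "offset_x r"
      and Y = "offset_y r" and X' = "\<lambda>u. - curv_radius r u * sin u"])
    show "hits \<in> sets borel" using hits_compact by (intro borel_compact)
    show "continuous_on {0..pi / 2} (\<lambda>u. - curv_radius r u * sin u)"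
      unfolding curv_radius_def using support_bounds(3)
      by (intro continuous_intros support_cont) (metis less_irrefl zero_less_power)
    show "- curv_radius r u * sin u \<le> 0" if "u \<in> {0..pi / 2}" for u
      using R[of u] sin_ge_zero[of u] that by (simp add: mult_nonneg_nonneg)
    show "0 \<le> offset_y r u" if "u \<in> {0..pi / 2}" for u
      unfolding offset_y_def using sin_ge_zero[of u] that support_bounds(3)[of u] r_pos by simp
    show "continuous_on {0..pi / 2} (offset_y r)"
      using offset_y_deriv by (meson DERIV_isCont continuous_at_imp_continuous_on)
    show "(offset_x r u, offset_y r u) \<in> hits" for u
    proof -
      have "(offset_x 0 u, offset_y 0 u) \<in> cball (offset_x r u, offset_y r u) r"
        unfolding mem_cball_iff offset_x_add[of r] offset_y_add[of r]
            by (simp add: power_mult_distrib distrib_left[symmetric])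
      then show ?thesis using foot_in_curve[of u] curve_subset_region unfolding hits_def by blast
    qed
    show "x * cos u + y * sin u \<le> offset_x r u * cos u + offset_y r u * sin u" if xy: "(x, y) \<in> hits" for x y u
    proof -
      obtain p q where pq: "(p, q) \<in> region" "(x - p)\<^sup>2 + (y - q)\<^sup>2 \<le> r\<^sup>2"
        using xy unfolding hits_def by (force simp: mem_cball_iff simp del: mem_cball)
      have "(x - p) * cos u + (y - q) * sin u \<le> r" using pq(2) r_pos by (simp add: component_le_norm)
      then show ?thesis using region_support[OF pq(1), of u] unfolding offset_cos_sin by (simp add: algebra_simps)
    qed
    show "(swept_area r has_real_derivative - offset_y r u * (- curv_radius r u * sin u)) (at u)"
        if "u \<in> {0..pi / 2}" for u
      using swept_area_deriv[of u r] that by simp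
  qed (use hits_symmetric hits_convex offset_x_deriv in \<open>auto simp: offset_x_def offset_y_def\<close>)
  then show ?thesis using swept_area_pi_half[of r] swept_area_0[of r] by simp
qed

lemma segment_meets_curve:
  assumes "c \<in> region" "w \<notin> region"
  shows "\<exists>l. 0 \<le> l \<and> l < 1 \<and> c + l *\<^sub>R (w - c) \<in> curve"
proof -
  define f where "f l = (fst (c + l *\<^sub>R (w - c)) / a)\<^sup>2 + (snd (c + l *\<^sub>R (w - c)) / b)\<^sup>2" for l
  have f: "continuous_on {0..1} f" unfolding f_def by (intro continuous_intros) (use a_pos b_pos in auto)
  have "f 0 \<le> 1" "1 < f 1" using assms by (auto simp: f_def region_def)
  then obtain l where "0 \<le> l" "l \<le> 1" "f l = 1" using IVT'[of f 0 1 1] f by auto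
  moreover have "l \<noteq> 1" using \<open>1 < f 1\<close> calculation by auto
  ultimately show ?thesis by (intro exI[of _ l]) (auto simp: f_def curve_def case_prod_beta')
qed

text \<open>
  The inner parallel body: the offset points at distance \<open>- r\<close> belong to it as long as they stay in the
  first quadrant, that is for \<open>r h \<le> b\<^sup>2\<close>, because then the foot point is the nearest point of the ellipse.
\<close>

lemma area_circle_in_region:
  assumes "0 \<le> p" "p < pi / 2" "offset_y (- r) p = 0" and rh: "\<And>u. u \<in> {p..pi / 2} \<Longrightarrow> r * support u \<le> b\<^sup>2"
  shows "has_area circle_in_region (4 * (swept_area (- r) (pi / 2) - swept_area (- r) p))"
proof (rule area_by_support_points[where p = p and q = "pi / 2" and G = "swept_area (- r)" and X
    = "offset_x (- r)" and Y = "offset_y (- r)" and X' = "\<lambda>u. - curv_radius (- r) u * sin u"])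
  have sn: "0 \<le> sin u" "0 \<le> cos u" if "u \<in> {p..pi / 2}" for u
    using that assms(1) by (auto intro!: sin_ge_zero cos_ge_zero)
  have ab: "b\<^sup>2 \<le> a\<^sup>2" using b_pos b_le_a by (simp add: power_mono)
  have Y: "0 \<le> 1 + - r * support u / b\<^sup>2" "0 \<le> 1 + - r * support u / a\<^sup>2" "1 + - r * support u / a\<^sup>2
      \<le> 1" "1 + - r * support u / b\<^sup>2 \<le> 1" if "u \<in> {p..pi / 2}" for u
    using rh[OF that] order_trans[OF rh[OF that] ab] a_pos b_pos r_pos support_bounds(3)[of u]
        by (auto simp: field_simps)
  have P0: "0 \<le> offset_x 0 u" "0 \<le> offset_y 0 u" if "u \<in> {p..pi / 2}" for u
    using sn[OF that] support_bounds(3)[of u] by (simp_all add: offset_x_def offset_y_def)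
  show "circle_in_region \<in> sets borel" using circle_in_region_closed by (intro borel_closed)
  show "continuous_on {p..pi / 2} (\<lambda>u. - curv_radius (- r) u * sin u)"
    unfolding curv_radius_def using support_bounds(3)
    by (intro continuous_intros support_cont) (metis less_irrefl zero_less_power)
  show "- curv_radius (- r) u * sin u \<le> 0" if "u \<in> {p..pi / 2}" for u
  proof -
    have "r * support u * (support u)\<^sup>2 \<le> b\<^sup>2 * a\<^sup>2"
      using rh[OF that] support_bounds[of u] r_pos by (intro mult_mono power_mono) auto
    then have "0 \<le> curv_radius (- r) u"
      using support_bounds(3)[of u] by (simp add: curv_radius_def field_simps power3_eq_cube power2_eq_square)
    then show ?thesis using sn(1)[OF that] by simp
  qed
  show "0 \<le> offset_y (- r) u" if "u \<in> {p..pi / 2}" for u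
    unfolding offset_y_eq[of "- r"] using P0[OF that] Y[OF that] by simp
  show "continuous_on {p..pi / 2} (offset_y (- r))"
    using offset_y_deriv by (meson DERIV_isCont continuous_at_imp_continuous_on)
  show "(offset_x (- r) u, offset_y (- r) u) \<in> circle_in_region" if u: "u \<in> {p..pi / 2}" for u
  proof -
    let ?c = "(offset_x (- r) u, offset_y (- r) u)"
    have far: "r\<^sup>2 \<le> (x - offset_x (- r) u)\<^sup>2 + (y - offset_y (- r) u)\<^sup>2" if "(x, y) \<in> curve" for x y
      unfolding distance_to_curve[OF that] using Y[OF u] by simp
    have "(offset_x (- r) u / a)\<^sup>2 + (offset_y (- r) u / b)\<^sup>2 \<le> (offset_x 0 u / a)\<^sup>2 + (offset_y 0 u / b)\<^sup>2"
      unfolding offset_x_eq[of "- r"] offset_y_eq[of "- r"]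
      using P0[OF u] Y[OF u] a_pos b_pos
      by (intro add_mono power_mono divide_right_mono mult_left_le divide_nonneg_nonneg mult_nonneg_nonneg) auto
    then have c: "?c \<in> region" using foot_in_curve[of u] by (auto simp: region_def curve_def)
    have "w \<in> region" if w: "w \<in> sphere ?c r" for w
    proof (rule ccontr)
      assume "w \<notin> region"
      then obtain l where l: "0 \<le> l" "l < 1" "?c + l *\<^sub>R (w - ?c) \<in> curve"
        using segment_meets_curve[OF c] by blast
      have "(offset_x (- r) u - fst w)\<^sup>2 + (offset_y (- r) u - snd w)\<^sup>2 = r\<^sup>2"
        using w mem_sphere_iff[of "fst w" "snd w" "offset_x (- r) u" "offset_y (- r) u"] by simp
      moreover have "(offset_x (- r) u + l * (fst w - offset_x (- r) u), offset_y (- r) u + l * (snd w -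
          offset_y (- r) u)) \<in> curve"
        using l(3) by (cases w) simp
      from far[OF this] have "r\<^sup>2 \<le> l\<^sup>2 * ((offset_x (- r) u - fst w)\<^sup>2 + (offset_y (- r) u - snd w)\<^sup>2)"
        by (simp add: power_mult_distrib distrib_left power2_commute)
      ultimately have "r\<^sup>2 \<le> l\<^sup>2 * r\<^sup>2" by simp
      moreover have "l\<^sup>2 < 1" using l by (simp add: abs_square_less_1)
      ultimately show False using r_pos by (simp add: mult_le_cancel_right1)
    qed
    then show ?thesis by (auto simp: circle_in_region_def)
  qed
  show "x * cos u + y * sin u \<le> offset_x (- r) u * cos u + offset_y (- r) u * sin u"
      if "(x, y) \<in> circle_in_region" for x y u
  proof -
    have "(x + r * cos u, y + r * sin u) \<in> sphere (x, y) r"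
      unfolding mem_sphere_iff by (simp add: power_mult_distrib distrib_left[symmetric])
    then have "(x + r * cos u, y + r * sin u) \<in> region" using that by (auto simp: circle_in_region_def)
    then have "(x + r * cos u) * cos u + (y + r * sin u) * sin u \<le> support u" by (rule region_support)
    moreover have "(x + r * cos u) * cos u + (y + r * sin u) * sin u = x * cos u + y * sin u + r"
      using sin_cos_squared_add[of u] by algebra
    ultimately show ?thesis unfolding offset_cos_sin by simp
  qed
  show "(swept_area (- r) has_real_derivative - offset_y (- r) u * (- curv_radius (- r) u * sin u)) (at u)"
      if "u \<in> {p..pi / 2}" for u
    using swept_area_deriv[of u "- r"] that assms by simp
qed (use assms circle_in_region_symmetric circle_in_region_convex offset_x_deriv in \<open>auto simp: offset_x_def\<close>)

text \<open>
  The roles of nearest and farthest point are exchanged here: for \<open>r h \<ge> a\<^sup>2\<close> the offset point at distance \<open>- r\<close>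
  has passed both axes and its farthest point on the ellipse is the foot point. Its
  reflection in the origin then lies in the first quadrant.
\<close>

lemma area_curve_in_disc:
  assumes "0 \<le> q" "q \<le> pi / 2" "offset_x (- r) q = 0" and rh: "\<And>u. u \<in> {0..q} \<Longrightarrow> a\<^sup>2 \<le> r * support u"
  shows "has_area curve_in_disc (4 * (swept_area (- r) q - swept_area (- r) 0))"
proof (rule area_by_support_points[where p = 0 and q = q and G = "swept_area (- r)" and X
    = "\<lambda>u. - offset_x (- r) u" and Y = "\<lambda>u. - offset_y (- r) u" and X' = "\<lambda>u. curv_radius (- r) u * sin u"])
  have sn: "0 \<le> sin u" "0 \<le> cos u" if "u \<in> {0..q}" for u
    using that assms(2) by (auto intro!: sin_ge_zero cos_ge_zero)
  have ab: "b\<^sup>2 \<le> a\<^sup>2" using b_pos b_le_a by (simp add: power_mono)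
  have Y: "1 + - r * support u / b\<^sup>2 \<le> 0" "1 + - r * support u / a\<^sup>2 \<le> 0" if "u \<in> {0..q}" for u
    using rh[OF that] order_trans[OF ab rh[OF that]] a_pos b_pos by (auto simp: field_simps)
  have P0: "0 \<le> offset_x 0 u" "0 \<le> offset_y 0 u" if "u \<in> {0..q}" for u
    using sn[OF that] support_bounds(3)[of u] by (simp_all add: offset_x_def offset_y_def)
  show "curve_in_disc \<in> sets borel" using curve_in_disc_closed by (intro borel_closed)
  show "continuous_on {0..q} (\<lambda>u. curv_radius (- r) u * sin u)"
    unfolding curv_radius_def using support_bounds(3)
    by (intro continuous_intros support_cont) (metis less_irrefl zero_less_power)
  show "curv_radius (- r) u * sin u \<le> 0" if "u \<in> {0..q}" for u
  proof -
    have "a\<^sup>2 * b\<^sup>2 \<le> r * support u * (support u)\<^sup>2"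
      using rh[OF that] support_bounds[of u] r_pos b_pos by (intro mult_mono power_mono) auto
    then have "curv_radius (- r) u \<le> 0"
      using support_bounds(3)[of u] by (simp add: curv_radius_def field_simps power3_eq_cube power2_eq_square)
    then show ?thesis using sn(1)[OF that] by (simp add: mult_nonpos_nonneg)
  qed
  show "0 \<le> - offset_y (- r) u" if "u \<in> {0..q}" for u
    unfolding offset_y_eq[of "- r"] using P0[OF that] Y[OF that] by (simp add: mult_nonneg_nonpos)
  have "continuous_on {0..q} (offset_y (- r))"
    using offset_y_deriv by (meson DERIV_isCont continuous_at_imp_continuous_on)
  then show "continuous_on {0..q} (\<lambda>u. - offset_y (- r) u)" by (rule continuous_on_minus)
  show "(- offset_x (- r) u, - offset_y (- r) u) \<in> curve_in_disc" if u: "u \<in> {0..q}" for u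
  proof -
    have "(x, y) \<in> cball (- offset_x (- r) u, - offset_y (- r) u) r" if "(x, y) \<in> curve" for x y
    proof -
      have "(- x - offset_x (- r) u)\<^sup>2 + (- y - offset_y (- r) u)\<^sup>2 \<le> r\<^sup>2"
        unfolding distance_to_curve[OF curve_minus[OF that]] using Y[OF u]
          mult_nonpos_nonneg[OF Y(1)[OF u] zero_le_power2] mult_nonpos_nonneg[OF Y(2)[OF u] zero_le_power2]
        by (simp add: add_nonpos_nonpos add.assoc)
      then show ?thesis unfolding mem_cball_iff by (simp add: power2_eq_square algebra_simps)
    qed
    then show ?thesis by (auto simp: curve_in_disc_def)
  qed
  show "x * cos u + y * sin u \<le> - offset_x (- r) u * cos u + - offset_y (- r) u * sin u"
      if "(x, y) \<in> curve_in_disc" for x y u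
  proof -
    have "(- offset_x 0 u, - offset_y 0 u) \<in> cball (x, y) r"
      using that curve_minus[OF foot_in_curve[of u]] by (auto simp: curve_in_disc_def)
    then have "(x + offset_x 0 u)\<^sup>2 + (y + offset_y 0 u)\<^sup>2 \<le> r\<^sup>2" unfolding mem_cball_iff by simp
    then have "(x + offset_x 0 u) * cos u + (y + offset_y 0 u) * sin u \<le> r"
      using r_pos by (simp add: component_le_norm)
    then show ?thesis using offset_cos_sin[of 0 u] offset_cos_sin[of "- r" u] by (simp add: algebra_simps)
  qed
  show "((\<lambda>u. - offset_x (- r) u) has_real_derivative curv_radius (- r) u * sin u) (at u)" for u
    using DERIV_minus[OF offset_x_deriv[of "- r" u]] by simp
  show "(swept_area (- r) has_real_derivative - (- offset_y (- r) u) * (curv_radius (- r) u * sin u)) (at u)"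
      if "u \<in> {0..q}" for u
    using swept_area_deriv[of u "- r"] that by simp
qed (use assms curve_in_disc_symmetric curve_in_disc_convex pi_gt_zero in \<open>auto simp: offset_y_def\<close>)

section \<open>The area of the nested positions\<close>


lemma support_arctan: "(support (arctan T))\<^sup>2 = (a\<^sup>2 + b\<^sup>2 * T\<^sup>2) / (1 + T\<^sup>2)"
proof -
  have "(cos (arctan T))\<^sup>2 = 1 / (1 + T\<^sup>2)" "(sin (arctan T))\<^sup>2 = T\<^sup>2 / (1 + T\<^sup>2)"
    by (simp_all add: cos_arctan sin_arctan power_divide)
  then show ?thesis unfolding support_sq by (simp add: add_divide_distrib)
qed

text \<open>The angle \<open>\<beta>\<close> is where the parallel curve at distance \<open>- r\<close> meets the \<open>y\<close>-axis.\<close>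

lemma support_beta:
  assumes "a < r" "r * b < a\<^sup>2"
  shows "support (angle_beta a b r) = a\<^sup>2 / r" "0 \<le> angle_beta a b r" "angle_beta a b r < pi / 2"
proof -
  let ?T = "a * sqrt (r\<^sup>2 - a\<^sup>2) / sqrt (a ^ 4 - r\<^sup>2 * b\<^sup>2)"
  have ra: "a\<^sup>2 \<le> r\<^sup>2" using assms a_pos by (intro power_mono) auto
  have "(r * b)\<^sup>2 < (a\<^sup>2)\<^sup>2" using assms b_pos r_pos by (intro power_strict_mono) auto
  then have D: "0 < a ^ 4 - r\<^sup>2 * b\<^sup>2" by (simp add: power_mult_distrib)
  have T2: "?T\<^sup>2 = a\<^sup>2 * (r\<^sup>2 - a\<^sup>2) / (a ^ 4 - r\<^sup>2 * b\<^sup>2)"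
    using ra D by (simp add: power_divide power_mult_distrib)
  have "(support (angle_beta a b r))\<^sup>2 = (a\<^sup>2 / r)\<^sup>2"
  proof -
    have e1: "1 + ?T\<^sup>2 = r\<^sup>2 * (a\<^sup>2 - b\<^sup>2) / (a ^ 4 - r\<^sup>2 * b\<^sup>2)"
      unfolding T2 using D by (simp add: field_simps power2_eq_square power4_eq_xxxx)
    have e2: "a\<^sup>2 + b\<^sup>2 * ?T\<^sup>2 = a ^ 4 * (a\<^sup>2 - b\<^sup>2) / (a ^ 4 - r\<^sup>2 * b\<^sup>2)"
      unfolding T2 using D by (simp add: field_simps power2_eq_square power4_eq_xxxx)
    have ab: "a\<^sup>2 - b\<^sup>2 > 0"
    proof -
      have "b * a < r * b" using assms b_pos by simp
      also have "\<dots> < a * a" using assms by (simp add: power2_eq_square)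
      finally have "b < a" using a_pos by (simp add: mult_less_cancel_right)
      then have "b\<^sup>2 < a\<^sup>2" using b_pos by (intro power_strict_mono) auto
      then show ?thesis by simp
    qed
    have "(support (angle_beta a b r))\<^sup>2 = a ^ 4 / r\<^sup>2"
      unfolding angle_beta_def support_arctan e1 e2 using D ab by simp
    then show ?thesis by (simp add: power_divide)
  qed
  then show "support (angle_beta a b r) = a\<^sup>2 / r"
    using support_bounds(3)[of "angle_beta a b r"] r_pos by (simp add: power2_eq_iff_nonneg)
  show "0 \<le> angle_beta a b r" "angle_beta a b r < pi / 2"
    unfolding angle_beta_def using a_pos ra D arctan_ubound by auto
qed

text \<open>The angle \<open>\<alpha>\<close> is where the parallel curve at distance \<open>- r\<close> meets the \<open>x\<close>-axis.\<close>

lemma support_alpha: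
  assumes "b\<^sup>2 < r * a" "r < b"
  shows "support (angle_alpha a b r) = b\<^sup>2 / r" "0 \<le> angle_alpha a b r" "angle_alpha a b r < pi / 2"
proof -
  let ?T = "sqrt (r\<^sup>2 * a\<^sup>2 - b ^ 4) / (b * sqrt (b\<^sup>2 - r\<^sup>2))"
  have D: "0 < b\<^sup>2 - r\<^sup>2" using assms r_pos by (simp add: power_strict_mono)
  have "(b\<^sup>2)\<^sup>2 < (r * a)\<^sup>2" using assms by (intro power_strict_mono) auto
  then have ra: "0 < r\<^sup>2 * a\<^sup>2 - b ^ 4" by (simp add: power_mult_distrib)
  have T2: "?T\<^sup>2 = (r\<^sup>2 * a\<^sup>2 - b ^ 4) / (b\<^sup>2 * (b\<^sup>2 - r\<^sup>2))"
    using ra D by (simp add: power_divide power_mult_distrib)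
  have "(support (angle_alpha a b r))\<^sup>2 = (b\<^sup>2 / r)\<^sup>2"
  proof -
    have D': "0 < b\<^sup>2 * (b\<^sup>2 - r\<^sup>2)" using D b_pos by simp
    have frac1: "1 + N / M = (M + N) / M" and frac2: "u + v * (N / M) = (u * M + v * N) / M" if "0 < M"
        for M N u v :: real
      using that by (simp_all add: add_divide_distrib)
    have e1: "1 + ?T\<^sup>2 = r\<^sup>2 * (a\<^sup>2 - b\<^sup>2) / (b\<^sup>2 * (b\<^sup>2 - r\<^sup>2))"
    proof -
      have "1 + ?T\<^sup>2 = (b\<^sup>2 * (b\<^sup>2 - r\<^sup>2) + (r\<^sup>2 * a\<^sup>2 - b ^ 4)) / (b\<^sup>2 * (b\<^sup>2 - r\<^sup>2))"
        unfolding T2 by (rule frac1[OF D'])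
      also have "b\<^sup>2 * (b\<^sup>2 - r\<^sup>2) + (r\<^sup>2 * a\<^sup>2 - b ^ 4) = r\<^sup>2 * (a\<^sup>2 - b\<^sup>2)" by algebra
      finally show ?thesis .
    qed
    have e2: "a\<^sup>2 + b\<^sup>2 * ?T\<^sup>2 = b ^ 4 * (a\<^sup>2 - b\<^sup>2) / (b\<^sup>2 * (b\<^sup>2 - r\<^sup>2))"
    proof -
      have "a\<^sup>2 + b\<^sup>2 * ?T\<^sup>2 = (a\<^sup>2 * (b\<^sup>2 * (b\<^sup>2 - r\<^sup>2)) + b\<^sup>2 * (r\<^sup>2 * a\<^sup>2 - b ^ 4)) / (b\<^sup>2 * (b\<^sup>2 - r\<^sup>2))"
        unfolding T2 by (rule frac2[OF D'])
      also have "a\<^sup>2 * (b\<^sup>2 * (b\<^sup>2 - r\<^sup>2)) + b\<^sup>2 * (r\<^sup>2 * a\<^sup>2 - b ^ 4) = b ^ 4 * (a\<^sup>2 - b\<^sup>2)" by algebra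
      finally show ?thesis .
    qed
    have ab: "a\<^sup>2 - b\<^sup>2 > 0"
    proof -
      have "b * b < r * a" using assms by (simp add: power2_eq_square)
      also have "\<dots> < b * a" using assms a_pos by simp
      finally have "b < a" using b_pos by (simp add: mult_less_cancel_left)
      then have "b\<^sup>2 < a\<^sup>2" using b_pos by (intro power_strict_mono) auto
      then show ?thesis by simp
    qed
    have "(support (angle_alpha a b r))\<^sup>2 = b ^ 4 / r\<^sup>2"
      unfolding angle_alpha_def support_arctan e1 e2 using D b_pos ab by simp
    then show ?thesis by (simp add: power_divide)
  qed
  then show "support (angle_alpha a b r) = b\<^sup>2 / r"
    using support_bounds(3)[of "angle_alpha a b r"] r_pos by (simp add: power2_eq_iff_nonneg)
  show "0 \<le> angle_alpha a b r" "angle_alpha a b r < pi / 2"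
    unfolding angle_alpha_def using b_pos ra D arctan_ubound by auto
qed

text \<open>The disc contains both ends of the major axis; adding the two inequalities removes the linear terms.\<close>

lemma curve_in_disc_small:
  assumes "(x, y) \<in> curve_in_disc"
  shows "x\<^sup>2 + y\<^sup>2 + a\<^sup>2 \<le> r\<^sup>2"
proof -
  have "(a, 0) \<in> curve" "(- a, 0) \<in> curve" using a_pos by (auto simp: curve_def)
  then have "(a, 0) \<in> cball (x, y) r" "(- a, 0) \<in> cball (x, y) r"
    using assms by (auto simp: curve_in_disc_def)
  then show ?thesis unfolding mem_cball_iff by (simp add: power2_eq_square algebra_simps)
qed

text \<open>Likewise with the two points of the circle above and below its centre.\<close>

lemma circle_in_region_small:
  assumes "(x, y) \<in> circle_in_region"
  shows "(x / a)\<^sup>2 + (y / b)\<^sup>2 + (r / b)\<^sup>2 \<le> 1"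
proof -
  have "(x, y + r) \<in> sphere (x, y) r" "(x, y - r) \<in> sphere (x, y) r"
    unfolding mem_sphere_iff by auto
  then have "(x, y + r) \<in> region" "(x, y - r) \<in> region"
    using assms by (auto simp: circle_in_region_def)
  then show ?thesis unfolding region_def
    by (simp add: power2_eq_square algebra_simps add_divide_distrib diff_divide_distrib)
qed

lemma area_inclusion: "has_area (curve_in_disc \<union> circle_in_region) (m_incl a b r / (2 * pi))"
proof -
  have full: "pi * r\<^sup>2 + pi * a * b - 4 * r * a * complete_ellE (ecc a b)
      = 4 * (swept_area (- r) (pi / 2) - swept_area (- r) 0)"
    using swept_area_pi_half[of "- r"] swept_area_0[of "- r"] by simp
  have empty1: "curve_in_disc = {}" if "r < a"
  proof -
    have "r\<^sup>2 < a\<^sup>2" using that r_pos by (simp add: power_strict_mono)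
    moreover have "a\<^sup>2 \<le> r\<^sup>2" if "(x, y) \<in> curve_in_disc" for x y
      using curve_in_disc_small[OF that] zero_le_power2[of x] zero_le_power2[of y] by linarith
    ultimately show ?thesis by fastforce
  qed
  have empty2: "circle_in_region = {}" if "b < r"
  proof -
    have "1 < (r / b)\<^sup>2" using that b_pos by (simp add: one_less_power)
    moreover have "(r / b)\<^sup>2 \<le> 1" if "(x, y) \<in> circle_in_region" for x y
      using circle_in_region_small[OF that] zero_le_power2[of "x / a"] zero_le_power2[of "y / b"] by linarith
    ultimately show ?thesis by fastforce
  qed
  consider "a < r" "a\<^sup>2 / b \<le> r" | "a < r" "r < a\<^sup>2 / b" | "b \<le> r" "r \<le> a" | "b\<^sup>2 / a < r" "r < b" | "r < b" "r
      \<le> b\<^sup>2 / a"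
    by linarith
  then show ?thesis
  proof cases
    case 1
    have "a\<^sup>2 \<le> r * support u" for u
    proof -
      have "a\<^sup>2 \<le> r * b" using 1 b_pos by (simp add: field_simps)
      also have "\<dots> \<le> r * support u" using support_bounds r_pos by (intro mult_left_mono) auto
      finally show ?thesis .
    qed
    then have "has_area curve_in_disc (4 * (swept_area (- r) (pi / 2) - swept_area (- r) 0))"
      by (intro area_curve_in_disc) (auto simp: offset_x_def)
    also have "4 * (swept_area (- r) (pi / 2) - swept_area (- r) 0) = m_incl a b r / (2 * pi)"
      unfolding full[symmetric] using 1 by (simp add: m_incl_def)
    finally show ?thesis using empty2 1 b_le_a by simp
  next
    case 2
    have "r * b < a\<^sup>2" using 2 b_pos by (simp add: field_simps)
    note beta = support_beta[OF 2(1) this]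
    have PX0: "offset_x (- r) (angle_beta a b r) = 0"
      unfolding offset_x_eq[of "- r"] beta using a_pos r_pos by simp
    have "has_area curve_in_disc (4 * (swept_area (- r) (angle_beta a b r) - swept_area (- r) 0))"
    proof (rule area_curve_in_disc[OF beta(2) _ PX0])
      show "a\<^sup>2 \<le> r * support u" if "u \<in> {0..angle_beta a b r}" for u
        using support_antimono[of u "angle_beta a b r"] that beta r_pos by (simp add: field_simps)
    qed (use beta in simp)
    also have "4 * (swept_area (- r) (angle_beta a b r) - swept_area (- r) 0) = incl_F a b r (angle_beta a b r)"
      using incl_F_swept_area[OF beta(2,3)] PX0 swept_area_0[of "- r"] by simp
    also have "\<dots> = m_incl a b r / (2 * pi)" using 2 by (simp add: m_incl_def)
    finally show ?thesis using empty2 2 b_le_a by simp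
  next
    case 3
    have "(x, y) = 0" if "(x, y) \<in> curve_in_disc" for x y
    proof -
      have "r\<^sup>2 \<le> a\<^sup>2" using 3 r_pos by (intro power_mono) auto
      then have "x\<^sup>2 + y\<^sup>2 \<le> 0" using curve_in_disc_small[OF that] by linarith
      then show ?thesis by (simp add: sum_power2_le_zero_iff zero_prod_def)
    qed
    moreover have "(x, y) = 0" if "(x, y) \<in> circle_in_region" for x y
    proof -
      have "1 \<le> (r / b)\<^sup>2" using 3 b_pos by (simp add: one_le_power)
      then have "(x / a)\<^sup>2 + (y / b)\<^sup>2 \<le> 0" using circle_in_region_small[OF that] by linarith
      then show ?thesis using a_pos b_pos by (simp add: sum_power2_le_zero_iff zero_prod_def)
    qed
    ultimately have "v = 0" if "v \<in> curve_in_disc \<union> circle_in_region" for v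
      using that by (cases v) blast
    then have "curve_in_disc \<union> circle_in_region \<subseteq> {0}" by blast
    then have "emeasure lborel (curve_in_disc \<union> circle_in_region) = 0"
      by (meson emeasure_lborel_countable countable_subset countable_finite finite.intros)
    then show ?thesis using 3 by (simp add: m_incl_def has_area_def)
  next
    case 4
    have "b\<^sup>2 < r * a" using 4 a_pos by (simp add: field_simps)
    note alpha = support_alpha[OF this 4(2)]
    have PY0: "offset_y (- r) (angle_alpha a b r) = 0"
      unfolding offset_y_eq[of "- r"] alpha using b_pos r_pos by simp
    have "has_area circle_in_region (4 * (swept_area (- r) (pi / 2) - swept_area (- r) (angle_alpha a b r)))"
    proof (rule area_circle_in_region[OF alpha(2,3) PY0])
      show "r * support u \<le> b\<^sup>2" if "u \<in> {angle_alpha a b r..pi / 2}" for u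
        using support_antimono[of "angle_alpha a b r" u] that alpha r_pos by (simp add: field_simps)
    qed
    also have "4 * (swept_area (- r) (pi / 2) - swept_area (- r) (angle_alpha a b r))
        = incl_F_tilde a b r (angle_alpha a b r)"
      using incl_F_swept_area[OF alpha(2,3)] PY0 swept_area_pi_half[of "- r"]
          by (simp add: incl_F_tilde_def algebra_simps)
    also have "\<dots> = m_incl a b r / (2 * pi)" using 4 b_le_a by (simp add: m_incl_def)
    finally show ?thesis using empty1 4 b_le_a by simp
  next
    case 5
    have "r * support u \<le> b\<^sup>2" for u
    proof -
      have "r * support u \<le> r * a" using support_bounds r_pos by (intro mult_left_mono) auto
      also have "\<dots> \<le> b\<^sup>2" using 5 a_pos by (simp add: field_simps)
      finally show ?thesis .
    qed
    then have "has_area circle_in_region (4 * (swept_area (- r) (pi / 2) - swept_area (- r) 0))"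
      by (intro area_circle_in_region) (auto simp: offset_y_def)
    also have "4 * (swept_area (- r) (pi / 2) - swept_area (- r) 0) = m_incl a b r / (2 * pi)"
      unfolding full[symmetric] using 5 b_le_a by (simp add: m_incl_def)
    finally show ?thesis using empty1 5 b_le_a by simp
  qed
qed

end

section \<open>Counting simple zeros by sign changes\<close>

text \<open>Testing for \<open>\<le> 0\<close> means, for the equation of a circle, testing for membership in the closed disc.\<close>

definition sign_changes :: "(real \<Rightarrow> real) \<Rightarrow> real \<Rightarrow> nat \<Rightarrow> nat" where
  "sign_changes f T n = card {k. k < n \<and> (f (T * real k / real n) \<le> 0) \<noteq> (f (T * real (Suc k) / real n) \<le> 0)}"

text \<open>Every change flips the truth value, so after an even number of changes it is back where it started.\<close>

lemma parity_of_changes: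
  fixes P :: "nat \<Rightarrow> bool"
  shows "even (card {k. k < n \<and> P k \<noteq> P (Suc k)}) \<longleftrightarrow> P 0 = P n"
proof (induction n)
  case (Suc n)
  show ?case
  proof (cases "P n = P (Suc n)")
    case True
    then have "{k. k < Suc n \<and> P k \<noteq> P (Suc k)} = {k. k < n \<and> P k \<noteq> P (Suc k)}"
      using less_Suc_eq by auto
    then show ?thesis using Suc True by simp
  next
    case False
    then have "{k. k < Suc n \<and> P k \<noteq> P (Suc k)} = insert n {k. k < n \<and> P k \<noteq> P (Suc k)}"
      using less_Suc_eq by auto
    then have "card {k. k < Suc n \<and> P k \<noteq> P (Suc k)} = Suc (card {k. k < n \<and> P k \<noteq> P (Suc k)})"
      by simp
    then show ?thesis using Suc False by auto
  qed
qed simp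

lemma even_sign_changes:
  assumes "f T = f 0" "0 < n"
  shows "even (sign_changes f T n)"
  using parity_of_changes[of n "\<lambda>k. f (T * real k / real n) \<le> 0"] assms by (simp add: sign_changes_def)

text \<open>If the signs at the ends agreed, the only zero would be a local extremum.\<close>

lemma sign_change_at_simple_zero:
  fixes f :: "real \<Rightarrow> real"
  assumes "u < z" "z < v" "f z = 0" "f u \<noteq> 0" "f v \<noteq> 0"
    and only: "\<And>x. u \<le> x \<Longrightarrow> x \<le> v \<Longrightarrow> f x = 0 \<Longrightarrow> x = z"
    and cont: "continuous_on UNIV f" and D: "(f has_real_derivative d) (at z)" "d \<noteq> 0"
  shows "(f u \<le> 0) \<noteq> (f v \<le> 0)"
proof
  assume same: "(f u \<le> 0) = (f v \<le> 0)"
  \<comment> \<open>After a change of sign the values at both ends are positive.\<close>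
  define s where "s = (if f u \<le> 0 then - 1 else 1 :: real)"
  define F where "F x = s * f x" for x
  have Fz: "F x = 0 \<longleftrightarrow> f x = 0" for x by (simp add: F_def s_def)
  have F: "0 < F u" "0 < F v" using same assms(4,5) by (auto simp: F_def s_def)
  have Fc: "continuous_on A F" for A unfolding F_def
    by (intro continuous_intros continuous_on_subset[OF cont]) auto
  have "0 < F x" if "u \<le> x" "x < z" for x
  proof (rule ccontr)
    assume "\<not> 0 < F x"
    then have "\<exists>y\<ge>u. y \<le> x \<and> F y = 0" using F that Fc by (intro IVT2') auto
    then obtain y where y: "u \<le> y" "y \<le> x" "f y = 0" using Fz by blast
    then have "y = z" using only[of y] that assms(2) by linarith
    then show False using y that by simp
  qed
  moreover have "0 < F x" if "z < x" "x \<le> v" for x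
  proof (rule ccontr)
    assume "\<not> 0 < F x"
    then have "\<exists>y\<ge>x. y \<le> v \<and> F y = 0" using F that Fc by (intro IVT') auto
    then obtain y where y: "x \<le> y" "y \<le> v" "f y = 0" using Fz by blast
    then have "y = z" using only[of y] that assms(1) by linarith
    then show False using y that by simp
  qed
  ultimately have "F z \<le> F y" if "\<bar>z - y\<bar> < min (z - u) (v - z)" for y
    using that Fz[of z] assms(3) by (cases y z rule: linorder_cases) (auto simp: less_imp_le)
  moreover have "(F has_real_derivative s * d) (at z)"
    unfolding F_def by (rule DERIV_cmult[OF D(1)])
  ultimately have "s * d = 0"
    using DERIV_local_min[of F "s * d" z "min (z - u) (v - z)"] assms(1,2) by auto
  then show False using D(2) by (simp add: s_def split: if_splits)
qed

text \<open>
  Each sign change needs a zero of its own in the open cell. Once the cells are shorter than the least distance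
  between two zeros, each zero is alone in its cell and causes a sign change there.
\<close>

lemma sign_changes_count_zeros:
  fixes f f' :: "real \<Rightarrow> real"
  assumes T: "0 < T"
    and D: "\<And>x. (f has_real_derivative f' x) (at x)"
    and simple: "\<And>x. f x = 0 \<Longrightarrow> f' x \<noteq> 0"
    and grid: "\<And>n k. 0 < n \<Longrightarrow> f (T * real k / real n) \<noteq> 0"
    and fin: "finite {x \<in> {0..<T}. f x = 0}"
  shows "0 < n \<Longrightarrow> sign_changes f T n \<le> card {x \<in> {0..<T}. f x = 0}"
    and "\<forall>\<^sub>F n in sequentially. sign_changes f T n = card {x \<in> {0..<T}. f x = 0}"
proof -
  define Z where "Z = {x \<in> {0..<T}. f x = 0}"
  define C where "C n = {k. k < n \<and> (f (T * real k / real n) \<le> 0) \<noteq> (f (T * real (Suc k) / real n) \<le> 0)}" for n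
  have cont: "continuous_on A f" for A
    using D by (meson DERIV_isCont continuous_at_imp_continuous_on)
  have between: "\<exists>z\<in>Z. T * real k / real n < z \<and> z < T * real (Suc k) / real n" if n: "0 < n" and k: "k \<in> C n" for n k
  proof -
    let ?u = "T * real k / real n" and ?v = "T * real (Suc k) / real n"
    have uv: "?u \<le> ?v" using T n by (simp add: divide_right_mono)
    have u0: "0 \<le> ?u" using T by simp
    have "?v \<le> T * real n / real n" using T n k by (intro divide_right_mono mult_left_mono) (auto simp: C_def)
    then have vT: "?v \<le> T" using n by simp
    have "\<exists>x\<ge>?u. x \<le> ?v \<and> f x = 0"
    proof (cases "f ?u \<le> 0")
      case True
      then have "0 \<le> f ?v" using k by (auto simp: C_def)
      then show ?thesis using True uv by (intro IVT' cont)
    next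
      case False
      then have "f ?v \<le> 0" using k by (auto simp: C_def)
      then show ?thesis using False uv by (intro IVT2' cont) auto
    qed
    then obtain x where x: "?u \<le> x" "x \<le> ?v" "f x = 0" by blast
    have "x \<noteq> ?u" "x \<noteq> ?v" using x(3) grid[OF n, of k] grid[OF n, of "Suc k"] by auto
    then have x': "?u < x" "x < ?v" using x by auto
    then have "x \<in> Z" using x(3) u0 vT by (auto simp: Z_def)
    then show ?thesis using x' by blast
  qed
  have cell_unique: "k = l" if "0 < n" "T * real k / real n < z" "z < T * real (Suc k) / real n"
      "T * real l / real n < z" "z < T * real (Suc l) / real n" for n k l z
  proof -
    have "T * real k / real n < T * real (Suc l) / real n" "T * real l / real n < T * real (Suc k) / real n"
      using that by linarith+
    then have "real k < real (Suc l)" "real l < real (Suc k)"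
      using T that(1) by (simp_all add: divide_less_cancel mult_less_cancel_left)
    then show ?thesis by simp
  qed
  have finC: "finite (C n)" for n by (simp add: C_def)
  show le: "sign_changes f T n \<le> card {x \<in> {0..<T}. f x = 0}" if n: "0 < n" for n
  proof -
    obtain h where h: "\<And>k. k \<in> C n \<Longrightarrow> h k \<in> Z \<and> T * real k / real n < h k \<and> h k < T * real (Suc k) / real n"
      using between[OF n] by metis
    have "inj_on h (C n)"
    proof (rule inj_onI)
      fix k l assume "k \<in> C n" "l \<in> C n" "h k = h l"
      then show "k = l" using cell_unique[OF n, of k "h k" l] h[of k] h[of l] by simp
    qed
    then have "card (C n) \<le> card Z" using h fin by (intro card_inj_on_le[of h]) (auto simp: Z_def)
    then show ?thesis by (simp add: sign_changes_def C_def Z_def)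
  qed
  obtain \<delta> where \<delta>: "0 < \<delta>" "\<And>z z'. z \<in> Z \<Longrightarrow> z' \<in> Z \<Longrightarrow> z \<noteq> z' \<Longrightarrow> \<delta> \<le> \<bar>z - z'\<bar>"
  proof -
    let ?D = "insert 1 ((\<lambda>(z, z'). \<bar>z - z'\<bar>) ` {(z, z') \<in> Z \<times> Z. z \<noteq> z'})"
    have "finite ((\<lambda>(z, z'). \<bar>z - z'\<bar>) ` {(z, z') \<in> Z \<times> Z. z \<noteq> z'})"
      using fin unfolding Z_def by (intro finite_imageI finite_subset[OF _ finite_cartesian_product[OF fin fin]]) auto
    then have f: "finite ?D" by simp
    have "0 < Min ?D" using f by (subst Min_gr_iff) auto
    moreover have "Min ?D \<le> \<bar>z - z'\<bar>" if "z \<in> Z" "z' \<in> Z" "z \<noteq> z'" for z z'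
      using that by (intro Min_le f) force
    ultimately show ?thesis using that by blast
  qed
  show "\<forall>\<^sub>F n in sequentially. sign_changes f T n = card {x \<in> {0..<T}. f x = 0}"
    using eventually_gt_at_top[of "nat \<lceil>T / \<delta>\<rceil>"]
  proof eventually_elim
    case (elim n)
    then have n: "0 < n" and "T / \<delta> < real n" using T \<delta>(1) by linarith+
    then have mesh: "T / real n < \<delta>" using \<delta>(1) by (simp add: field_simps)
    have width: "T * real (Suc k) / real n = T * real k / real n + T / real n" for k
      by (simp add: field_simps add_divide_distrib)
    have cell: "\<exists>k\<in>C n. T * real k / real n < z \<and> z < T * real (Suc k) / real n" if z: "z \<in> Z" for z
    proof -
      define k where "k = nat \<lfloor>z * real n / T\<rfloor>"
      have zn: "0 \<le> z * real n / T" using z T by (simp add: Z_def)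
      have k1: "real k \<le> z * real n / T" "z * real n / T < real (Suc k)"
        unfolding k_def using zn by linarith+
      then have k2: "T * real k / real n \<le> z" "z < T * real (Suc k) / real n"
        using T n by (simp_all add: field_simps)
      have fz: "f z = 0" using z by (simp add: Z_def)
      then have "z \<noteq> T * real k / real n" using grid[OF n, of k] by auto
      then have k3: "T * real k / real n < z" using k2 by simp
      have "z * real n / T < real n" using z T n by (simp add: Z_def field_simps)
      then have kn: "k < n" using k1 by linarith
      have vT: "T * real (Suc k) / real n \<le> T * real n / real n" using kn T n
          by (intro divide_right_mono mult_left_mono) auto
      have "(f (T * real k / real n) \<le> 0) \<noteq> (f (T * real (Suc k) / real n) \<le> 0)"
      proof (rule sign_change_at_simple_zero[OF k3 k2(2) fz grid[OF n] grid[OF n] _ cont D simple[OF fz]])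
        fix x assume x: "T * real k / real n \<le> x" "x \<le> T * real (Suc k) / real n" "f x = 0"
        have "x \<noteq> T * real (Suc k) / real n" using grid[OF n, of "Suc k"] x(3) by auto
        then have "x < T" using vT x(2) n by simp
        moreover have "0 \<le> T * real k / real n" using T by simp
        ultimately have "x \<in> Z" using x by (simp add: Z_def)
        moreover have "\<bar>x - z\<bar> < \<delta>" using x k2 k3 mesh width[of k] by linarith
        ultimately show "x = z" using \<delta>(2)[of x z] z by force
      qed
      then have "k \<in> C n" using kn by (simp add: C_def)
      then show ?thesis using k3 k2 by blast
    qed
    then obtain h where h: "\<And>z. z \<in> Z \<Longrightarrow> h z \<in> C n \<and> T * real (h z) / real n < z \<and> z < T * real (Suc (h z)) / real n"
      by metis
    have "inj_on h Z"
    proof (rule inj_onI, rule ccontr)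
      fix z z' assume z: "z \<in> Z" "z' \<in> Z" "h z = h z'" "z \<noteq> z'"
      then have "\<bar>z - z'\<bar> < \<delta>" using h[of z] h[of z'] mesh width[of "h z"] by fastforce
      then show False using \<delta>(2)[of z z'] z by force
    qed
    then have "card Z \<le> card (C n)" using h finC by (intro card_inj_on_le[of h]) auto
    then show ?case using le[OF n] by (simp add: sign_changes_def C_def Z_def)
  qed
qed

section \<open>Intersections with a generic circle\<close>

context ellipse_circle begin

definition ellipse_point :: "real \<Rightarrow> real \<times> real" where "ellipse_point \<theta> = (a * cos \<theta>, b * sin \<theta>)"

definition circle_eq :: "real \<times> real \<Rightarrow> real \<Rightarrow> real" where
  "circle_eq c \<theta> = (a * cos \<theta> - fst c)\<^sup>2 + (b * sin \<theta> - snd c)\<^sup>2 - r\<^sup>2"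

definition circle_eq' :: "real \<times> real \<Rightarrow> real \<Rightarrow> real" where
  "circle_eq' c \<theta> = 2 * (b * cos \<theta> * (b * sin \<theta> - snd c) - a * sin \<theta> * (a * cos \<theta> - fst c))"

definition transversal :: "real \<times> real \<Rightarrow> bool" where
  "transversal c \<longleftrightarrow> (\<forall>\<theta>. circle_eq c \<theta> = 0 \<longrightarrow> circle_eq' c \<theta> \<noteq> 0)"

text \<open>
  In addition to transversality the vertices of all inscribed polygons that are used below are kept off
  the circle. The vertex with \<open>n = 2\<close> and \<open>k = 1\<close> is the point with parameter \<open>\<pi>\<close>, which the
  substitution by the tangent of the half angle misses.
\<close>

definition generic :: "real \<times> real \<Rightarrow> bool" where
  "generic c \<longleftrightarrow> transversal c \<and> (\<forall>n k. 0 < n \<longrightarrow> circle_eq c (2 * pi * real k / real n) \<noteq> 0)"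

definition crossings :: "real \<times> real \<Rightarrow> real set" where
  "crossings c = {\<theta> \<in> {0..<2 * pi}. circle_eq c \<theta> = 0}"

lemma circle_eq_deriv: "(circle_eq c has_real_derivative circle_eq' c \<theta>) (at \<theta>)"
  unfolding circle_eq_def[abs_def] circle_eq'_def
  by (auto intro!: derivative_eq_intros simp: algebra_simps)

lemma circle_eq_cont: "continuous_on A (circle_eq c)"
  using circle_eq_deriv by (meson DERIV_isCont continuous_at_imp_continuous_on)

lemma circle_eq_periodic: "circle_eq c (2 * pi) = circle_eq c 0"
  by (simp add: circle_eq_def)

lemma circle_eq_le_iff: "circle_eq c \<theta> \<le> 0 \<longleftrightarrow> (a * cos \<theta>, b * sin \<theta>) \<in> cball c r"
  and circle_eq_zero_iff: "circle_eq c \<theta> = 0 \<longleftrightarrow> (a * cos \<theta>, b * sin \<theta>) \<in> sphere c r"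
  using mem_cball_iff[of "a * cos \<theta>" "b * sin \<theta>" "fst c" "snd c"] mem_sphere_iff[of "a * cos \<theta>" "b * sin \<theta>" "fst
      c" "snd c"]
  by (auto simp: circle_eq_def power2_commute)

lemma param_in_curve: "(a * cos \<theta>, b * sin \<theta>) \<in> curve"
  using a_pos b_pos by (simp add: curve_def)

lemma curve_param:
  assumes "p \<in> curve"
  obtains \<theta> where "0 \<le> \<theta>" "\<theta> < 2 * pi" "p = (a * cos \<theta>, b * sin \<theta>)"
proof -
  have "(fst p / a)\<^sup>2 + (snd p / b)\<^sup>2 = 1" using assms by (auto simp: curve_def)
  then obtain \<theta> where "0 \<le> \<theta>" "\<theta> < 2 * pi" "fst p / a = cos \<theta>" "snd p / b = sin \<theta>"
    using sincos_total_2pi by metis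
  then show ?thesis using that[of \<theta>] a_pos b_pos by (cases p) (auto simp: field_simps)
qed

definition speed :: "real \<Rightarrow> real" where
  "speed \<theta> = sqrt (a\<^sup>2 * (sin \<theta>)\<^sup>2 + b\<^sup>2 * (cos \<theta>)\<^sup>2)"

lemma speed_support: "speed \<theta> = support (\<theta> - pi / 2)"
  by (simp add: speed_def support_def sin_diff cos_diff)

lemma speed_pos: "0 < speed \<theta>"
  unfolding speed_support by (rule support_bounds)

lemma speed_sq: "(speed \<theta>)\<^sup>2 = a\<^sup>2 * (sin \<theta>)\<^sup>2 + b\<^sup>2 * (cos \<theta>)\<^sup>2"
  unfolding speed_def by simp

text \<open>
  The normal at the parameter \<open>\<theta>\<close> is proportional to \<open>(b cos \<theta>, a sin \<theta>)\<close>, a vector of length \<open>speed \<theta>\<close>, and in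
  its direction the support function has the value \<open>a b / speed \<theta>\<close>.
\<close>

lemma normal_angle:
  obtains \<phi> where "cos \<phi> = b * cos \<theta> / speed \<theta>" "sin \<phi> = a * sin \<theta> / speed \<theta>"
    "offset_x 0 \<phi> = a * cos \<theta>" "offset_y 0 \<phi> = b * sin \<theta>"
proof -
  define w where "w = speed \<theta>"
  have w: "w > 0" unfolding w_def by (rule speed_pos)
  have w2: "(b * cos \<theta>)\<^sup>2 + (a * sin \<theta>)\<^sup>2 = w\<^sup>2" unfolding w_def speed_sq by (simp add: power_mult_distrib)
  have "(b * cos \<theta> / w)\<^sup>2 + (a * sin \<theta> / w)\<^sup>2 = 1"
    using w by (simp add: power_divide add_divide_distrib[symmetric] w2)
  then obtain \<phi> where \<phi>: "b * cos \<theta> / w = cos \<phi>" "a * sin \<theta> / w = sin \<phi>"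
    using sincos_total_2pi by metis
  have "a\<^sup>2 * (b * cos \<theta>)\<^sup>2 + b\<^sup>2 * (a * sin \<theta>)\<^sup>2 = (a * b)\<^sup>2"
    using sin_cos_squared_add[of \<theta>] by algebra
  then have "(support \<phi>)\<^sup>2 = (a * b / w)\<^sup>2"
    unfolding support_sq \<phi>[symmetric] by (simp add: power_divide add_divide_distrib[symmetric])
  then have h: "support \<phi> = a * b / w"
    using support_bounds(3)[of \<phi>] w a_pos b_pos by (simp add: power2_eq_iff_nonneg)
  have "offset_x 0 \<phi> = a * cos \<theta>" "offset_y 0 \<phi> = b * sin \<theta>"
    unfolding offset_x_def offset_y_def h \<phi>[symmetric] using w a_pos b_pos by (simp_all add: power2_eq_square)
  then show ?thesis using that[of \<phi>] \<phi> by (simp add: w_def)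
qed

definition parallel_curve :: "real \<Rightarrow> (real \<times> real) set" where
  "parallel_curve \<rho> = range (\<lambda>\<phi>. (offset_x \<rho> \<phi>, offset_y \<rho> \<phi>))"

text \<open>A circle that touches the ellipse has its centre on the normal at the point of contact, at distance \<open>r\<close>.\<close>

lemma not_transversal_in_parallel_curves:
  assumes "\<not> transversal c"
  shows "c \<in> parallel_curve r \<union> parallel_curve (- r)"
proof -
  obtain \<theta> where z: "circle_eq c \<theta> = 0" "circle_eq' c \<theta> = 0"
    using assms by (auto simp: transversal_def)
  obtain \<phi> where \<phi>: "cos \<phi> = b * cos \<theta> / speed \<theta>" "sin \<phi> = a * sin \<theta> / speed \<theta>"
    "offset_x 0 \<phi> = a * cos \<theta>" "offset_y 0 \<phi> = b * sin \<theta>" by (rule normal_angle)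
  define u v where "u = fst c - a * cos \<theta>" and "v = snd c - b * sin \<theta>"
  have uv: "u\<^sup>2 + v\<^sup>2 = r\<^sup>2" using z(1) by (simp add: circle_eq_def u_def v_def power2_commute)
  have "a * sin \<theta> * u = b * cos \<theta> * v" using z(2) by (simp add: circle_eq'_def u_def v_def algebra_simps)
  then have t: "sin \<phi> * u = cos \<phi> * v" unfolding \<phi> by (simp add: divide_simps)
  define k where "k = u * cos \<phi> + v * sin \<phi>"
  have u: "u = k * cos \<phi>" and v: "v = k * sin \<phi>"
    unfolding k_def using t sin_cos_squared_add[of \<phi>] by algebra+
  have "k\<^sup>2 = r\<^sup>2" using uv sin_cos_squared_add[of \<phi>] unfolding u v by algebra
  then have k: "k = r \<or> k = - r" by (simp add: power2_eq_iff)
  have "c = (offset_x k \<phi>, offset_y k \<phi>)"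
    unfolding offset_x_add[of k] offset_y_add[of k] \<phi>(3,4) u[symmetric] v[symmetric]
    by (simp add: u_def v_def)
  then show ?thesis using k unfolding parallel_curve_def by blast
qed

lemma negligible_parallel_curve: "negligible (parallel_curve \<rho>)"
  unfolding parallel_curve_def
proof (rule negligible_differentiable_image_lowdim)
  show "(\<lambda>\<phi>. (offset_x \<rho> \<phi>, offset_y \<rho> \<phi>)) differentiable_on UNIV"
    unfolding differentiable_on_def
    using has_derivative_Pair[OF offset_x_deriv[THEN has_field_derivative_imp_has_derivative]
        offset_y_deriv[THEN has_field_derivative_imp_has_derivative]]
    by (auto intro: differentiableI)
qed auto

lemma AE_notin_negligible: "negligible S \<Longrightarrow> AE x in lborel. x \<notin> (S :: 'a::euclidean_space set)"
  using AE_not_in[of S lebesgue] by (simp add: negligible_iff_null_sets AE_completion_iff)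

lemma AE_generic: "AE c in lborel. generic c"
proof -
  have 1: "AE c in lborel. c \<notin> parallel_curve r \<union> parallel_curve (- r)"
    by (intro AE_notin_negligible negligible_Un negligible_parallel_curve)
  have "AE c in lborel. circle_eq c \<theta> \<noteq> 0" for \<theta>
  proof -
    have "AE c in lborel. c \<notin> sphere (a * cos \<theta>, b * sin \<theta>) r"
      by (intro AE_notin_negligible negligible_sphere)
    then show ?thesis by eventually_elim (simp add: circle_eq_zero_iff dist_commute)
  qed
  then have 2: "AE c in lborel. \<forall>n k. circle_eq c (2 * pi * real k / real n) \<noteq> 0"
    by (subst AE_all_countable, intro allI, subst AE_all_countable) auto
  show ?thesis using 1 2
    by eventually_elim (use not_transversal_in_parallel_curves in \<open>auto simp: generic_def\<close>)
qed

text \<open>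
  In terms of \<open>t = tan (\<theta> / 2)\<close> the equation of the circle becomes a polynomial of degree at most \<open>4\<close>. Its
  leading coefficient is the value at \<open>\<theta> = \<pi>\<close>, hence it is not the zero polynomial.
\<close>

lemma crossings_le_4:
  assumes "circle_eq c pi \<noteq> 0"
  shows "finite (crossings c)" "card (crossings c) \<le> 4"
proof -
  define u v where "u = fst c" and "v = snd c"
  define P where "P = [: (a - u)\<^sup>2 + v\<^sup>2 - r\<^sup>2, - 4 * b * v, 4 * b\<^sup>2 + 2 * v\<^sup>2 - 2 * r\<^sup>2 - 2 * (a - u) * (a + u),
      - 4 * b * v, (a + u)\<^sup>2 + v\<^sup>2 - r\<^sup>2 :]"
  have P0: "P \<noteq> 0" using assms by (simp add: P_def circle_eq_def u_def v_def power2_eq_square algebra_simps)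
  have poly_eq: "poly P (tan (\<theta> / 2)) = (1 + (tan (\<theta> / 2))\<^sup>2)\<^sup>2 * circle_eq c \<theta>" if c0: "cos (\<theta> / 2) \<noteq> 0" for \<theta>
  proof -
    define t where "t = tan (\<theta> / 2)"
    have t1: "1 + t\<^sup>2 = 1 / (cos (\<theta> / 2))\<^sup>2" unfolding t_def using tan_sec[OF c0]
        by (simp add: inverse_eq_divide power_divide)
    have C: "(1 + t\<^sup>2) * cos \<theta> = 1 - t\<^sup>2"
    proof -
      have "cos \<theta> = (cos (\<theta> / 2))\<^sup>2 - (sin (\<theta> / 2))\<^sup>2" using cos_double[of "\<theta> / 2"] by simp
      then show ?thesis unfolding t1 using c0 by (simp add: t_def tan_def power_divide diff_divide_distrib)
    qed
    have S: "(1 + t\<^sup>2) * sin \<theta> = 2 * t"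
    proof -
      have "sin \<theta> = 2 * sin (\<theta> / 2) * cos (\<theta> / 2)" using sin_double[of "\<theta> / 2"] by simp
      then show ?thesis unfolding t1 using c0 by (simp add: t_def tan_def power2_eq_square)
    qed
    have "(1 + t\<^sup>2)\<^sup>2 * circle_eq c \<theta> = (a * ((1 + t\<^sup>2) * cos \<theta>) - u * (1 + t\<^sup>2))\<^sup>2 + (b * ((1 + t\<^sup>2) * sin \<theta>) -
        v * (1 + t\<^sup>2))\<^sup>2 - r\<^sup>2 * (1 + t\<^sup>2)\<^sup>2"
      unfolding circle_eq_def u_def v_def by algebra
    also have "\<dots> = poly P t" unfolding C S P_def by simp algebra
    finally show ?thesis by (simp add: t_def)
  qed
  have c0: "cos (\<theta> / 2) \<noteq> 0" if "\<theta> \<in> crossings c" for \<theta>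
  proof
    assume "cos (\<theta> / 2) = 0"
    moreover have "0 \<le> \<theta> / 2" "\<theta> / 2 \<le> pi" using that by (auto simp: crossings_def)
    ultimately have "\<theta> / 2 = pi / 2" using cos_inj_pi[of "\<theta> / 2" "pi / 2"] by simp
    then show False using that assms by (auto simp: crossings_def)
  qed
  have inj: "inj_on (\<lambda>\<theta>. tan (\<theta> / 2)) (crossings c)"
  proof (rule inj_onI)
    fix x y assume xy: "x \<in> crossings c" "y \<in> crossings c" "tan (x / 2) = tan (y / 2)"
    then have "sin (x / 2) * cos (y / 2) = sin (y / 2) * cos (x / 2)"
      using c0[of x] c0[of y] by (simp add: tan_def field_simps)
    then have "sin ((x - y) / 2) = 0" by (simp add: sin_diff diff_divide_distrib)
    moreover have "\<bar>(x - y) / 2\<bar> < pi" using xy by (auto simp: crossings_def abs_less_iff)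
    ultimately have "(x - y) / 2 = 0" using sin_eq_0_pi[of "(x - y) / 2"] by (simp add: abs_less_iff)
    then show "x = y" by simp
  qed
  have sub: "(\<lambda>\<theta>. tan (\<theta> / 2)) ` crossings c \<subseteq> {t. poly P t = 0}"
    using poly_eq c0 by (auto simp: crossings_def)
  have fin: "finite {t. poly P t = 0}" using P0 by (rule poly_roots_finite)
  then show "finite (crossings c)" using sub inj by (meson finite_imageD finite_subset)
  have "card (crossings c) \<le> card {t. poly P t = 0}"
    using card_inj_on_le[OF inj sub fin] .
  also have "\<dots> \<le> degree P" using P0 by (rule card_poly_roots_bound)
  also have "\<dots> \<le> 4" unfolding P_def by simp
  finally show "card (crossings c) \<le> 4" .
qed

definition changes :: "nat \<Rightarrow> real \<times> real \<Rightarrow> nat" where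
  "changes n c = sign_changes (circle_eq c) (2 * pi) n"

lemma generic_crossings:
  assumes "generic c"
  shows "finite (crossings c)" "card (crossings c) \<in> {0, 2, 4}"
    and "0 < n \<Longrightarrow> changes n c \<le> 4"
    and "\<forall>\<^sub>F n in sequentially. changes n c = card (crossings c)"
proof -
  have "circle_eq c (2 * pi * real 1 / real 2) \<noteq> 0" using assms unfolding generic_def by (metis zero_less_numeral)
  then have "circle_eq c pi \<noteq> 0" by simp
  note le4 = crossings_le_4[OF this]
  show fin: "finite (crossings c)" by (rule le4)
  have *: "0 < n \<Longrightarrow> changes n c \<le> card (crossings c)"
     "\<forall>\<^sub>F n in sequentially. changes n c = card (crossings c)" for n
    unfolding crossings_def changes_def
    using sign_changes_count_zeros[of "2 * pi" "circle_eq c" "circle_eq' c"] circle_eq_deriv assms fin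
    by (auto simp: generic_def transversal_def crossings_def)
  then show "0 < n \<Longrightarrow> changes n c \<le> 4"
     "\<forall>\<^sub>F n in sequentially. changes n c = card (crossings c)" using le4(2) by (auto intro: order_trans)
  have "\<forall>\<^sub>F n in sequentially. even (card (crossings c))"
    using *(2) eventually_gt_at_top[of 0]
    by eventually_elim (metis changes_def circle_eq_periodic even_sign_changes)
  then have "even (card (crossings c))" by simp
  then show "card (crossings c) \<in> {0, 2, 4}" using le4(2)
    by (auto elim!: evenE)
qed

lemma crossings_hits:
  assumes "\<theta> \<in> crossings c"
  shows "c \<in> hits"
proof -
  have "(a * cos \<theta>, b * sin \<theta>) \<in> cball c r"
    using assms circle_eq_le_iff[of c \<theta>] by (auto simp: crossings_def)
  then show ?thesis using param_in_curve curve_subset_region unfolding hits_def by blast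
qed

lemma changes_hits:
  assumes "0 < changes n c"
  shows "c \<in> hits"
proof -
  obtain k where "circle_eq c (2 * pi * real k / real n) \<le> 0 \<or> circle_eq c (2 * pi * real (Suc k) / real n) \<le> 0"
  proof -
    have "{k. k < n \<and> (circle_eq c (2 * pi * real k / real n)
        \<le> 0) \<noteq> (circle_eq c (2 * pi * real (Suc k) / real n) \<le> 0)} \<noteq> {}"
      using assms unfolding changes_def sign_changes_def by (metis card.empty less_irrefl)
    then show ?thesis using that by blast
  qed
  then obtain \<theta> where "circle_eq c \<theta> \<le> 0" by blast
  then have "(a * cos \<theta>, b * sin \<theta>) \<in> cball c r" by (simp add: circle_eq_le_iff)
  then show ?thesis using param_in_curve curve_subset_region unfolding hits_def by blast
qed

lemma inclusion_hits: "curve_in_disc \<union> circle_in_region \<subseteq> hits"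
proof
  fix c assume "c \<in> curve_in_disc \<union> circle_in_region"
  then show "c \<in> hits"
  proof
    assume "c \<in> curve_in_disc"
    then have "(a * cos 0, b * sin 0) \<in> cball c r" using param_in_curve unfolding curve_in_disc_def by blast
    then show ?thesis using param_in_curve[of 0] curve_subset_region unfolding hits_def by blast
  next
    assume "c \<in> circle_in_region"
    moreover have "(fst c + r, snd c) \<in> sphere c r"
      using mem_sphere_iff[of "fst c + r" "snd c" "fst c" "snd c"] by simp
    ultimately have "(fst c + r, snd c) \<in> region" unfolding circle_in_region_def by blast
    moreover have "(fst c + r, snd c) \<in> cball c r"
      using \<open>(fst c + r, snd c) \<in> sphere c r\<close> sphere_cball by blast
    ultimately show ?thesis unfolding hits_def by blast
  qed
qed

text \<open>
  If the two curves are nested, the equation of the circle does not change sign along the ellipse, and a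
  zero would be a tangency. Conversely, without zeros the ellipse lies either inside the disc or
  outside of it. In the latter case a segment from a common point of disc and region to a point
  of the circle stays in the disc, so it cannot leave the region.
\<close>

lemma inclusion_iff_no_crossings:
  assumes "transversal c" "c \<in> hits"
  shows "c \<in> curve_in_disc \<union> circle_in_region \<longleftrightarrow> crossings c = {}"
proof
  assume inc: "c \<in> curve_in_disc \<union> circle_in_region"
  show "crossings c = {}"
  proof (rule ccontr)
    assume "crossings c \<noteq> {}"
    then obtain \<theta> where z: "circle_eq c \<theta> = 0" by (auto simp: crossings_def)
    from inc have "circle_eq' c \<theta> = 0"
    proof
      assume "c \<in> curve_in_disc"
      then have "circle_eq c x \<le> circle_eq c \<theta>" for x
      proof -
        have "(a * cos x, b * sin x) \<in> cball c r"
          using \<open>c \<in> curve_in_disc\<close> param_in_curve unfolding curve_in_disc_def by blast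
        then show ?thesis using z circle_eq_le_iff by metis
      qed
      then show ?thesis by (intro DERIV_local_max[OF circle_eq_deriv zero_less_one]) blast
    next
      assume c: "c \<in> circle_in_region"
      have "circle_eq c \<theta> \<le> circle_eq c x" for x
      proof -
        obtain \<phi> where \<phi>: "offset_x 0 \<phi> = a * cos x" "offset_y 0 \<phi> = b * sin x"
          using normal_angle[of x] by metis
        have "(fst c + r * cos \<phi>, snd c + r * sin \<phi>) \<in> sphere (fst c, snd c) r"
          unfolding mem_sphere_iff by (simp add: power_mult_distrib distrib_left[symmetric])
        then have "(fst c + r * cos \<phi>, snd c + r * sin \<phi>) \<in> region" using c by (auto simp: circle_in_region_def)
        then have "(fst c + r * cos \<phi>) * cos \<phi> + (snd c + r * sin \<phi>) * sin \<phi> \<le> support \<phi>" by (rule region_support)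
        moreover have "a * cos x * cos \<phi> + b * sin x * sin \<phi> = support \<phi>"
          using offset_cos_sin[of 0 \<phi>] unfolding \<phi> by simp
        moreover have "(fst c + r * cos \<phi>) * cos \<phi> + (snd c + r * sin \<phi>) * sin \<phi> = fst c * cos \<phi> + snd c * sin \<phi> + r"
          using sin_cos_squared_add[of \<phi>] by algebra
        ultimately have "r \<le> (a * cos x - fst c) * cos \<phi> + (b * sin x - snd c) * sin \<phi>"
          by (simp add: left_diff_distrib)
        also have "\<dots> \<le> sqrt ((a * cos x - fst c)\<^sup>2 + (b * sin x - snd c)\<^sup>2)"
          by (rule component_le_norm) simp_all
        finally have "r\<^sup>2 \<le> (a * cos x - fst c)\<^sup>2 + (b * sin x - snd c)\<^sup>2"
          using r_pos by (simp add: real_le_rsqrt sqrt_ge_absD)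
        then have "0 \<le> circle_eq c x" by (simp add: circle_eq_def)
        then show ?thesis using z by simp
      qed
      then show ?thesis by (intro DERIV_local_min[OF circle_eq_deriv zero_less_one]) blast
    qed
    then show False using assms(1) z by (simp add: transversal_def)
  qed
next
  assume none: "crossings c = {}"
  have nz: "circle_eq c \<theta> \<noteq> 0" if "0 \<le> \<theta>" "\<theta> \<le> 2 * pi" for \<theta>
  proof (cases "\<theta> = 2 * pi")
    case True
    have "0 \<notin> crossings c" using none by simp
    then show ?thesis using True circle_eq_periodic by (simp add: crossings_def)
  next
    case False
    have "\<theta> \<notin> crossings c" using none by simp
    then show ?thesis using False that by (simp add: crossings_def)
  qed
  show "c \<in> curve_in_disc \<union> circle_in_region"
  proof (cases "circle_eq c 0 \<le> 0")
    case True
    have "circle_eq c \<theta> \<le> 0" if t: "0 \<le> \<theta>" "\<theta> < 2 * pi" for \<theta>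
    proof (rule ccontr)
      assume "\<not> circle_eq c \<theta> \<le> 0"
      then have "\<exists>x\<ge>0. x \<le> \<theta> \<and> circle_eq c x = 0" using True t by (intro IVT' circle_eq_cont) auto
      then show False using nz t by force
    qed
    then have "p \<in> cball c r" if "p \<in> curve" for p
      using curve_param[OF that] circle_eq_le_iff by metis
    then show ?thesis by (auto simp: curve_in_disc_def)
  next
    case False
    have pos: "\<not> circle_eq c \<theta> \<le> 0" if t: "0 \<le> \<theta>" "\<theta> < 2 * pi" for \<theta>
    proof
      assume "circle_eq c \<theta> \<le> 0"
      then have "\<exists>x\<ge>0. x \<le> \<theta> \<and> circle_eq c x = 0" using False t by (intro IVT2' circle_eq_cont) auto
      then show False using nz t by force
    qed
    then have off: "p \<notin> cball c r" if "p \<in> curve" for p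
      using curve_param[OF that] circle_eq_le_iff by metis
    obtain q where q: "q \<in> cball c r" "q \<in> region" using assms(2) by (auto simp: hits_def)
    have "w \<in> region" if w: "w \<in> sphere c r" for w
    proof (rule ccontr)
      assume "w \<notin> region"
      then obtain l where l: "0 \<le> l" "l < 1" "q + l *\<^sub>R (w - q) \<in> curve"
        using segment_meets_curve[OF q(2)] by blast
      have "(1 - l) *\<^sub>R q + l *\<^sub>R w \<in> cball c r"
        using q(1) w l by (intro convexD_alt convex_cball) auto
      moreover have "(1 - l) *\<^sub>R q + l *\<^sub>R w = q + l *\<^sub>R (w - q)" by (simp add: algebra_simps)
      ultimately show False using off[OF l(3)] by simp
    qed
    then show ?thesis by (auto simp: circle_in_region_def)
  qed
qed

end

section \<open>The integral of the number of intersections\<close>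

lemma midpoint_sums_converge:
  fixes F f :: "real \<Rightarrow> real"
  assumes T: "0 < T" and F: "\<And>x. 0 \<le> x \<Longrightarrow> x \<le> T \<Longrightarrow> (F has_real_derivative f x) (at x)"
    and cont: "continuous_on {0..T} f"
  shows "(\<lambda>n. \<Sum>k<n. f (T * (2 * real k + 1) / (2 * real n)) * (T / real n)) \<longlonglongrightarrow> F T - F 0"
proof (rule LIMSEQ_I)
  fix e :: real assume e: "0 < e"
  have "uniformly_continuous_on {0..T} f" using cont by (intro compact_uniformly_continuous) auto
  then obtain \<delta> where \<delta>: "0 < \<delta>" "\<And>x y. x \<in> {0..T} \<Longrightarrow> y \<in> {0..T} \<Longrightarrow> dist x y < \<delta> \<Longrightarrow> dist (f x) (f y) < e / (2 * T)"
    using e T unfolding uniformly_continuous_on_def by (metis divide_pos_pos mult_pos_pos zero_less_numeral)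
  have "norm ((\<Sum>k<n. f (T * (2 * real k + 1) / (2 * real n)) * (T / real n)) - (F T - F 0)) < e"
      if n: "nat \<lceil>T / \<delta>\<rceil> + 1 \<le> n" for n
  proof -
    have n0: "0 < n" and "T / \<delta> < real n" using n by linarith+
    then have mesh: "T / real n < \<delta>" using \<delta>(1) by (simp add: field_simps)
    define x where "x k = T * real k / real n" for k
    define m where "m k = T * (2 * real k + 1) / (2 * real n)" for k
    have step: "x (Suc k) = x k + T / real n" for k
      by (simp add: x_def field_simps add_divide_distrib)
    have mid: "m k = x k + T / real n / 2" for k
      using n0 by (simp add: x_def m_def field_simps)
    have x0: "0 \<le> x k" for k using T by (simp add: x_def)
    have xT: "x k \<le> T" if "k \<le> n" for k
    proof -
      have "x k \<le> T * real n / real n" unfolding x_def using that T by (intro divide_right_mono mult_left_mono) auto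
      then show ?thesis using n0 by simp
    qed
    have h: "0 < T / real n" using T n0 by simp
    have cell: "\<bar>f (m k) * (T / real n) - (F (x (Suc k)) - F (x k))\<bar> \<le> e / (2 * T) * (T / real n)" if k: "k < n" for k
    proof -
      have "\<exists>z>x k. z < x (Suc k) \<and> F (x (Suc k)) - F (x k) = (x (Suc k) - x k) * f z"
        using h step[of k] x0[of k] xT[of "Suc k"] k by (intro MVT2 F) auto
      then obtain z where z: "x k < z" "z < x (Suc k)" "F (x (Suc k)) - F (x k) = (T / real n) * f z"
        using step[of k] by auto
      have "dist (m k) z < \<delta>" using z mesh h step[of k] mid[of k] by (simp add: dist_real_def abs_less_iff)
      moreover have "m k \<in> {0..T}" "z \<in> {0..T}"
        using x0[of k] xT[of "Suc k"] k z h step[of k] mid[of k] by auto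
      ultimately have "\<bar>f (m k) - f z\<bar> \<le> e / (2 * T)" using \<delta>(2)[of "m k" z] by (simp add: dist_real_def)
      then have "\<bar>f (m k) - f z\<bar> * (T / real n) \<le> e / (2 * T) * (T / real n)" using h by (intro mult_right_mono) auto
      moreover have "f (m k) * (T / real n) - (F (x (Suc k)) - F (x k)) = (f (m k) - f z) * (T / real n)"
        unfolding z(3) by (simp only: left_diff_distrib mult.commute[of "T / real n"])
      ultimately show ?thesis by (simp only: abs_mult abs_of_pos[OF h])
    qed
    have "F T - F 0 = F (x n) - F (x 0)" using n0 by (simp add: x_def)
    also have "\<dots> = (\<Sum>k<n. F (x (Suc k)) - F (x k))" using sum_lessThan_telescope[of "\<lambda>k. F (x k)" n] by simp
    finally have "(\<Sum>k<n. f (m k) * (T / real n)) - (F T - F 0)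
        = (\<Sum>k<n. f (m k) * (T / real n) - (F (x (Suc k)) - F (x k)))"
      by (simp add: sum_subtractf)
    then have "\<bar>(\<Sum>k<n. f (m k) * (T / real n)) - (F T - F 0)\<bar>
        \<le> (\<Sum>k<n. \<bar>f (m k) * (T / real n) - (F (x (Suc k)) - F (x k))\<bar>)"
      by (simp only: sum_abs)
    also have "\<dots> \<le> (\<Sum>k<n. e / (2 * T) * (T / real n))"
      by (intro sum_mono cell) simp
    also have "\<dots> < e" using T n0 e by simp
    finally show ?thesis by (simp add: m_def)
  qed
  then show "\<exists>no. \<forall>n\<ge>no. norm ((\<Sum>k<n. f (T * (2 * real k + 1) / (2 * real n)) * (T / real n)) - (F T - F 0)) < e"
    by blast
qed

context ellipse_circle begin

text \<open>The discs have centres \<open>0\<close> and \<open>(d, 0)\<close>.\<close>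

definition disc_symdiff :: "real \<Rightarrow> (real \<times> real) set" where
  "disc_symdiff d = {(x, y). (x\<^sup>2 + y\<^sup>2 \<le> r\<^sup>2) \<noteq> ((x - d)\<^sup>2 + y\<^sup>2 \<le> r\<^sup>2)}"

lemma disc_symdiff_sets: "disc_symdiff d \<in> sets borel"
proof -
  have "closed {v :: real \<times> real. (fst v)\<^sup>2 + (snd v)\<^sup>2 \<le> r\<^sup>2}" (is "closed ?A")
    "closed {v :: real \<times> real. (fst v - d)\<^sup>2 + (snd v)\<^sup>2 \<le> r\<^sup>2}" (is "closed ?B")
    by (intro closed_Collect_le continuous_intros)+
  then have "(?A - ?B) \<union> (?B - ?A) \<in> sets borel" by auto
  also have "(?A - ?B) \<union> (?B - ?A) = disc_symdiff d" unfolding disc_symdiff_def by auto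
  finally show ?thesis .
qed

text \<open>
  A horizontal line at height \<open>y\<close> cuts both discs in intervals of half-length \<open>w = sqrt (r\<^sup>2 - y\<^sup>2)\<close>, shifted by \<open>d\<close>
  against each other. Their symmetric difference has length at most \<open>2 d\<close>, with equality as long as
  \<open>d \<le> 2 w\<close>.
\<close>

lemma emeasure_disc_symdiff:
  assumes d: "0 \<le> d"
  shows "emeasure lborel (disc_symdiff d) \<le> ennreal (4 * r * d)"
    and "d \<le> 2 * r \<Longrightarrow> ennreal (4 * sqrt (r\<^sup>2 - (d / 2)\<^sup>2) * d) \<le> emeasure lborel (disc_symdiff d)"
proof -
  let ?S = "\<lambda>y. {x. (x\<^sup>2 + y\<^sup>2 \<le> r\<^sup>2) \<noteq> ((x - d)\<^sup>2 + y\<^sup>2 \<le> r\<^sup>2)}"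
  have L: "disc_symdiff d \<in> sets (lborel \<Otimes>\<^sub>M lborel)"
    unfolding lborel_prod using disc_symdiff_sets by simp
  have "emeasure lborel (disc_symdiff d) = (\<integral>\<^sup>+ y. emeasure lborel ((\<lambda>x. (x, y)) -` disc_symdiff d) \<partial>lborel)"
    using lborel_pair.emeasure_pair_measure_alt2[OF L] by (simp add: lborel_prod)
  also have "\<dots> = (\<integral>\<^sup>+ y. emeasure lborel (?S y) \<partial>lborel)"
    by (simp add: disc_symdiff_def vimage_def)
  finally have E: "emeasure lborel (disc_symdiff d) = (\<integral>\<^sup>+ y. emeasure lborel (?S y) \<partial>lborel)" .
  have sq: "(z\<^sup>2 + y\<^sup>2 \<le> r\<^sup>2) \<longleftrightarrow> \<bar>z\<bar> \<le> sqrt (r\<^sup>2 - y\<^sup>2)" if "y\<^sup>2 \<le> r\<^sup>2" for y z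
  proof -
    have "\<bar>z\<bar> \<le> sqrt (r\<^sup>2 - y\<^sup>2) \<longleftrightarrow> z\<^sup>2 \<le> r\<^sup>2 - y\<^sup>2"
      using that abs_le_square_iff[of z "sqrt (r\<^sup>2 - y\<^sup>2)"] by simp
    then show ?thesis by linarith
  qed
  have S: "?S y = {x. (\<bar>x\<bar> \<le> sqrt (r\<^sup>2 - y\<^sup>2)) \<noteq> (\<bar>x - d\<bar> \<le> sqrt (r\<^sup>2 - y\<^sup>2))}" if "y\<^sup>2 \<le> r\<^sup>2" for y
    using sq[OF that] by simp
  have "emeasure lborel (?S y) \<le> ennreal (2 * d) * indicator {- r..r} y" for y
  proof (cases "\<bar>y\<bar> \<le> r")
    case True
    then have "y\<^sup>2 \<le> r\<^sup>2" by (simp add: abs_le_square_iff[symmetric])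
    define w where "w = sqrt (r\<^sup>2 - y\<^sup>2)"
    have w: "0 \<le> w" using \<open>y\<^sup>2 \<le> r\<^sup>2\<close> by (simp add: w_def)
    have "?S y \<subseteq> {- w..d - w} \<union> {w..d + w}"
      unfolding S[OF \<open>y\<^sup>2 \<le> r\<^sup>2\<close>] w_def[symmetric] using d w by auto
    then have "emeasure lborel (?S y) \<le> emeasure lborel ({- w..d - w} \<union> {w..d + w})"
      by (intro emeasure_mono) auto
    also have "\<dots> \<le> emeasure lborel {- w..d - w} + emeasure lborel {w..d + w}"
      by (intro emeasure_subadditive) auto
    also have "\<dots> = ennreal (2 * d)" using d by (simp add: ennreal_plus[symmetric] del: ennreal_plus)
    finally show ?thesis using True by (simp add: indicator_def abs_le_iff)
  next
    case False
    then have "\<not> y\<^sup>2 \<le> r\<^sup>2" using r_pos by (simp add: abs_le_square_iff[symmetric])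
    then have "\<not> z\<^sup>2 + y\<^sup>2 \<le> r\<^sup>2" for z using zero_le_power2[of z] by linarith
    then have "?S y = {}" by simp
    then show ?thesis by simp
  qed
  then have "emeasure lborel (disc_symdiff d) \<le> (\<integral>\<^sup>+ y. ennreal (2 * d) * indicator {- r..r} y \<partial>lborel)"
    unfolding E by (intro nn_integral_mono)
  also have "\<dots> = ennreal (4 * r * d)"
    using d r_pos by (simp add: nn_integral_cmult ennreal_mult'[symmetric] mult_ac)
  finally show "emeasure lborel (disc_symdiff d) \<le> ennreal (4 * r * d)" .
  assume d2: "d \<le> 2 * r"
  \<comment> \<open>The heights at which the two discs overlap.\<close>
  define \<rho> where "\<rho> = sqrt (r\<^sup>2 - (d / 2)\<^sup>2)"
  have "(d / 2)\<^sup>2 \<le> r\<^sup>2" using d d2 by (intro power_mono) auto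
  then have \<rho>: "0 \<le> \<rho>" "\<rho>\<^sup>2 = r\<^sup>2 - (d / 2)\<^sup>2" by (simp_all add: \<rho>_def)
  have "ennreal (2 * d) * indicator {- \<rho>..\<rho>} y \<le> emeasure lborel (?S y)" for y
  proof (cases "\<bar>y\<bar> \<le> \<rho>")
    case True
    then have "y\<^sup>2 \<le> \<rho>\<^sup>2" by (simp add: abs_le_square_iff[symmetric])
    then have y: "(d / 2)\<^sup>2 \<le> r\<^sup>2 - y\<^sup>2" and y': "y\<^sup>2 \<le> r\<^sup>2" using \<rho>(2) zero_le_power2[of "d / 2"] by linarith+
    define w where "w = sqrt (r\<^sup>2 - y\<^sup>2)"
    have w: "d / 2 \<le> w" unfolding w_def using y by (intro real_le_rsqrt)
    have "{- w..<d - w} \<union> {w<..d + w} \<subseteq> ?S y"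
      unfolding S[OF y'] w_def[symmetric] using d w by auto
    moreover have "?S y \<in> sets borel"
    proof -
      have "(\<lambda>x. (x, y)) -` disc_symdiff d \<in> sets lborel" using sets_Pair2[OF L] .
      then show ?thesis by (simp add: disc_symdiff_def vimage_def)
    qed
    ultimately have "emeasure lborel ({- w..<d - w} \<union> {w<..d + w}) \<le> emeasure lborel (?S y)"
      by (intro emeasure_mono) auto
    moreover have "emeasure lborel ({- w..<d - w} \<union> {w<..d + w})
        = emeasure lborel {- w..<d - w} + emeasure lborel {w<..d + w}"
      using w by (intro plus_emeasure[symmetric]) auto
    moreover have "\<dots> = ennreal (2 * d)" using d by (simp add: ennreal_plus[symmetric] del: ennreal_plus)
    ultimately show ?thesis using True by (simp add: indicator_def abs_le_iff)
  next
    case False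
    then show ?thesis by (auto simp: indicator_def)
  qed
  then have "(\<integral>\<^sup>+ y. ennreal (2 * d) * indicator {- \<rho>..\<rho>} y \<partial>lborel) \<le> emeasure lborel (disc_symdiff d)"
    unfolding E by (intro nn_integral_mono)
  moreover have "(\<integral>\<^sup>+ y. ennreal (2 * d) * indicator {- \<rho>..\<rho>} y \<partial>lborel) = ennreal (4 * \<rho> * d)"
    using d \<rho>(1) by (simp add: nn_integral_cmult ennreal_mult'[symmetric] mult_ac)
  ultimately show "ennreal (4 * sqrt (r\<^sup>2 - (d / 2)\<^sup>2) * d) \<le> emeasure lborel (disc_symdiff d)"
    by (simp add: \<rho>_def)
qed

definition vertex :: "nat \<Rightarrow> nat \<Rightarrow> real \<times> real" where
  "vertex n k = ellipse_point (2 * pi * real k / real n)"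

definition separating :: "real \<times> real \<Rightarrow> real \<times> real \<Rightarrow> (real \<times> real) set" where
  "separating p q = {c. (p \<in> cball c r) \<noteq> (q \<in> cball c r)}"

lemma emeasure_separating: "emeasure lborel (separating p q) = emeasure lborel (disc_symdiff (dist p q))"
proof -
  define d where "d = dist p q"
  define z where "z = Complex (fst q - fst p) (snd q - snd p)"
  obtain \<psi> where \<psi>: "z = rcis (cmod z) \<psi>" using rcis_Ex by (metis rcis_cmod_Arg)
  have cz: "cmod z = d" by (simp add: z_def d_def cmod_def dist_prod_def dist_real_def power2_commute)
  have q: "fst q - fst p = d * cos \<psi>" "snd q - snd p = d * sin \<psi>"
    using arg_cong[OF \<psi>, of Re] arg_cong[OF \<psi>, of Im] unfolding cz by (simp_all add: z_def)
  have "c \<in> separating p q \<longleftrightarrow> rot (- \<psi>) (c - p) \<in> disc_symdiff d" for c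
  proof -
    define u v where "u = fst c - fst p" and "v = snd c - snd p"
    have e1: "(u * cos \<psi> + v * sin \<psi>)\<^sup>2 + (v * cos \<psi> - u * sin \<psi>)\<^sup>2 = u\<^sup>2 + v\<^sup>2"
      using sin_cos_squared_add[of \<psi>] by algebra
    have e2: "(u * cos \<psi> + v * sin \<psi> - d)\<^sup>2 + (v * cos \<psi> - u * sin \<psi>)\<^sup>2 = (u - d * cos \<psi>)\<^sup>2 + (v - d * sin \<psi>)\<^sup>2"
      using sin_cos_squared_add[of \<psi>] by algebra
    have "p \<in> cball c r \<longleftrightarrow> u\<^sup>2 + v\<^sup>2 \<le> r\<^sup>2"
      using mem_cball_iff[of "fst p" "snd p" "fst c" "snd c"] by (simp add: u_def v_def)
    moreover have "q \<in> cball c r \<longleftrightarrow> (u - d * cos \<psi>)\<^sup>2 + (v - d * sin \<psi>)\<^sup>2 \<le> r\<^sup>2"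
    proof -
      have "u - d * cos \<psi> = fst c - fst q" "v - d * sin \<psi> = snd c - snd q" using q by (auto simp: u_def v_def)
      then show ?thesis using mem_cball_iff[of "fst q" "snd q" "fst c" "snd c"] by simp
    qed
    moreover have "rot (- \<psi>) (c - p) = (u * cos \<psi> + v * sin \<psi>, v * cos \<psi> - u * sin \<psi>)"
      by (simp add: rot_def u_def v_def)
    ultimately show ?thesis by (simp add: separating_def disc_symdiff_def e1 e2)
  qed
  then have sep: "separating p q = {c. - p + c \<in> rot (- \<psi>) -` disc_symdiff d}" by auto
  have "rot (- \<psi>) -` disc_symdiff d \<in> sets borel"
    by (rule measurable_sets_borel[OF rot_measurable disc_symdiff_sets])
  then have "emeasure lborel (separating p q) = emeasure lborel (rot (- \<psi>) -` disc_symdiff d)"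
    unfolding sep by (rule emeasure_lborel_shift)
  then show ?thesis by (simp add: emeasure_rot_vimage disc_symdiff_sets d_def)
qed

lemma separating_sets [measurable]: "separating p q \<in> sets borel"
proof -
  have "separating p q = (cball p r - cball q r) \<union> (cball q r - cball p r)"
    by (auto simp: separating_def dist_commute)
  then show ?thesis by auto
qed

lemma separating_fmeasurable: "emeasure lborel (separating p q) < \<infinity>"
  unfolding emeasure_separating using emeasure_disc_symdiff(1)[of "dist p q"]
  by (auto simp: le_less_trans)

lemma measure_separating:
  "measure lborel (separating p q) \<le> 4 * r * dist p q"
  "dist p q \<le> 2 * r \<Longrightarrow> 4 * sqrt (r\<^sup>2 - (dist p q / 2)\<^sup>2) * dist p q \<le> measure lborel (separating p q)"
proof -
  have e: "emeasure lborel (separating p q) = ennreal (measure lborel (separating p q))"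
    using separating_fmeasurable[of p q] by (simp add: emeasure_eq_ennreal_measure)
  note b = emeasure_disc_symdiff[of "dist p q", unfolded emeasure_separating[symmetric] e]
  show "measure lborel (separating p q) \<le> 4 * r * dist p q"
    using b(1) r_pos by (simp add: ennreal_le_iff)
  show "4 * sqrt (r\<^sup>2 - (dist p q / 2)\<^sup>2) * dist p q \<le> measure lborel (separating p q)" if "dist p q \<le> 2 * r"
    using b(2) that by (simp add: ennreal_le_iff)
qed

lemma changes_eq_sum:
  "real (changes n c) = (\<Sum>k<n. indicat_real (separating (vertex n k) (vertex n (Suc k))) c)"
proof -
  have "changes n c = card {k \<in> {..<n}. c \<in> separating (vertex n k) (vertex n (Suc k))}"
    unfolding changes_def sign_changes_def circle_eq_le_iff separating_def vertex_def ellipse_point_def by simp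
  then show ?thesis by (simp add: indicator_def sum.If_cases Int_def)
qed

lemma changes_measurable [measurable]: "(\<lambda>c. real (changes n c)) \<in> borel_measurable borel"
  unfolding changes_eq_sum by measurable

lemma integral_changes:
  "(\<integral>c. real (changes n c) \<partial>lborel) = (\<Sum>k<n. measure lborel (separating (vertex n k) (vertex n (Suc k))))"
  unfolding changes_eq_sum
  by (subst Bochner_Integration.integral_sum) (auto intro!: integrable_real_indicator separating_fmeasurable
      simp: less_top[symmetric] simp del: of_nat_Suc)

text \<open>
  The chord between the parameters \<open>m - h\<close> and \<open>m + h\<close> is parallel to the tangent at \<open>m\<close>, and the addition theorems
  give its exact length.
\<close>

lemma dist_vertex:
  assumes "0 < n"
  shows "dist (vertex n k) (vertex n (Suc k))
    = 2 * sin (pi / real n) * speed (2 * pi * (2 * real k + 1) / (2 * real n))"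
proof -
  define m h where "m = 2 * pi * (2 * real k + 1) / (2 * real n)" and "h = pi / real n"
  have t: "2 * pi * real k / real n = m - h" "2 * pi * real (Suc k) / real n = m + h"
    using assms by (simp_all add: m_def h_def field_simps)
  have h: "0 \<le> sin h" unfolding h_def using assms by (intro sin_ge_zero) (auto simp: field_simps)
  have "(dist (ellipse_point (m - h)) (ellipse_point (m + h)))\<^sup>2
      = (a * cos (m - h) - a * cos (m + h))\<^sup>2 + (b * sin (m - h) - b * sin (m + h))\<^sup>2"
    by (simp add: ellipse_point_def dist_Pair_Pair dist_real_def)
  also have "\<dots> = (2 * sin h)\<^sup>2 * (a\<^sup>2 * (sin m)\<^sup>2 + b\<^sup>2 * (cos m)\<^sup>2)"
    unfolding cos_diff cos_add sin_diff sin_add by algebra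
  also have "\<dots> = (2 * sin h * speed m)\<^sup>2" unfolding power_mult_distrib speed_sq ..
  finally have "dist (ellipse_point (m - h)) (ellipse_point (m + h)) = 2 * sin h * speed m"
    using h speed_pos[of m] by (subst (asm) power2_eq_iff_nonneg) auto
  then show ?thesis unfolding vertex_def t by (simp add: m_def h_def)
qed

text \<open>
  The integrand has period \<open>\<pi>\<close> and is symmetric about \<open>\<pi>/2\<close>, so that each quarter of the ellipse
  contributes the same.
\<close>

lemma elliptic_quarters: "elliptic (5 / 2 * pi) - elliptic (pi / 2) = 4 * elliptic (pi / 2)"
proof -
  have cont: "continuous_on {0..} elliptic"
    using elliptic_deriv by (intro continuous_at_imp_continuous_on) (auto intro: DERIV_isCont)
  have symm: "support (pi - x) = support x" "support (x + pi) = support x" for x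
    by (simp_all add: support_def cos_diff cos_add sin_diff sin_add)
  have half: "elliptic pi = 2 * elliptic (pi / 2)"
  proof -
    have "((\<lambda>x. elliptic x + elliptic (pi - x)) has_real_derivative 0) (at x)" if "0 < x" "x < pi / 2" for x
    proof -
      have "((\<lambda>x. pi - x) has_real_derivative - 1) (at x)" by (auto intro!: derivative_eq_intros)
      from DERIV_add[OF elliptic_deriv[of x] DERIV_chain2[OF elliptic_deriv[of "pi - x"] this]] that
      show ?thesis by (simp add: symm)
    qed
    moreover have "continuous_on {0..pi / 2} (\<lambda>x. elliptic x + elliptic (pi - x))"
      using pi_gt_zero by (intro continuous_intros continuous_on_compose2[OF cont]) auto
    ultimately have "elliptic (pi / 2) + elliptic (pi - pi / 2) = elliptic 0 + elliptic (pi - 0)"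
      using DERIV_isconst_end[of 0 "pi / 2" "\<lambda>x. elliptic x + elliptic (pi - x)"] pi_gt_zero by simp
    then show ?thesis by (simp add: elliptic_def)
  qed
  have shift: "elliptic (y + pi) = elliptic y + elliptic pi" if y: "0 < y" for y
  proof -
    have "((\<lambda>x. elliptic (x + pi) - elliptic x) has_real_derivative 0) (at x)" if "0 < x" for x
    proof -
      have "((\<lambda>x. x + pi) has_real_derivative 1) (at x)" by (auto intro!: derivative_eq_intros)
      from DERIV_diff[OF DERIV_chain2[OF elliptic_deriv[of "x + pi"] this] elliptic_deriv[of x]] that pi_gt_zero
      show ?thesis by (simp add: symm)
    qed
    moreover have "continuous_on {0..y} (\<lambda>x. elliptic (x + pi) - elliptic x)"
      using pi_gt_zero by (intro continuous_intros continuous_on_compose2[OF cont]) auto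
    ultimately have "elliptic (y + pi) - elliptic y = elliptic (0 + pi) - elliptic 0"
      using DERIV_isconst_end[of 0 y "\<lambda>x. elliptic (x + pi) - elliptic x"] y by simp
    then show ?thesis by (simp add: elliptic_def)
  qed
  have "elliptic (5 / 2 * pi) = elliptic ((pi / 2 + pi) + pi)" by (simp add: field_simps)
  also have "\<dots> = elliptic (pi / 2) + elliptic pi + elliptic pi"
    using shift[of "pi / 2 + pi"] shift[of "pi / 2"] pi_gt_zero by simp
  finally show ?thesis using half by simp
qed

text \<open>
  Up to the factor \<open>sin (\<pi>/n) / (\<pi>/n)\<close>, the length of the inscribed polygon is a midpoint sum for the integral of
  the speed.
\<close>

lemma perimeter_limit:
  "(\<lambda>n. \<Sum>k<n. dist (vertex n k) (vertex n (Suc k))) \<longlonglongrightarrow> 4 * a * complete_ellE (ecc a b)"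
proof -
  define R where "R n = (\<Sum>k<n. speed (2 * pi * (2 * real k + 1) / (2 * real n)) * (2 * pi / real n))" for n
  have "R \<longlonglongrightarrow> a * elliptic (2 * pi + pi / 2) - a * elliptic (0 + pi / 2)"
    unfolding R_def
  proof (rule midpoint_sums_converge)
    show "((\<lambda>x. a * elliptic (x + pi / 2)) has_real_derivative speed x) (at x)" if "0 \<le> x" "x \<le> 2 * pi" for x
    proof -
      have "support (x + pi / 2) = speed x" by (simp add: support_def speed_def cos_add sin_add)
      moreover have "((\<lambda>x. x + pi / 2) has_real_derivative 1) (at x)" by (auto intro!: derivative_eq_intros)
      from DERIV_cmult[OF DERIV_chain2[OF elliptic_deriv[of "x + pi / 2"] this], of a]
      have "((\<lambda>x. a * elliptic (x + pi / 2)) has_real_derivative a * (support (x + pi / 2) / a * 1)) (at x)"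
        using that pi_gt_zero by simp
      ultimately show ?thesis using a_pos by simp
    qed
    show "continuous_on {0..2 * pi} speed"
      unfolding speed_def by (intro continuous_intros)
  qed simp
  moreover have "a * elliptic (2 * pi + pi / 2) - a * elliptic (0 + pi / 2) = 4 * a * complete_ellE (ecc a b)"
  proof -
    have "2 * pi + pi / 2 = 5 / 2 * pi" by simp
    then show ?thesis using elliptic_quarters pi_gt_zero
      by (simp add: elliptic_eq[symmetric] right_diff_distrib[symmetric])
  qed
  ultimately have R: "R \<longlonglongrightarrow> 4 * a * complete_ellE (ecc a b)" by simp
  have "(\<lambda>n. sin (pi / real n) / (pi / real n)) \<longlonglongrightarrow> 1"
  proof -
    have "filterlim (\<lambda>n. pi / real n) (at 0) sequentially"
      unfolding filterlim_at
    proof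
      show "\<forall>\<^sub>F n in sequentially. pi / real n \<in> UNIV \<and> pi / real n \<noteq> 0"
        using eventually_gt_at_top[of 0] by eventually_elim auto
      show "(\<lambda>n. pi / real n) \<longlonglongrightarrow> 0" by (rule lim_const_over_n)
    qed
    moreover have "((\<lambda>x::real. sin x / x) \<longlongrightarrow> 1) (at 0)"
      using DERIV_sin[of 0] by (simp add: has_field_derivative_iff)
    ultimately show ?thesis by (rule filterlim_compose[rotated])
  qed
  from tendsto_mult[OF this R]
  have "(\<lambda>n. sin (pi / real n) / (pi / real n) * R n) \<longlonglongrightarrow> 4 * a * complete_ellE (ecc a b)" by simp
  moreover have "\<forall>\<^sub>F n in sequentially. sin (pi / real n) / (pi / real n) * R n =
     (\<Sum>k<n. dist (vertex n k) (vertex n (Suc k)))"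
    using eventually_gt_at_top[of 0]
  proof eventually_elim
    case (elim n)
    have key: "sin (pi / real n) / (pi / real n) * (s * (2 * pi / real n)) = 2 * sin (pi / real n) * s" for s
      using elim by (simp add: field_simps)
    show ?case unfolding R_def sum_distrib_left
      by (intro sum.cong refl) (simp only: key dist_vertex[OF elim])
  qed
  ultimately show ?thesis by (rule Lim_transform_eventually)
qed

text \<open>Summed over the edges, both bounds for the areas of the separating sets tend to \<open>4 r\<close> times the perimeter.\<close>

lemma integral_changes_limit:
  "(\<lambda>n. \<integral>c. real (changes n c) \<partial>lborel) \<longlonglongrightarrow> 16 * r * a * complete_ellE (ecc a b)"
proof -
  define d where "d n k = dist (vertex n k) (vertex n (Suc k))" for n k
  define D where "D n = (\<Sum>k<n. d n k)" for n
  have D: "D \<longlonglongrightarrow> 4 * a * complete_ellE (ecc a b)" using perimeter_limit unfolding D_def d_def .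
  have s0: "(\<lambda>n. sin (pi / real n)) \<longlonglongrightarrow> 0"
    using tendsto_sin[OF lim_const_over_n[of pi]] by simp
  have "(\<lambda>n. 4 * sqrt (r\<^sup>2 - (sin (pi / real n) * a)\<^sup>2) * D n) \<longlonglongrightarrow> 4 * sqrt (r\<^sup>2 - (0 * a)\<^sup>2) * (4 * a *
      complete_ellE (ecc a b))"
    by (intro tendsto_intros s0 D)
  then have lo: "(\<lambda>n. 4 * sqrt (r\<^sup>2 - (sin (pi / real n) * a)\<^sup>2) * D n) \<longlonglongrightarrow> 16 * r * a * complete_ellE (ecc a b)"
    using r_pos by (simp add: mult_ac)
  have "(\<lambda>n. 4 * r * D n) \<longlonglongrightarrow> 4 * r * (4 * a * complete_ellE (ecc a b))" by (intro tendsto_intros D)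
  then have up: "(\<lambda>n. 4 * r * D n) \<longlonglongrightarrow> 16 * r * a * complete_ellE (ecc a b)" by (simp add: mult_ac)
  have "(\<lambda>n. sin (pi / real n) * a) \<longlonglongrightarrow> 0" using tendsto_mult_right[OF s0, of a] by simp
  then have small: "\<forall>\<^sub>F n in sequentially. sin (pi / real n) * a < r"
    using r_pos by (rule order_tendstoD)
  show ?thesis
  proof (rule tendsto_sandwich[OF _ _ lo up])
    show "\<forall>\<^sub>F n in sequentially. (\<integral>c. real (changes n c) \<partial>lborel) \<le> 4 * r * D n"
      unfolding integral_changes D_def sum_distrib_left d_def
      by (intro always_eventually allI sum_mono measure_separating)
    show "\<forall>\<^sub>F n in sequentially. 4 * sqrt (r\<^sup>2 - (sin (pi / real n) * a)\<^sup>2) * D n \<le> (\<integral>c. real (changes n c) \<partial>lborel)"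
      using small eventually_gt_at_top[of 0]
    proof eventually_elim
      case (elim n)
      have sn: "0 \<le> sin (pi / real n)" using elim by (intro sin_ge_zero) (auto simp: field_simps)
      have dk: "d n k / 2 \<le> sin (pi / real n) * a" "0 \<le> d n k" for k
      proof -
        have "d n k / 2 = sin (pi / real n) * speed (2 * pi * (2 * real k + 1) / (2 * real n))"
          unfolding d_def using dist_vertex[OF elim(2)] by simp
        also have "\<dots> \<le> sin (pi / real n) * a"
          using sn support_bounds(2) by (intro mult_left_mono) (auto simp: speed_support)
        finally show "d n k / 2 \<le> sin (pi / real n) * a" .
      qed (simp add: d_def)
      have "4 * sqrt (r\<^sup>2 - (sin (pi / real n) * a)\<^sup>2) * d n k
          \<le> measure lborel (separating (vertex n k) (vertex n (Suc k)))" for k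
      proof -
        have "(d n k / 2)\<^sup>2 \<le> (sin (pi / real n) * a)\<^sup>2" using dk[of k] by (intro power_mono) auto
        then have "4 * sqrt (r\<^sup>2 - (sin (pi / real n) * a)\<^sup>2) * d n k \<le> 4 * sqrt (r\<^sup>2 - (d n k / 2)\<^sup>2) * d n k"
          using dk[of k] by (intro mult_right_mono mult_left_mono real_sqrt_le_mono) auto
        also have "\<dots> \<le> measure lborel (separating (vertex n k) (vertex n (Suc k)))"
          unfolding d_def using dk(1)[of k] elim(1) by (intro measure_separating(2)) (simp add: d_def)
        finally show ?thesis .
      qed
      then show ?case unfolding integral_changes D_def sum_distrib_left by (intro sum_mono)
    qed
  qed
qed

section \<open>The areas of the positions with two and four intersections\<close>

text \<open>For generic \<open>c\<close> this is the number of crossings. Being a limit of step functions, it is Borel measurable.\<close>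

definition num_crossings :: "real \<times> real \<Rightarrow> real" where
  "num_crossings c = lim (\<lambda>n. real (changes n c))"

lemma num_crossings_measurable [measurable]: "num_crossings \<in> borel_measurable borel"
  unfolding num_crossings_def by measurable

lemma generic_num_crossings:
  assumes "generic c"
  shows "(\<lambda>n. real (changes n c)) \<longlonglongrightarrow> num_crossings c" "num_crossings c = real (card (crossings c))"
proof -
  have "\<forall>\<^sub>F n in sequentially. real (changes n c) = real (card (crossings c))"
    using generic_crossings(4)[OF assms] by eventually_elim simp
  then have l: "(\<lambda>n. real (changes n c)) \<longlonglongrightarrow> real (card (crossings c))" by (rule tendsto_eventually)
  then show "num_crossings c = real (card (crossings c))" unfolding num_crossings_def by (rule limI)
  then show "(\<lambda>n. real (changes n c)) \<longlonglongrightarrow> num_crossings c" using l by simp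
qed

lemma num_crossings_hits:
  assumes "num_crossings c = real k" "0 < k"
  shows "c \<in> hits"
proof (rule ccontr)
  assume "c \<notin> hits"
  then have "changes n c = 0" for n using changes_hits by blast
  then have "num_crossings c = 0" unfolding num_crossings_def by (intro limI) simp
  then show False using assms by simp
qed

definition crossed :: "nat \<Rightarrow> (real \<times> real) set" where
  "crossed k = {c. num_crossings c = real k}"

lemma crossed_sets [measurable]: "crossed k \<in> sets borel"
proof -
  have "num_crossings -` {real k} \<inter> space borel \<in> sets borel" by measurable
  then show ?thesis by (simp add: crossed_def vimage_def)
qed

lemma emeasure_hits_finite: "emeasure lborel hits < \<infinity>"
  using area_hits by (simp add: has_area_def)

text \<open>The numbers of sign changes are dominated by \<open>4\<close> on the bounded set of hitting positions.\<close>

lemma integral_num_crossings: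
  "(\<integral>c. num_crossings c \<partial>lborel) = 16 * r * a * complete_ellE (ecc a b)"
proof -
  have h [measurable]: "hits \<in> sets borel" using hits_compact by (rule borel_compact)
  \<comment> \<open>The shift of the index excludes \<open>n = 0\<close>, where there is no polygon.\<close>
  have "(\<lambda>n. \<integral>c. real (changes (Suc n) c) \<partial>lborel) \<longlonglongrightarrow> (\<integral>c. num_crossings c \<partial>lborel)"
  proof (rule integral_dominated_convergence[where w = "\<lambda>c. 4 * indicat_real hits c"])
    show "AE c in lborel. (\<lambda>n. real (changes (Suc n) c)) \<longlonglongrightarrow> num_crossings c"
      using AE_generic by eventually_elim (rule LIMSEQ_Suc, rule generic_num_crossings)
    show "AE c in lborel. norm (real (changes (Suc n) c)) \<le> 4 * indicat_real hits c" for n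
      using AE_generic
    proof eventually_elim
      case (elim c)
      have "changes (Suc n) c \<le> 4" using generic_crossings(3)[OF elim] by simp
      then show ?case using changes_hits[of "Suc n" c] by (cases "changes (Suc n) c = 0") (auto simp: indicator_def)
    qed
    show "integrable lborel (\<lambda>c. 4 * indicat_real hits c)"
      using emeasure_hits_finite by (intro integrable_mult_right integrable_real_indicator) auto
  qed measurable
  moreover have "(\<lambda>n. \<integral>c. real (changes (Suc n) c) \<partial>lborel) \<longlonglongrightarrow> 16 * r * a * complete_ellE (ecc a b)"
    using integral_changes_limit by (rule LIMSEQ_Suc)
  ultimately show ?thesis by (rule LIMSEQ_unique)
qed

text \<open>
  Two linear equations for two areas: generic hitting positions are either nested or have two or four
  crossings, and the integral of the number of crossings is known.
\<close>

lemma area_crossed: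
  shows "measure lborel (crossed 2) = 2 * pi * r\<^sup>2 + 2 * pi * a * b - m_incl a b r / pi" (is ?A2)
    and "measure lborel (crossed 4) = 4 * r * a * complete_ellE (ecc a b) - pi * r\<^sup>2 - pi * a * b + m_incl a b r
        / (2 * pi)" (is ?A4)
    and "emeasure lborel (crossed 2) < \<infinity>" "emeasure lborel (crossed 4) < \<infinity>" 
    and "0 \<le> m_incl a b r" "0 \<le> complete_ellE (ecc a b)"
proof -
  let ?I = "curve_in_disc \<union> circle_in_region"
  have h [measurable]: "hits \<in> sets borel" using hits_compact by (rule borel_compact)
  have I [measurable]: "?I \<in> sets borel" using curve_in_disc_closed circle_in_region_closed by auto
  have sub: "crossed 2 \<subseteq> hits" "crossed 4 \<subseteq> hits"
    using num_crossings_hits unfolding crossed_def by fastforce+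
  show f: "emeasure lborel (crossed 2) < \<infinity>" "emeasure lborel (crossed 4) < \<infinity>"
    using emeasure_mono[OF sub(1), of lborel] emeasure_mono[OF sub(2), of lborel] emeasure_hits_finite
    by (auto intro: le_less_trans)
  have fI: "emeasure lborel ?I < \<infinity>" using area_inclusion by (simp add: has_area_def)
  have E0: "0 \<le> ellE (pi / 2) (ecc a b)"
  proof -
    have "elliptic 0 \<le> elliptic (pi / 2)"
    proof (rule DERIV_nonneg_imp_nondecreasing[where f = elliptic])
      show "\<exists>y. (elliptic has_real_derivative y) (at x) \<and> 0 \<le> y" if "0 \<le> x" "x \<le> pi / 2" for x
        using elliptic_deriv[OF that(1)] support_bounds(3)[of x] a_pos by (intro exI conjI) auto
    qed simp
    then show ?thesis by (simp add: elliptic_eq ellE_def)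
  qed
  then show "0 \<le> complete_ellE (ecc a b)" .
  show "0 \<le> m_incl a b r"
    using area_inclusion pi_gt_zero by (auto simp: has_area_def zero_le_divide_iff)
  have mh: "measure lborel hits = pi * a * b + pi * r\<^sup>2 + 4 * r * a * complete_ellE (ecc a b)"
    using area_hits by (simp add: has_area_def measure_def)
  have mI: "measure lborel ?I = m_incl a b r / (2 * pi)"
    using area_inclusion unfolding has_area_def measure_def by simp
  have "AE c in lborel. num_crossings c = 2 * indicat_real (crossed 2) c + 4 * indicat_real (crossed 4) c"
    using AE_generic
  proof eventually_elim
    case (elim c)
    show ?case using generic_crossings(2)[OF elim] generic_num_crossings(2)[OF elim]
      by (auto simp: crossed_def indicator_def)
  qed
  then have "(\<integral>c. num_crossings c \<partial>lborel) = (\<integral>c. 2 * indicat_real (crossed 2) c + 4 * indicat_real (crossed 4)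
      c \<partial>lborel)"
    by (intro integral_cong_AE) measurable
  also have "\<dots> = 2 * measure lborel (crossed 2) + 4 * measure lborel (crossed 4)"
    using f by (subst Bochner_Integration.integral_add) (auto intro!: integrable_mult_right integrable_real_indicator)
  finally have 1: "2 * measure lborel (crossed 2) + 4 * measure lborel (crossed 4)
      = 16 * r * a * complete_ellE (ecc a b)"
    using integral_num_crossings by simp
  have "measure lborel (crossed 2 \<union> crossed 4) = measure lborel (hits - ?I)"
  proof (rule measure_eq_AE)
    show "AE c in lborel. c \<in> crossed 2 \<union> crossed 4 \<longleftrightarrow> c \<in> hits - ?I"
      using AE_generic
    proof eventually_elim
      case (elim c)
      have t: "transversal c" using elim by (simp add: generic_def)
      have "c \<in> crossed 2 \<union> crossed 4 \<longleftrightarrow> crossings c \<noteq> {}"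
        using generic_crossings(1,2)[OF elim] generic_num_crossings(2)[OF elim] by (auto simp: crossed_def)
      moreover have "crossings c \<noteq> {} \<Longrightarrow> c \<in> hits" using crossings_hits by blast
      ultimately show ?case using inclusion_iff_no_crossings[OF t] by blast
    qed
  qed measurable
  moreover have "measure lborel (crossed 2 \<union> crossed 4) = measure lborel (crossed 2) + measure lborel (crossed 4)"
    using f by (intro measure_Union) (auto simp: crossed_def)
  moreover have "measure lborel (hits - ?I) = measure lborel hits - measure lborel ?I"
    using inclusion_hits emeasure_hits_finite fI by (intro measure_Diff) auto
  ultimately have 2: "measure lborel (crossed 2) + measure lborel (crossed 4)
      = measure lborel hits - measure lborel ?I" by simp
  have m2: "m_incl a b r / pi = 2 * (m_incl a b r / (2 * pi))" by simp
  show ?A2 using 1 2 unfolding mh mI m2 by linarith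
  show ?A4 using 1 2 unfolding mh mI by linarith
qed

end

section \<open>From the moving frame to the random throw\<close>

lemma norm_rot: "norm (rot \<psi> v) = norm v"
proof -
  have "(fst (rot \<psi> v))\<^sup>2 + (snd (rot \<psi> v))\<^sup>2 = (fst v)\<^sup>2 + (snd v)\<^sup>2"
    unfolding rot_def fst_conv snd_conv using sin_cos_squared_add[of \<psi>] by algebra
  then show ?thesis by (simp add: norm_prod_def)
qed

lemma rot_diff: "rot \<psi> (v - w) = rot \<psi> v - rot \<psi> w"
  by (simp add: rot_def algebra_simps)

lemma place_eq: "place M \<psi> v = M + rot \<psi> v"
  by (simp add: place_def rot_def case_prod_beta')

lemma unplace_place: "unplace M \<psi> (place M \<psi> v) = v" and place_unplace: "place M \<psi> (unplace M \<psi> p) = p"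
  by (simp_all add: unplace_def place_eq rot_rot)

lemma dist_unplace: "dist (unplace M \<psi> p) (unplace M \<psi> q) = dist p q"
  unfolding unplace_def dist_norm rot_diff[symmetric] norm_rot by simp

lemma mem_place_image: "p \<in> place M \<psi> ` S \<longleftrightarrow> unplace M \<psi> p \<in> S"
  using unplace_place place_unplace by (metis imageE imageI)

lemma vanishing_order_simple:
  assumes "f x = 0" "(f has_real_derivative d) (at x)" "d \<noteq> 0"
  shows "vanishing_order f x = 1"
proof (rule antisym)
  have "deriv f x \<noteq> 0" using DERIV_imp_deriv[OF assms(2)] assms(3) by simp
  then have "1 \<in> {k. (deriv ^^ k) f x \<noteq> 0}" by simp
  then have "vanishing_order f x \<le> enat 1" unfolding vanishing_order_def by (rule INF_lower)
  then show "vanishing_order f x \<le> 1" by (simp add: one_enat_def)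
  show "1 \<le> vanishing_order f x"
    unfolding vanishing_order_def
  proof (rule INF_greatest)
    fix k assume "k \<in> {k. (deriv ^^ k) f x \<noteq> 0}"
    then have "k \<noteq> 0" using assms(1) by (cases k) auto
    then show "1 \<le> enat k" by (simp add: one_enat_def)
  qed
qed

context ellipse_circle begin

lemma ellipse_eq: "ellipse a b M \<psi> = place M \<psi> ` curve"
  and ellipse_region_eq: "ellipse_region a b M \<psi> = place M \<psi> ` region"
  by (simp_all add: ellipse_def ellipse_region_def curve_def region_def)

lemma mem_cball_unplace: "p \<in> cball c r \<longleftrightarrow> unplace M \<psi> p \<in> cball (unplace M \<psi> c) r"
  and mem_sphere_unplace: "p \<in> sphere c r \<longleftrightarrow> unplace M \<psi> p \<in> sphere (unplace M \<psi> c) r"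
  by (simp_all add: dist_unplace)

lemma meets_iff_hits: "ellipse_region a b M \<psi> \<inter> cball c r \<noteq> {} \<longleftrightarrow> unplace M \<psi> c \<in> hits"
proof -
  have "ellipse_region a b M \<psi> \<inter> cball c r \<noteq> {}
      \<longleftrightarrow> (\<exists>p. unplace M \<psi> p \<in> region \<and> unplace M \<psi> p \<in> cball (unplace M \<psi> c) r)"
    unfolding ellipse_region_eq using mem_place_image[of _ M \<psi> region] mem_cball_unplace[of _ c M \<psi>] by blast
  also have "\<dots> \<longleftrightarrow> (\<exists>v. v \<in> region \<and> v \<in> cball (unplace M \<psi> c) r)"
    using unplace_place by metis
  finally show ?thesis unfolding hits_def by blast
qed

lemma included_iff:
  "ellipse a b M \<psi> \<subseteq> cball c r \<longleftrightarrow> unplace M \<psi> c \<in> curve_in_disc"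
  "sphere c r \<subseteq> ellipse_region a b M \<psi> \<longleftrightarrow> unplace M \<psi> c \<in> circle_in_region"
proof -
  have "ellipse a b M \<psi> \<subseteq> cball c r \<longleftrightarrow> (\<forall>p. unplace M \<psi> p \<in> curve \<longrightarrow> unplace M \<psi> p \<in> cball (unplace M \<psi> c) r)"
    unfolding ellipse_eq using mem_place_image[of _ M \<psi> curve] mem_cball_unplace[of _ c M \<psi>] by blast
  also have "\<dots> \<longleftrightarrow> (\<forall>v. v \<in> curve \<longrightarrow> v \<in> cball (unplace M \<psi> c) r)"
    using unplace_place by metis
  finally show "ellipse a b M \<psi> \<subseteq> cball c r \<longleftrightarrow> unplace M \<psi> c \<in> curve_in_disc"
    unfolding curve_in_disc_def by blast
  have "sphere c r \<subseteq> ellipse_region a b M \<psi> \<longleftrightarrow> (\<forall>p. unplace M \<psi> p \<in> sphere (unplace M \<psi> c) r \<longrightarrow> unplace M \<psi> p \<in> region)"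
    unfolding ellipse_region_eq using mem_place_image[of _ M \<psi> region] mem_sphere_unplace[of _ c M \<psi>] by blast
  also have "\<dots> \<longleftrightarrow> (\<forall>v. v \<in> sphere (unplace M \<psi> c) r \<longrightarrow> v \<in> region)"
    using unplace_place by metis
  finally show "sphere c r \<subseteq> ellipse_region a b M \<psi> \<longleftrightarrow> unplace M \<psi> c \<in> circle_in_region"
    unfolding circle_in_region_def by blast
qed

lemma inj_on_ellipse_point: "inj_on ellipse_point {0..<2 * pi}"
proof (rule inj_onI)
  fix x y assume xy: "x \<in> {0..<2 * pi}" "y \<in> {0..<2 * pi}" "ellipse_point x = ellipse_point y"
  then have "cos x = cos y" "sin x = sin y" using a_pos b_pos by (auto simp: ellipse_point_def)
  then have "cos (x - y) = 1" unfolding cos_diff using sin_cos_squared_add3[of y] by simp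
  then have "cos \<bar>x - y\<bar> = 1" by (simp add: abs_if cos_diff mult.commute)
  then obtain n :: int where n: "x - y = of_int n * 2 * pi" using \<open>cos (x - y) = 1\<close> cos_one_2pi_int by blast
  have "\<bar>x - y\<bar> < 2 * pi" using xy by auto
  then have "\<bar>real_of_int n\<bar> < 1" unfolding n by (simp add: abs_mult)
  then have "n = 0" by linarith
  then show "x = y" using n by simp
qed

lemma circle_eq_unplace: "(dist (ellipse_param a b M \<psi> \<theta>) c)\<^sup>2 - r\<^sup>2 = circle_eq (unplace M \<psi> c) \<theta>"
proof -
  have "dist (ellipse_param a b M \<psi> \<theta>) c = dist (ellipse_point \<theta>) (unplace M \<psi> c)"
    unfolding ellipse_param_def ellipse_point_def[symmetric]
    using dist_unplace[of M \<psi> "place M \<psi> (ellipse_point \<theta>)" c] by (simp add: unplace_place)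
  then show ?thesis by (simp add: circle_eq_def ellipse_point_def dist_prod_def dist_real_def)
qed

lemma common_points: "ellipse a b M \<psi> \<inter> sphere c r = (\<lambda>\<theta>. place M \<psi> (ellipse_point \<theta>)) ` crossings (unplace M \<psi> c)"
proof (intro equalityI subsetI)
  fix p assume p: "p \<in> ellipse a b M \<psi> \<inter> sphere c r"
  then have "unplace M \<psi> p \<in> curve" unfolding ellipse_eq by (simp add: mem_place_image)
  then obtain \<theta> where t: "0 \<le> \<theta>" "\<theta> < 2 * pi" "unplace M \<psi> p = ellipse_point \<theta>"
    unfolding ellipse_point_def by (rule curve_param)
  have "ellipse_point \<theta> \<in> sphere (unplace M \<psi> c) r" using p mem_sphere_unplace[of p c M \<psi>] t(3) by auto
  then have "\<theta> \<in> crossings (unplace M \<psi> c)" using t unfolding crossings_def circle_eq_zero_iff ellipse_point_def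
      by simp
  moreover have "p = place M \<psi> (ellipse_point \<theta>)" using t(3) place_unplace by metis
  ultimately show "p \<in> (\<lambda>\<theta>. place M \<psi> (ellipse_point \<theta>)) ` crossings (unplace M \<psi> c)" by blast
next
  fix p assume "p \<in> (\<lambda>\<theta>. place M \<psi> (ellipse_point \<theta>)) ` crossings (unplace M \<psi> c)"
  then obtain \<theta> where t: "\<theta> \<in> crossings (unplace M \<psi> c)" "p = place M \<psi> (ellipse_point \<theta>)" by blast
  have "ellipse_point \<theta> \<in> sphere (unplace M \<psi> c) r" using t(1)
      unfolding crossings_def ellipse_point_def circle_eq_zero_iff by blast
  moreover have "unplace M \<psi> p = ellipse_point \<theta>" using t(2) by (simp add: unplace_place)
  moreover have "ellipse_point \<theta> \<in> curve" unfolding ellipse_point_def by (rule param_in_curve)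
  ultimately show "p \<in> ellipse a b M \<psi> \<inter> sphere c r"
    unfolding ellipse_eq using mem_place_image[of p M \<psi> curve] mem_sphere_unplace[of p c M \<psi>] by simp
qed

text \<open>The multiplicity is the order of vanishing of \<open>circle_eq\<close>, whose zeros are simple for a transversal circle.\<close>

lemma multiplicity_one:
  assumes "transversal (unplace M \<psi> c)" "p \<in> ellipse a b M \<psi> \<inter> sphere c r"
  shows "intersection_multiplicity a b r M \<psi> c p = 1"
proof -
  obtain \<theta> where t: "\<theta> \<in> crossings (unplace M \<psi> c)" "p = place M \<psi> (ellipse_point \<theta>)"
    using assms(2) unfolding common_points by blast
  have "(THE \<theta>. 0 \<le> \<theta> \<and> \<theta> < 2 * pi \<and> ellipse_param a b M \<psi> \<theta> = p) = \<theta>"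
  proof (rule the_equality)
    show "0 \<le> \<theta> \<and> \<theta> < 2 * pi \<and> ellipse_param a b M \<psi> \<theta> = p"
      using t by (simp add: crossings_def ellipse_param_def ellipse_point_def)
    fix \<theta>' assume t': "0 \<le> \<theta>' \<and> \<theta>' < 2 * pi \<and> ellipse_param a b M \<psi> \<theta>' = p"
    then have "ellipse_point \<theta>' = ellipse_point \<theta>"
      using t(2) unplace_place unfolding ellipse_param_def ellipse_point_def by metis
    then show "\<theta>' = \<theta>" using inj_on_ellipse_point t(1) t' by (auto simp: inj_on_def crossings_def)
  qed
  then have "intersection_multiplicity a b r M \<psi> c p = vanishing_order (circle_eq (unplace M \<psi> c)) \<theta>"
    by (simp add: intersection_multiplicity_def circle_eq_unplace)
  also have "\<dots> = 1"
    using t(1) assms(1) by (intro vanishing_order_simple[OF _ circle_eq_deriv]) (auto simp: crossings_def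
        transversal_def)
  finally show ?thesis .
qed

lemma card_common_points: "card (ellipse a b M \<psi> \<inter> sphere c r) = card (crossings (unplace M \<psi> c))"
  unfolding common_points
proof (rule card_image)
  show "inj_on (\<lambda>\<theta>. place M \<psi> (ellipse_point \<theta>)) (crossings (unplace M \<psi> c))"
  proof (rule inj_onI)
    fix x y assume xy: "x \<in> crossings (unplace M \<psi> c)" "y \<in> crossings (unplace M \<psi> c)" "place M \<psi> (ellipse_point
        x) = place M \<psi> (ellipse_point y)"
    then have "ellipse_point x = ellipse_point y" by (metis unplace_place)
    then show "x = y" using inj_on_ellipse_point xy by (auto simp: inj_on_def crossings_def)
  qed
qed

text \<open>At most one circle contributes, and its contribution is the number of its crossings.\<close>

lemma num_intersections_generic:
  assumes gen: "\<And>c. c \<in> lattice_points s t \<sigma> \<Longrightarrow> generic (unplace M \<psi> c)"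
    and one: "meets_at_most_one a b r s t \<sigma> M \<psi>"
  shows "k \<in> {2, 4} \<Longrightarrow> num_intersections a b r s t \<sigma> M \<psi> = enat k
      \<longleftrightarrow> (\<exists>c\<in>lattice_points s t \<sigma>. unplace M \<psi> c \<in> crossed k)"
    and "num_intersections a b r s t \<sigma> M \<psi> \<noteq> 0 \<longleftrightarrow> (\<exists>c\<in>lattice_points s t \<sigma>. unplace M \<psi> c \<in> crossed 2 \<union> crossed 4)"
proof -
  let ?L = "lattice_points s t \<sigma>"
  let ?I = "SIGMA c:?L. ellipse a b M \<psi> \<inter> sphere c r"
  let ?N = "num_intersections a b r s t \<sigma> M \<psi>"
  have crossed: "unplace M \<psi> c \<in> crossed k \<longleftrightarrow> card (crossings (unplace M \<psi> c)) = k" if "c \<in> ?L" for c k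
    using generic_num_crossings(2)[OF gen[OF that]] by (simp add: crossed_def)
  have vals: "card (crossings (unplace M \<psi> c)) \<in> {0, 2, 4}" "finite (crossings (unplace M \<psi> c))" if "c \<in> ?L" for c
    using generic_crossings(1,2)[OF gen[OF that]] by auto
  have uniq: "c = c'" if "c \<in> ?L" "c' \<in> ?L" "crossings (unplace M \<psi> c) \<noteq> {}" "crossings (unplace M \<psi> c') \<noteq> {}"
      for c c'
    using one that crossings_hits unfolding meets_at_most_one_def meets_iff_hits by blast
  have "(k \<in> {2, 4} \<longrightarrow> (?N = enat k \<longleftrightarrow> (\<exists>c\<in>?L. unplace M \<psi> c \<in> crossed k))) \<and> (?N \<noteq> 0
      \<longleftrightarrow> (\<exists>c\<in>?L. unplace M \<psi> c \<in> crossed 2 \<union> crossed 4))" for k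
  proof (cases "\<exists>c\<in>?L. crossings (unplace M \<psi> c) \<noteq> {}")
    case False
    then have "?I = {}" by (auto simp: common_points)
    then have "?N = 0" unfolding num_intersections_def Let_def by (simp only:) simp
    moreover have "unplace M \<psi> c \<notin> crossed k" if "c \<in> ?L" "k \<noteq> 0" for c k
      using crossed[OF that(1)] False that by auto
    ultimately show ?thesis by (auto simp: zero_enat_def)
  next
    case True
    then obtain c0 where c0: "c0 \<in> ?L" "crossings (unplace M \<psi> c0) \<noteq> {}" by blast
    let ?n = "card (crossings (unplace M \<psi> c0))"
    have empty: "crossings (unplace M \<psi> c) = {}" if "c \<in> ?L" "c \<noteq> c0" for c
      using uniq[OF that(1) c0(1) _ c0(2)] that by blast
    have "?I = {c0} \<times> (ellipse a b M \<psi> \<inter> sphere c0 r)"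
      using c0 empty by (auto simp: common_points)
    moreover have "finite (ellipse a b M \<psi> \<inter> sphere c0 r)"
      unfolding common_points using vals(2)[OF c0(1)] by simp
    moreover have "(\<Sum>(c, p)\<in>{c0} \<times> (ellipse a b M \<psi> \<inter> sphere c0 r). intersection_multiplicity a b r M \<psi> c p)
        = (\<Sum>(c, p)\<in>{c0} \<times> (ellipse a b M \<psi> \<inter> sphere c0 r). 1)"
    proof (rule sum.cong[OF refl])
      fix z assume "z \<in> {c0} \<times> (ellipse a b M \<psi> \<inter> sphere c0 r)"
      then obtain p where "z = (c0, p)" "p \<in> ellipse a b M \<psi> \<inter> sphere c0 r" by blast
      then show "(case z of (c, p) \<Rightarrow> intersection_multiplicity a b r M \<psi> c p) = (case z of (c, p) \<Rightarrow> 1)"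
        using multiplicity_one[of M \<psi> c0 p] gen[OF c0(1)] by (simp only: generic_def prod.case)
    qed
    ultimately have N: "?N = enat ?n"
      unfolding num_intersections_def Let_def
      by (simp only: finite_cartesian_product finite.intros if_True)
         (simp add: case_prod_beta' card_common_points of_nat_eq_enat)
    have n: "?n = 2 \<or> ?n = 4" using vals[OF c0(1)] c0(2) by auto
    have K: "(\<exists>c\<in>?L. unplace M \<psi> c \<in> crossed k) \<longleftrightarrow> ?n = k" if "k \<noteq> 0" for k
      using crossed c0 empty that by (metis card.empty)
    have "(\<exists>c\<in>?L. unplace M \<psi> c \<in> crossed 2 \<union> crossed 4) \<longleftrightarrow>
        (\<exists>c\<in>?L. unplace M \<psi> c \<in> crossed 2) \<or> (\<exists>c\<in>?L. unplace M \<psi> c \<in> crossed 4)" by blast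
    then show ?thesis unfolding N using n K[of 2] K[of 4] by (auto simp: zero_enat_def)
  qed
  then show "k \<in> {2, 4} \<Longrightarrow> ?N = enat k \<longleftrightarrow> (\<exists>c\<in>?L. unplace M \<psi> c \<in> crossed k)"
    and "?N \<noteq> 0 \<longleftrightarrow> (\<exists>c\<in>?L. unplace M \<psi> c \<in> crossed 2 \<union> crossed 4)" by blast+
qed

end

context lattice begin

lemma prob_space_throw: "prob_space (throw s t \<sigma>)"
proof -
  interpret A: prob_space centres by (rule prob_space_cell)
  interpret A2: prob_space angles by (rule prob_space_angle)
  interpret P: pair_prob_space centres angles ..
  show ?thesis
    unfolding throw_def
  proof (rule prob_spaceI)
    have "emeasure (completion throw_space) (space throw_space)
        = emeasure throw_space (main_part throw_space (space throw_space))"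
      by (intro emeasure_completion sets_completionI_sets sets.top)
    also have "\<dots> = 1" unfolding main_part[OF sets.top] by (rule P.emeasure_space_1)
    finally show "emeasure (completion throw_space) (space (completion throw_space)) = 1" unfolding space_completion .
  qed
qed

lemma prob_throw_not:
  assumes "{\<omega> \<in> space (throw s t \<sigma>). \<not> Q \<omega>} \<in> sets (throw s t \<sigma>)"
  shows "measure (throw s t \<sigma>) {\<omega> \<in> space (throw s t \<sigma>). Q \<omega>}
      = 1 - measure (throw s t \<sigma>) {\<omega> \<in> space (throw s t \<sigma>). \<not> Q \<omega>}"
proof -
  have "{\<omega> \<in> space (throw s t \<sigma>). Q \<omega>} = space (throw s t \<sigma>) - {\<omega> \<in> space (throw s t \<sigma>). \<not> Q \<omega>}" by auto
  then show ?thesis using prob_space.prob_compl[OF prob_space_throw assms] by simp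
qed

end

theorem corollary5p1:
  fixes a b r s t \<sigma> :: real
  assumes "0 < b" "b \<le> a" "0 < r" "0 < s" "0 < t" "0 < \<sigma>" "\<sigma> \<le> pi / 2"
    and "2 * (a + r) \<le> min s t"
    and "AE (M, \<psi>) in throw s t \<sigma>. meets_at_most_one a b r s t \<sigma> M \<psi>"
  shows
    "p_num a b r s t \<sigma> 0 =
       1 - (2 * pi\<^sup>2 * r\<^sup>2 + 2 * pi\<^sup>2 * a * b + 8 * pi * r * a * complete_ellE (ecc a b) - m_incl a b r)
           / (2 * pi * s * t * sin \<sigma>)
     \<and> p_num a b r s t \<sigma> 2 =
       (2 * pi\<^sup>2 * r\<^sup>2 + 2 * pi\<^sup>2 * a * b - m_incl a b r) / (pi * s * t * sin \<sigma>)
     \<and> p_num a b r s t \<sigma> 4 =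
       (8 * pi * r * a * complete_ellE (ecc a b) - 2 * pi\<^sup>2 * r\<^sup>2 - 2 * pi\<^sup>2 * a * b + m_incl a b r)
           / (2 * pi * s * t * sin \<sigma>)
     \<and> p_incl a b r s t \<sigma> = m_incl a b r / (2 * pi * s * t * sin \<sigma>)
     \<and> p_ext a b r s t \<sigma> =
       1 - (2 * pi\<^sup>2 * r\<^sup>2 + 2 * pi\<^sup>2 * a * b + 8 * pi * r * a * complete_ellE (ecc a b))
           / (2 * pi * s * t * sin \<sigma>)"
proof -
  interpret ellipse_circle a b r using assms(1-3) by unfold_locales
  interpret lattice s t \<sigma> using assms(4-7) by unfold_locales
  define A where "A = s * t * sin \<sigma>"
  have A: "0 < A" using s_pos height_pos by (simp add: A_def mult.assoc)
  have one: "AE \<omega> in throw_space. meets_at_most_one a b r s t \<sigma> (fst \<omega>) (snd \<omega>)"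
    using assms(9) unfolding throw_def AE_completion_iff by (simp add: case_prod_beta')
  have gen: "AE \<omega> in throw_space. \<forall>c\<in>\<Lambda>. generic (position \<omega> c)"
    using AE_generic by (rule AE_unplace)
  \<comment> \<open>Two lattice points with position in \<open>B\<close> would be the centres of two circles that are hit.\<close>
  have uniq: "AE \<omega> in throw_space. \<forall>c\<in>\<Lambda>. \<forall>c'\<in>\<Lambda>. position \<omega> c \<in> B \<longrightarrow> position \<omega> c' \<in> B \<longrightarrow> c = c'"
    if "B \<subseteq> hits" for B
    using one by eventually_elim (use that in \<open>unfold meets_at_most_one_def meets_iff_hits, blast\<close>)
  have prob: "{\<omega> \<in> space (throw s t \<sigma>). Q \<omega>} \<in> sets (throw s t \<sigma>)"
      "measure (throw s t \<sigma>) {\<omega> \<in> space (throw s t \<sigma>). Q \<omega>} = m / A"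
    if "B \<in> sets borel" "has_area B m" "B \<subseteq> hits" "AE \<omega> in throw_space. Q \<omega> \<longleftrightarrow> (\<exists>c\<in>\<Lambda>. position \<omega> c \<in> B)" for B m Q
    using prob_throw[of B m Q] that uniq[OF that(3)] unfolding has_area_def A_def by blast+
  have area_m: "has_area B (measure lborel B)" if "emeasure lborel B < \<infinity>" for B
    using that by (simp add: has_area_def emeasure_eq_ennreal_measure)
  have sub: "crossed 2 \<subseteq> hits" "crossed 4 \<subseteq> hits"
    using num_crossings_hits unfolding crossed_def by fastforce+
  let ?N = "\<lambda>\<omega>. num_intersections a b r s t \<sigma> (fst \<omega>) (snd \<omega>)"
  have ae: "AE \<omega> in throw_space. ?N \<omega> = enat k \<longleftrightarrow> (\<exists>c\<in>\<Lambda>. position \<omega> c \<in> crossed k)" if "k \<in> {2, 4}" for k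
    using one gen by eventually_elim (use num_intersections_generic(1) that in blast)
  have p2: "p_num a b r s t \<sigma> 2 = measure lborel (crossed 2) / A"
    using prob(2)[OF crossed_sets area_m[OF area_crossed(3)] sub(1) ae[of 2]]
    by (simp add: p_num_def case_prod_beta' numeral_eq_enat)
  have p4: "p_num a b r s t \<sigma> 4 = measure lborel (crossed 4) / A"
    using prob(2)[OF crossed_sets area_m[OF area_crossed(4)] sub(2) ae[of 4]]
    by (simp add: p_num_def case_prod_beta' numeral_eq_enat)
  have p0: "p_num a b r s t \<sigma> 0 = 1 - (measure lborel (crossed 2) + measure lborel (crossed 4)) / A"
  proof -
    have "AE \<omega> in throw_space. ?N \<omega> \<noteq> 0 \<longleftrightarrow> (\<exists>c\<in>\<Lambda>. position \<omega> c \<in> crossed 2 \<union> crossed 4)"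
      using one gen by eventually_elim (use num_intersections_generic(2) in blast)
    moreover have "has_area (crossed 2 \<union> crossed 4) (measure lborel (crossed 2) + measure lborel (crossed 4))"
    proof -
      have "emeasure lborel (crossed 2 \<union> crossed 4) = emeasure lborel (crossed 2) + emeasure lborel (crossed 4)"
        by (intro plus_emeasure[symmetric]) (auto simp: crossed_def[of 2] crossed_def[of 4] simp flip: crossed_def)
      then show ?thesis using area_m[OF area_crossed(3)] area_m[OF area_crossed(4)] by (simp add: has_area_def)
    qed
    ultimately have *: "{\<omega> \<in> space (throw s t \<sigma>). \<not> (?N \<omega> = 0)} \<in> sets (throw s t \<sigma>)"
      "measure (throw s t \<sigma>) {\<omega> \<in> space (throw s t \<sigma>). \<not> (?N \<omega> = 0)}
          = (measure lborel (crossed 2) + measure lborel (crossed 4)) / A"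
      using prob[of "crossed 2 \<union> crossed 4" _ "\<lambda>\<omega>. \<not> (?N \<omega> = 0)"] sub by auto
    show ?thesis using prob_throw_not[OF *(1)] *(2) by (simp add: p_num_def case_prod_beta')
  qed
  have pi': "p_incl a b r s t \<sigma> = m_incl a b r / (2 * pi) / A"
  proof -
    have "curve_in_disc \<union> circle_in_region \<in> sets borel"
      using curve_in_disc_closed circle_in_region_closed by auto
    from prob(2)[OF this area_inclusion inclusion_hits AE_I2, of "\<lambda>\<omega>. \<exists>c\<in>\<Lambda>. position \<omega> c \<in> curve_in_disc \<union>
        circle_in_region"]
    show ?thesis by (simp add: p_incl_def case_prod_beta' included_iff)
  qed
  have pe: "p_ext a b r s t \<sigma> = 1 - (pi * a * b + pi * r\<^sup>2 + 4 * r * a * complete_ellE (ecc a b)) / A"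
  proof -
    have e: "cball c r \<inter> ellipse_region a b M \<psi> = {} \<longleftrightarrow> unplace M \<psi> c \<notin> hits" for c M \<psi>
      using meets_iff_hits[of M \<psi> c] by (subst Int_commute) blast
    let ?Q = "\<lambda>\<omega>. \<forall>c\<in>\<Lambda>. position \<omega> c \<notin> hits"
    have "AE \<omega> in throw_space. \<not> ?Q \<omega> \<longleftrightarrow> (\<exists>c\<in>\<Lambda>. position \<omega> c \<in> hits)" by simp
    note * = prob[OF borel_compact[OF hits_compact] area_hits subset_refl this]
    show ?thesis using prob_throw_not[OF *(1)] *(2) by (simp add: p_ext_def case_prod_beta' e)
  qed
  have denom: "2 * pi * s * t * sin \<sigma> = 2 * pi * A" "pi * s * t * sin \<sigma> = pi * A" by (simp_all add: A_def)
  show ?thesis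
    unfolding p0 p2 p4 pi' pe area_crossed(1,2) denom
    using A by (simp add: field_simps power2_eq_square)
qed

end
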